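(* Let $G$ be a finite group. Then there exist a positive integer $d$ and an infinite-dimensional graded virtual $\mathbb{C}[G]$-module $V^G=\bigoplus_{n\in\{-d\}\cup\mathbb{N}}V_n^G$ such that for every $g\in G$ the McKay–Thompson series $\mathrm{Tr}(g\mid V^G):=\sum_n\mathrm{Tr}(g\mid V_n^G)q^n$ is a weakly holomorphic modular function strictly of level $\mathrm{ord}(g)$, and such that $V_n^G$ fails to be a genuine (non-virtual) $\mathbb{C}[G]$-module for only finitely many $n$.
   Context: $q=e^{2\pi i\tau}$; $\mathbb{N}$ denotes the natural numbers; $\mathrm{ord}(g)$ is the order of $g$. A virtual $\mathbb{C}[G]$-module is a formal $\mathbb{Z}$-linear combination of irreducible representations (coefficients possibly negative); it is genuine if all coefficients are nonnegative. $\Gamma_0(N)$ is the subgroup of $\mathrm{SL}_2(\mathbb{Z})$ of matrices with lower-left entry divisible by $N$. A weakly holomorphic modular function on $\Gamma_0(N)$ is a holomorphic $\Gamma_0(N)$-invariant function on the upper half-plane with at most poles at the cusps; it is strictly of level $N$ if it is not invariant under $\Gamma_0(M)$ for any proper divisor $M\mid N$. *)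

theory Defs
  imports
    "HOL-Complex_Analysis.Complex_Analysis"
    "HOL-Algebra.Free_Abelian_Groups"
    "HOL-Algebra.Multiplicative_Group"
    "Jordan_Normal_Form.VS_Connect"
begin

section \<open>Complex representations and virtual modules\<close>

text \<open>Finite-dimensional \<open>\<complex>[G]\<close>-modules are given as matrix representations, that is, group
  homomorphisms into \<open>GL\<^sub>n(\<complex>)\<close>.\<close>

definition representation :: "('a, 'b) monoid_scheme \<Rightarrow> nat \<Rightarrow> ('a \<Rightarrow> complex mat) \<Rightarrow> bool" where
  "representation G n \<rho> \<longleftrightarrow> \<rho> \<in> hom G (units_of (ring_mat TYPE(complex) n ()))"

definition irreducible_representation ::
    "('a, 'b) monoid_scheme \<Rightarrow> nat \<Rightarrow> ('a \<Rightarrow> complex mat) \<Rightarrow> bool" where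
  "irreducible_representation G n \<rho> \<longleftrightarrow>
     representation G n \<rho> \<and> n > 0 \<and>
     (\<forall>W. VectorSpace.subspace class_ring W (module_vec TYPE(complex) n) \<and>
          (\<forall>g\<in>carrier G. \<forall>w\<in>W. \<rho> g *\<^sub>v w \<in> W)
        \<longrightarrow> W = {0\<^sub>v n} \<or> W = carrier_vec n)"

definition irreps :: "('a, 'b) monoid_scheme \<Rightarrow> ('a \<Rightarrow> complex mat) set" where
  "irreps G = {\<rho>. \<exists>n. irreducible_representation G n \<rho>}"

definition rep_iso ::
    "('a, 'b) monoid_scheme \<Rightarrow> (('a \<Rightarrow> complex mat) \<times> ('a \<Rightarrow> complex mat)) set" where
  "rep_iso G = {(\<rho>, \<sigma>). \<rho> \<in> irreps G \<and> \<sigma> \<in> irreps G \<and>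
     (\<exists>n. representation G n \<rho> \<and> representation G n \<sigma> \<and>
       (\<exists>P\<in>Units (ring_mat TYPE(complex) n ()). \<forall>g\<in>carrier G. P * \<rho> g = \<sigma> g * P))}"

text \<open>Elements of \<open>Irr G\<close> are isomorphism classes. As \<open>rep_iso\<close> only looks at values on
  \<open>carrier G\<close>, functions that differ outside the carrier fall into the same class.\<close>

definition Irr :: "('a, 'b) monoid_scheme \<Rightarrow> ('a \<Rightarrow> complex mat) set set" where
  "Irr G = irreps G // rep_iso G"

definition mat_trace :: "complex mat \<Rightarrow> complex" where
  "mat_trace A = (\<Sum>i<dim_row A. A $$ (i, i))"

text \<open>The trace of a group element is constant on each isomorphism class, so \<open>the_elem\<close> picks
  the common value.\<close>

definition irr_character :: "('a \<Rightarrow> complex mat) set \<Rightarrow> 'a \<Rightarrow> complex" where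
  "irr_character C g = the_elem ((\<lambda>\<rho>. mat_trace (\<rho> g)) ` C)"

type_synonym 'a virtual_module = "('a \<Rightarrow> complex mat) set \<Rightarrow>\<^sub>0 int"

definition virtual_modules :: "('a, 'b) monoid_scheme \<Rightarrow> 'a virtual_module set" where
  "virtual_modules G = carrier (free_Abelian_group (Irr G))"

definition genuine :: "'a virtual_module \<Rightarrow> bool" where
  "genuine M \<longleftrightarrow> (\<forall>C. Poly_Mapping.lookup M C \<ge> 0)"

definition virtual_trace :: "'a \<Rightarrow> 'a virtual_module \<Rightarrow> complex" where
  "virtual_trace g M =
     (\<Sum>C\<in>Poly_Mapping.keys M. of_int (Poly_Mapping.lookup M C) * irr_character C g)"

definition degrees :: "nat \<Rightarrow> int set" where
  "degrees d = {- int d} \<union> range int"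

definition graded_virtual_module ::
    "('a, 'b) monoid_scheme \<Rightarrow> nat \<Rightarrow> (int \<Rightarrow> 'a virtual_module) \<Rightarrow> bool" where
  "graded_virtual_module G d V \<longleftrightarrow>
     (\<forall>n. V n \<in> virtual_modules G) \<and> (\<forall>n. n \<notin> degrees d \<longrightarrow> V n = 0)"

text \<open>Each graded piece is a finite combination of finite-dimensional modules, so the direct sum
  is infinite-dimensional exactly when infinitely many pieces are nonzero.\<close>

definition infinite_dimensional :: "(int \<Rightarrow> 'a virtual_module) \<Rightarrow> bool" where
  "infinite_dimensional V \<longleftrightarrow> infinite {n. V n \<noteq> 0}"


section \<open>Modular functions\<close>

definition upper_half_plane :: "complex set" where
  "upper_half_plane = {\<tau>. Im \<tau> > 0}"

definition SL2Z :: "int mat set" where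
  "SL2Z = {A \<in> carrier_mat 2 2. det A = 1}"

definition Gamma0 :: "nat \<Rightarrow> int mat set" where
  "Gamma0 N = {A \<in> SL2Z. int N dvd A $$ (1, 0)}"

definition moebius :: "int mat \<Rightarrow> complex \<Rightarrow> complex" where
  "moebius A \<tau> = (of_int (A $$ (0, 0)) * \<tau> + of_int (A $$ (0, 1))) /
                 (of_int (A $$ (1, 0)) * \<tau> + of_int (A $$ (1, 1)))"

definition Gamma0_invariant :: "nat \<Rightarrow> (complex \<Rightarrow> complex) \<Rightarrow> bool" where
  "Gamma0_invariant N f \<longleftrightarrow>
     (\<forall>A\<in>Gamma0 N. \<forall>\<tau>\<in>upper_half_plane. f (moebius A \<tau>) = f \<tau>)"

text \<open>The cusp \<open>A \<infinity>\<close> is moved to \<open>\<infinity>\<close>; there \<open>f \<circ> A\<close> has to be a function of the local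
  parameter \<open>exp (2 \<pi> \<i> \<tau> / h)\<close>, for some width \<open>h\<close>, with at most a pole at \<open>0\<close>. Letting \<open>A\<close>
  range over \<open>SL2Z\<close> covers all cusps.\<close>

definition at_most_poles_at_cusps :: "(complex \<Rightarrow> complex) \<Rightarrow> bool" where
  "at_most_poles_at_cusps f \<longleftrightarrow>
     (\<forall>A\<in>SL2Z. \<exists>h::nat. h > 0 \<and> (\<exists>F. F meromorphic_on {0} \<and>
        (\<forall>\<tau>\<in>upper_half_plane.
           f (moebius A \<tau>) = F (exp (2 * of_real pi * \<i> * \<tau> / of_nat h)))))"

definition weakly_holomorphic_modular_function :: "nat \<Rightarrow> (complex \<Rightarrow> complex) \<Rightarrow> bool" where
  "weakly_holomorphic_modular_function N f \<longleftrightarrow>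
     f holomorphic_on upper_half_plane \<and> Gamma0_invariant N f \<and> at_most_poles_at_cusps f"

definition strictly_of_level :: "nat \<Rightarrow> (complex \<Rightarrow> complex) \<Rightarrow> bool" where
  "strictly_of_level N f \<longleftrightarrow>
     weakly_holomorphic_modular_function N f \<and>
     (\<forall>M. M dvd N \<and> M \<noteq> N \<longrightarrow> \<not> Gamma0_invariant M f)"


section \<open>McKay--Thompson series\<close>

definition mckay_thompson_term ::
    "(int \<Rightarrow> 'a virtual_module) \<Rightarrow> 'a \<Rightarrow> complex \<Rightarrow> int \<Rightarrow> complex" where
  "mckay_thompson_term V g \<tau> n = virtual_trace g (V n) * exp (2 * of_real pi * \<i> * \<tau>) powi n"

text \<open>\<open>infsum\<close> is \<open>0\<close> for divergent series, so convergence has to be required separately.\<close>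

definition mckay_thompson_converges ::
    "nat \<Rightarrow> (int \<Rightarrow> 'a virtual_module) \<Rightarrow> 'a \<Rightarrow> bool" where
  "mckay_thompson_converges d V g \<longleftrightarrow>
     (\<forall>\<tau>\<in>upper_half_plane. mckay_thompson_term V g \<tau> summable_on degrees d)"

definition mckay_thompson ::
    "nat \<Rightarrow> (int \<Rightarrow> 'a virtual_module) \<Rightarrow> 'a \<Rightarrow> complex \<Rightarrow> complex" where
  "mckay_thompson d V g \<tau> = infsum (mckay_thompson_term V g \<tau>) (degrees d)"

end

(* The discriminant Delta = q prod (1 - q^n)^24 satisfies Delta(-1/t) = t^12 Delta(t), so for m > 1
   the quotient h_m(t) = Delta(m t) / Delta(t) is a modular function of level exactly m, while the sum
   h_1 of the square of 2^12 Delta(2 t) / Delta(t) over its three conjugates is one of level 1. The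
   coefficients of all of them are natural numbers, and those of q h_m are bounded by those of q h_1:
   both are compared with prod (1 - q^n)^(-24), the latter through the q-binomial theorem.
   On the group side, N times the indicator of the elements of order m is the trace of a virtual
   module W_m if N is the order of G (induction over cyclic subgroups, starting from permutation
   characters), and there are genuine modules with trace supported at 1 that contain any given
   irreducible representation. A sum W_1 of such modules dominates the multiplicities of all the
   W_m together, so that the virtual modules h_1[n] W_1 + sum_{m > 1} h_m[n] W_m, where h[n] is the
   coefficient of q^n, are all genuine, and g has trace a multiple of h_{ord g} on their sum. *)

theory Submission
  imports Defs "HOL-Algebra.Left_Coset"
begin

section \<open>The modular discriminant\<close>

text \<open>Level 1 needs a function of its own because \<open>Delta \<tau> / Delta \<tau>\<close>
  is constant. Without the squares the sum over the three conjugates would be constant too: the two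
  with half arguments have poles q^(-1/2) and -q^(-1/2), which cancel and leave a level one function
  without poles. Squaring turns them into 2/q, removes the minus sign and yields the exponent 48:
  the square of prod (1 + x^(2 i + 1)) dominates 1 / prod (1 - x^(2 n)), so its 24th power dominates
  the majorant of the h_m. The factor 2^12 makes the three functions a single orbit, since inversion
  takes Delta(2 t) / Delta(t) to 2^(-12) Delta(t/2) / Delta(t). Only h_1 has a pole at infinity and
  that pole is simple, whence d = 1. The obstacle on the group side is that the W_m may have
  negative multiplicities, while a correction must not disturb the series of any element but the
  identity. This is why W_1 has trace supported at 1. The law for Delta is obtained from a theta
  product by Liouville's theorem.\<close>

lemma locally_uniform_prodinf:
  fixes f :: "nat \<Rightarrow> complex \<Rightarrow> complex"
  assumes S: "open S" and hol: "\<And>n. f n holomorphic_on S"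
    and bd: "\<And>K. compact K \<Longrightarrow> K \<subseteq> S \<Longrightarrow>
               \<exists>M. summable M \<and> (\<forall>n. \<forall>x\<in>K. norm (f n x) \<le> M n)"
  shows "compact K \<Longrightarrow> K \<subseteq> S \<Longrightarrow>
           uniform_limit K (\<lambda>N x. \<Prod>n<N. 1 + f n x) (\<lambda>x. prodinf (\<lambda>n. 1 + f n x)) sequentially"
    and "(\<lambda>x. prodinf (\<lambda>n. 1 + f n x)) holomorphic_on S"
    and "x \<in> S \<Longrightarrow> convergent_prod (\<lambda>n. 1 + f n x)"
    and "x \<in> S \<Longrightarrow> prodinf (\<lambda>n. 1 + f n x) = 0 \<longleftrightarrow> (\<exists>n. 1 + f n x = 0)"
proof -
  have cp: "convergent_prod (\<lambda>n. 1 + f n x)" if x: "x \<in> S" for x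
  proof -
    obtain M where M: "summable M" "\<forall>n. \<forall>y\<in>{x}. norm (f n y) \<le> M n"
      using bd[of "{x}"] x by auto
    have "summable (\<lambda>n. norm (f n x))"
      by (rule summable_comparison_test'[OF M(1), of 0]) (use M(2) in auto)
    thus ?thesis
      by (intro abs_convergent_prod_imp_convergent_prod summable_imp_abs_convergent_prod) auto
  qed
  thus "x \<in> S \<Longrightarrow> convergent_prod (\<lambda>n. 1 + f n x)" .
  show "x \<in> S \<Longrightarrow> prodinf (\<lambda>n. 1 + f n x) = 0 \<longleftrightarrow> (\<exists>n. 1 + f n x = 0)"
    using has_prod_eq_0_iff[OF convergent_prod_has_prod[OF cp]] by (auto simp: image_iff)
  have ul: "uniform_limit K (\<lambda>N x. \<Prod>n<N. 1 + f n x) (\<lambda>x. prodinf (\<lambda>n. 1 + f n x)) sequentially"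
    if K: "compact K" "K \<subseteq> S" for K
  proof -
    obtain M where M: "summable M" "\<forall>n. \<forall>x\<in>K. norm (f n x) \<le> M n"
      using bd[OF K] by blast
    have "uniformly_convergent_on K (\<lambda>N x. \<Sum>n<N. norm (f n x))"
      by (rule Weierstrass_m_test'_ev[OF _ M(1)]) (use M(2) in auto)
    then have "uniformly_convergent_on K (\<lambda>N x. \<Prod>n<N. 1 + f n x)"
      by (intro uniformly_convergent_on_prod K holomorphic_on_imp_continuous_on
            holomorphic_on_subset[OF hol])
    then obtain g where g: "uniform_limit K (\<lambda>N x. \<Prod>n<N. 1 + f n x) g sequentially"
      by (auto simp: uniformly_convergent_on_def)
    have "g x = prodinf (\<lambda>n. 1 + f n x)" if "x \<in> K" for x
    proof (rule LIMSEQ_unique)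
      show "(\<lambda>N. \<Prod>n<N. 1 + f n x) \<longlonglongrightarrow> g x"
        using tendsto_uniform_limitI[OF g that] .
      have "x \<in> S" using that K by auto
      then show "(\<lambda>N. \<Prod>n<N. 1 + f n x) \<longlonglongrightarrow> prodinf (\<lambda>n. 1 + f n x)"
        using convergent_prod_LIMSEQ[OF cp[of x]]
        by (subst LIMSEQ_lessThan_iff_atMost) auto
    qed
    thus ?thesis using g by (subst uniform_limit_cong'[where g="\<lambda>N x. \<Prod>n<N. 1 + f n x" and i=g]) auto
  qed
  show "compact K \<Longrightarrow> K \<subseteq> S \<Longrightarrow>
           uniform_limit K (\<lambda>N x. \<Prod>n<N. 1 + f n x) (\<lambda>x. prodinf (\<lambda>n. 1 + f n x)) sequentially"
    by (rule ul)
  show "(\<lambda>x. prodinf (\<lambda>n. 1 + f n x)) holomorphic_on S"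
  proof (rule holomorphic_uniform_sequence[OF S, of "\<lambda>N x. \<Prod>n<N. 1 + f n x"])
    show "(\<lambda>x. \<Prod>n<N. 1 + f n x) holomorphic_on S" for N
      by (intro holomorphic_intros hol)
    fix x assume "x \<in> S"
    then obtain d where "d > 0" "cball x d \<subseteq> S"
      using S open_contains_cball by blast
    then show "\<exists>d>0. cball x d \<subseteq> S \<and> uniform_limit (cball x d) (\<lambda>N x. \<Prod>n<N. 1 + f n x)
        (\<lambda>x. prodinf (\<lambda>n. 1 + f n x)) sequentially"
      using ul by auto
  qed
qed

section \<open>Infinite products of 1 - w q^n and Euler's product\<close>

definition qpoch :: "complex \<Rightarrow> complex \<Rightarrow> complex" where
  "qpoch w q = prodinf (\<lambda>n. 1 - w * q ^ n)"

lemma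
  assumes q: "norm q < 1"
  shows holomorphic_on_qpoch: "(\<lambda>w. qpoch w q) holomorphic_on UNIV"
    and convergent_prod_qpoch: "convergent_prod (\<lambda>n. 1 - w * q ^ n)"
    and qpoch_eq_0_iff: "qpoch w q = 0 \<longleftrightarrow> (\<exists>n. w * q ^ n = 1)"
proof -
  have bd: "\<exists>M. summable M \<and> (\<forall>n. \<forall>w\<in>K. norm (- (w * q ^ n)) \<le> M n)"
    if K: "compact K" "K \<subseteq> UNIV" for K
  proof -
    obtain B where B: "\<forall>w\<in>K. norm w \<le> B"
      using compact_imp_bounded[OF K(1)] by (auto simp: bounded_iff)
    show ?thesis
      by (rule exI[of _ "\<lambda>n. B * norm q ^ n"])
         (use B q in \<open>auto simp: norm_mult norm_power intro!: summable_mult summable_geometric mult_right_mono\<close>)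
  qed
  have hol: "(\<lambda>w. - (w * q ^ n)) holomorphic_on UNIV" for n
    by (intro holomorphic_intros)
  note * = locally_uniform_prodinf[of UNIV "\<lambda>n w. - (w * q ^ n)", OF open_UNIV hol bd]
  show "(\<lambda>w. qpoch w q) holomorphic_on UNIV"
    using *(2) by (simp add: qpoch_def)
  show "convergent_prod (\<lambda>n. 1 - w * q ^ n)"
    using *(3)[of w] by simp
  have "qpoch w q = 0 \<longleftrightarrow> (\<exists>n. 1 + - (w * q ^ n) = 0)"
    using *(4)[of w] unfolding qpoch_def by simp
  then show "qpoch w q = 0 \<longleftrightarrow> (\<exists>n. w * q ^ n = 1)"
    by (metis add.right_neutral add_uminus_conv_diff eq_iff_diff_eq_0)
qed

lemma qpoch_rec:
  assumes "norm q < 1"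
  shows "qpoch w q = (1 - w) * qpoch (w * q) q"
proof (cases "w = 1")
  case True
  then show ?thesis using qpoch_eq_0_iff[OF assms, of w] by (auto intro: exI[of _ 0])
next
  case False
  have "prodinf (\<lambda>n. 1 - w * q ^ Suc n) = qpoch w q / (1 - w * q ^ 0)"
    unfolding qpoch_def
    by (rule prodinf_split_head) (use convergent_prod_qpoch[OF assms] False in auto)
  then show ?thesis using False by (simp add: qpoch_def mult_ac)
qed

definition euler_phi :: "complex \<Rightarrow> complex" where
  "euler_phi q = qpoch q q"

lemma
  shows euler_phi_uniform_limit: "compact K \<Longrightarrow> K \<subseteq> ball 0 1 \<Longrightarrow>
           uniform_limit K (\<lambda>N q. \<Prod>n<N. 1 - q ^ Suc n) euler_phi sequentially"
    and holomorphic_on_euler_phi: "euler_phi holomorphic_on ball 0 1"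
proof -
  have bd: "\<exists>M. summable M \<and> (\<forall>n. \<forall>q\<in>K. norm (- (q ^ Suc n)) \<le> M n)"
    if K: "compact K" "K \<subseteq> ball 0 1" for K :: "complex set"
  proof (cases "K = {}")
    case True
    then show ?thesis by (auto intro: exI[of _ "\<lambda>_. 0"])
  next
    case False
    obtain y where y: "y \<in> K" "\<forall>x\<in>K. norm x \<le> norm y"
      using continuous_attains_sup[OF K(1) False, of norm] by (auto intro: continuous_intros)
    then have y1: "norm y < 1" using K by auto
    show ?thesis
    proof (intro exI conjI allI ballI)
      show "summable (\<lambda>n. norm y ^ n)" using y1 by (simp add: summable_geometric)
      fix n q assume "q \<in> K"
      then have "norm q \<le> norm y" "norm q \<le> 1" using y y1 by force+
      then have "norm q * norm q ^ n \<le> 1 * norm y ^ n"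
        by (intro mult_mono power_mono) auto
      then show "norm (- (q ^ Suc n)) \<le> norm y ^ n" by (simp add: norm_mult norm_power)
    qed
  qed
  have eq: "prodinf (\<lambda>n. 1 + - (x ^ Suc n)) = euler_phi x" for x
    by (simp add: euler_phi_def qpoch_def)
  have hol: "(\<lambda>q. - (q ^ Suc n)) holomorphic_on ball 0 1" for n
    by (intro holomorphic_intros)
  note * = locally_uniform_prodinf[of "ball 0 1" "\<lambda>n q. - (q ^ Suc n)", OF open_ball hol bd, unfolded eq]
  show "compact K \<Longrightarrow> K \<subseteq> ball 0 1 \<Longrightarrow>
           uniform_limit K (\<lambda>N q. \<Prod>n<N. 1 - q ^ Suc n) euler_phi sequentially"
    using *(1)[of K] by simp
  show "euler_phi holomorphic_on ball 0 1"
    using *(2) by simp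
qed

lemma euler_phi_nonzero:
  assumes "norm q < 1"
  shows "euler_phi q \<noteq> 0"
proof
  assume "euler_phi q = 0"
  then obtain n where "q * q ^ n = 1"
    unfolding euler_phi_def by (auto simp: qpoch_eq_0_iff[OF assms])
  then have "norm q ^ Suc n = 1" by (metis norm_power norm_one power_Suc)
  then show False using assms power_Suc_less_one[of "norm q" n] by (cases "q = 0") auto
qed

lemma euler_phi_0 [simp]: "euler_phi 0 = 1"
  by (simp add: euler_phi_def qpoch_def)

section \<open>The exponential of period 1 and product identities\<close>

definition qexp :: "complex \<Rightarrow> complex" where
  "qexp z = exp (2 * of_real pi * \<i> * z)"

lemma norm_qexp_less_1 [simp]: "norm (qexp \<tau>) < 1 \<longleftrightarrow> Im \<tau> > 0"
  by (simp add: qexp_def norm_exp_eq_Re zero_less_mult_iff)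

lemma qexp_nonzero [simp]: "qexp z \<noteq> 0"
  by (simp add: qexp_def)

lemma qexp_0 [simp]: "qexp 0 = 1"
  by (simp add: qexp_def)

lemma holomorphic_on_qexp [holomorphic_intros]:
  "f holomorphic_on A \<Longrightarrow> (\<lambda>z. qexp (f z)) holomorphic_on A"
  unfolding qexp_def by (intro holomorphic_intros)

lemma qexp_add: "qexp (a + b) = qexp a * qexp b"
  by (simp add: qexp_def exp_add ring_distribs)

lemma qexp_diff: "qexp (a - b) = qexp a / qexp b"
  by (simp add: qexp_def exp_diff ring_distribs)

lemma qexp_minus: "qexp (- a) = inverse (qexp a)"
  by (simp add: qexp_def exp_minus)

lemma qexp_of_nat_mult: "qexp (of_nat n * z) = qexp z ^ n"
  by (simp add: qexp_def exp_of_nat_mult [symmetric] mult_ac)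

lemma qexp_eq_1_iff: "qexp z = 1 \<longleftrightarrow> (\<exists>n. z = of_int n)"
proof
  assume "qexp z = 1"
  then obtain n where n: "Re (2 * of_real pi * \<i> * z) = 0" "Im (2 * of_real pi * \<i> * z) = of_int (2 * n) * pi"
    by (auto simp: qexp_def exp_eq_1)
  then have "Im z = 0" "Re z = of_int n" by auto
  then show "\<exists>n. z = of_int n" by (auto simp: complex_eq_iff)
next
  assume "\<exists>n. z = of_int n"
  then show "qexp z = 1" by (auto simp: qexp_def exp_eq_1)
qed

lemma qexp_of_int [simp]: "qexp (of_int n) = 1"
  using qexp_eq_1_iff by blast

lemma qexp_1 [simp]: "qexp 1 = 1"
  using qexp_of_int[of 1] by (simp del: qexp_of_int)

lemma qexp_half: "qexp (1 / 2) = - 1"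
  by (simp add: qexp_def)

lemma qexp_quarter: "qexp (1 / 4) = \<i>"
  by (simp add: qexp_def) (simp add: exp_eq_polar)

lemma qpoch_mult_uminus:
  assumes "norm q < 1"
  shows "qpoch w q * qpoch (- w) q = qpoch (w\<^sup>2) (q\<^sup>2)"
proof -
  have "qpoch w q * qpoch (- w) q = prodinf (\<lambda>n. (1 - w * q ^ n) * (1 - (- w) * q ^ n))"
    unfolding qpoch_def by (rule prodinf_mult) (rule convergent_prod_qpoch[OF assms])+
  also have "(\<lambda>n. (1 - w * q ^ n) * (1 - (- w) * q ^ n)) = (\<lambda>n. 1 - w\<^sup>2 * (q\<^sup>2) ^ n)"
    by (rule ext) (simp add: algebra_simps power2_eq_square power_mult_distrib)
  finally show ?thesis by (simp add: qpoch_def)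
qed

lemma qpoch_LIMSEQ:
  assumes "norm q < 1"
  shows "(\<lambda>N. \<Prod>n<N. 1 - w * q ^ n) \<longlonglongrightarrow> qpoch w q"
  using convergent_prod_LIMSEQ[OF convergent_prod_qpoch[OF assms, of w]]
  unfolding qpoch_def by (subst LIMSEQ_lessThan_iff_atMost)

lemma qpoch_even_odd:
  assumes "norm q < 1"
  shows "qpoch w q = qpoch w (q\<^sup>2) * qpoch (w * q) (q\<^sup>2)"
proof (rule LIMSEQ_unique)
  have q2: "norm (q\<^sup>2) < 1"
    using assms by (simp add: norm_power abs_square_less_1)
  have "(\<Prod>n<2*N. 1 - w * q ^ n) = (\<Prod>n<N. 1 - w * (q\<^sup>2) ^ n) * (\<Prod>n<N. 1 - w * q * (q\<^sup>2) ^ n)" for N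
    by (induction N) (simp_all add: algebra_simps power_mult [symmetric])
  then show "(\<lambda>N. \<Prod>n<2*N. 1 - w * q ^ n) \<longlonglongrightarrow> qpoch w (q\<^sup>2) * qpoch (w * q) (q\<^sup>2)"
    by (simp only:) (intro tendsto_intros qpoch_LIMSEQ q2)
  show "(\<lambda>N. \<Prod>n<2*N. 1 - w * q ^ n) \<longlonglongrightarrow> qpoch w q"
    by (rule filterlim_compose[OF qpoch_LIMSEQ[OF assms]])
       (rule filterlim_subseq, auto simp: strict_mono_def)
qed

text \<open>This is Euler's identity prod (1 + q^n) * prod (1 - q^(2 n - 1)) = 1 for q = x^2: the
  products at x and - x merge into the product over odd powers of q.\<close>

lemma qpoch_triple_eq_1:
  assumes "norm x < 1"
  shows "qpoch (- (x\<^sup>2)) (x\<^sup>2) * qpoch x (x\<^sup>2) * qpoch (- x) (x\<^sup>2) = 1"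
proof -
  define q where "q = x\<^sup>2"
  have q: "norm q < 1" "norm (q\<^sup>2) < 1"
    using assms by (simp_all add: q_def norm_power power_less_one_iff abs_square_less_1)
  have 1: "qpoch x q * qpoch (- x) q = qpoch q (q\<^sup>2)"
    using qpoch_mult_uminus[OF q(1), of x] by (simp add: q_def)
  have 2: "qpoch q q * qpoch (- q) q = qpoch (q\<^sup>2) (q\<^sup>2)"
    by (rule qpoch_mult_uminus[OF q(1)])
  have 3: "qpoch q q = qpoch q (q\<^sup>2) * qpoch (q\<^sup>2) (q\<^sup>2)"
    using qpoch_even_odd[OF q(1), of q] by (simp add: power2_eq_square)
  have period_nonzero: "qpoch (q\<^sup>2) (q\<^sup>2) \<noteq> 0"
    using euler_phi_nonzero[OF q(2)] by (simp add: euler_phi_def)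
  have "qpoch (- q) q * qpoch q (q\<^sup>2) = 1"
    using 2 period_nonzero unfolding 3 by (simp add: mult_ac)
  then have "qpoch (- q) q * (qpoch x q * qpoch (- x) q) = 1" unfolding 1 .
  then show ?thesis unfolding q_def by (simp only: mult.assoc)
qed

text \<open>Up to a factor depending only on \<open>\<tau>\<close>, this is Jacobi's theta function \<open>\<theta>\<^sub>1\<close> as an infinite
  product.\<close>

definition jac :: "complex \<Rightarrow> complex \<Rightarrow> complex" where
  "jac \<tau> z = qexp (- z / 2) * qpoch (qexp z) (qexp \<tau>) * qpoch (qexp (\<tau> - z)) (qexp \<tau>)"

section \<open>Quasi-periods, zeros and half-period values of the theta product\<close>

context
  fixes \<tau> :: complex
  assumes \<tau>: "Im \<tau> > 0"
begin

lemma norm_qexp_period: "norm (qexp \<tau>) < 1"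
  using \<tau> by simp

lemma holomorphic_on_qpoch_comp [holomorphic_intros]:
  "f holomorphic_on A \<Longrightarrow> (\<lambda>z. qpoch (f z) (qexp \<tau>)) holomorphic_on A"
  using holomorphic_on_compose_gen[OF _ holomorphic_on_qpoch[OF norm_qexp_period]] by (auto simp: o_def)

lemma holomorphic_on_jac: "jac \<tau> holomorphic_on A"
  unfolding jac_def [abs_def] by (intro holomorphic_intros) auto

text \<open>With the factor \<open>1 - qexp z\<close> split off, the two remaining products are
  exchanged by z -> - z, which makes oddness and the simple zero at 0 visible.\<close>

lemma jac_eq: "jac \<tau> z = qexp (- z / 2) * (1 - qexp z) *
    qpoch (qexp (\<tau> + z)) (qexp \<tau>) * qpoch (qexp (\<tau> - z)) (qexp \<tau>)"
  unfolding jac_def qpoch_rec[OF norm_qexp_period, of "qexp z"] qexp_add by (simp add: mult_ac)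

lemma jac_minus: "jac \<tau> (- z) = - jac \<tau> z"
proof -
  have "qexp (z / 2) * qexp (- z) = qexp (- z / 2)" "qexp (- z / 2) * qexp z = qexp (z / 2)"
    by (simp_all flip: qexp_add)
  then have "qexp (z / 2) * (1 - qexp (- z)) = - (qexp (- z / 2) * (1 - qexp z))"
    by (simp add: algebra_simps)
  then show ?thesis by (simp add: jac_eq)
qed

lemma jac_add_1: "jac \<tau> (z + 1) = - jac \<tau> z"
proof -
  have "qexp (- (z + 1) / 2) = - qexp (- z / 2)"
    by (simp add: add_divide_distrib diff_divide_distrib qexp_diff qexp_half qexp_minus)
  moreover have "qexp (z + 1) = qexp z" "qexp (\<tau> - (z + 1)) = qexp (\<tau> - z)"
    by (simp_all add: qexp_add qexp_diff)
  ultimately show ?thesis by (simp add: jac_def)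
qed

text \<open>One product loses the factor \<open>1 - qexp z\<close> and the other gains
  \<open>1 - qexp (- z)\<close>; the quotient of gained and lost factor is
  \<open>- qexp (- z)\<close>.\<close>

lemma jac_add_period: "jac \<tau> (z + \<tau>) = - qexp (- \<tau> / 2) * qexp (- z) * jac \<tau> z"
proof -
  have "qexp (- (z + \<tau>) / 2) = qexp (- \<tau> / 2) * qexp (- z / 2)"
    by (simp add: field_simps flip: qexp_add)
  then have "jac \<tau> (z + \<tau>) = qexp (- \<tau> / 2) * qexp (- z / 2) *
          qpoch (qexp (\<tau> + z)) (qexp \<tau>) * qpoch (qexp (- z)) (qexp \<tau>)"
    by (simp add: jac_def add_ac)
  also have "qpoch (qexp (- z)) (qexp \<tau>) = (1 - qexp (- z)) * qpoch (qexp (\<tau> - z)) (qexp \<tau>)"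
    unfolding qpoch_rec[OF norm_qexp_period, of "qexp (- z)"] by (simp add: add.commute flip: qexp_add)
  also have "1 - qexp (- z) = - qexp (- z) * (1 - qexp z)"
    by (simp add: algebra_simps flip: qexp_add)
  finally show ?thesis by (simp add: jac_eq)
qed

lemma jac_eq_0_iff: "jac \<tau> z = 0 \<longleftrightarrow> (\<exists>m n::int. z = of_int m + of_int n * \<tau>)"
proof
  assume "jac \<tau> z = 0"
  then have "qpoch (qexp z) (qexp \<tau>) = 0 \<or> qpoch (qexp (\<tau> - z)) (qexp \<tau>) = 0"
    by (simp add: jac_def)
  then consider n where "qexp z * qexp \<tau> ^ n = 1" | n where "qexp (\<tau> - z) * qexp \<tau> ^ n = 1"
    unfolding qpoch_eq_0_iff[OF norm_qexp_period] by blast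
  then show "\<exists>m n::int. z = of_int m + of_int n * \<tau>"
  proof cases
    case 1
    then have "qexp (z + of_nat n * \<tau>) = 1" by (simp only: qexp_add qexp_of_nat_mult)
    then obtain m where "z + of_nat n * \<tau> = of_int m" unfolding qexp_eq_1_iff by blast
    then have "z = of_int m + of_int (- int n) * \<tau>" by (simp add: algebra_simps)
    then show ?thesis by blast
  next
    case 2
    then have "qexp (\<tau> - z + of_nat n * \<tau>) = 1" by (simp only: qexp_add qexp_of_nat_mult)
    then obtain m where "\<tau> - z + of_nat n * \<tau> = of_int m" unfolding qexp_eq_1_iff by blast
    then have "z = of_int (- m) + of_int (int n + 1) * \<tau>" by (simp add: algebra_simps)
    then show ?thesis by blast
  qed
next
  assume "\<exists>m n::int. z = of_int m + of_int n * \<tau>"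
  then obtain m n :: int where z: "z = of_int m + of_int n * \<tau>" by blast
  show "jac \<tau> z = 0"
  \<comment> \<open>The first product vanishes at the lattice points with n at most 0, the second at
    those with n positive.\<close>
  proof (cases "n \<le> 0")
    case True
    have "qexp z * qexp \<tau> ^ nat (- n) = qexp (z + of_nat (nat (- n)) * \<tau>)"
      by (simp only: qexp_add qexp_of_nat_mult)
    also have "z + of_nat (nat (- n)) * \<tau> = of_int m" using True by (simp add: z algebra_simps of_nat_nat)
    finally show ?thesis using qpoch_eq_0_iff[OF norm_qexp_period] by (auto simp: jac_def)
  next
    case False
    have "qexp (\<tau> - z) * qexp \<tau> ^ nat (n - 1) = qexp (\<tau> - z + of_nat (nat (n - 1)) * \<tau>)"
      by (simp only: qexp_add qexp_of_nat_mult)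
    also have "\<tau> - z + of_nat (nat (n - 1)) * \<tau> = of_int (- m)"
      using False by (simp add: z algebra_simps of_nat_nat)
    finally show ?thesis using qpoch_eq_0_iff[OF norm_qexp_period] by (auto simp: jac_def simp del: of_int_minus)
  qed
qed

lemma lattice_periodic:
  assumes "\<And>z. f (z + 1) = f z" "\<And>z. f (z + \<tau>) = f z"
  shows "f (z + of_int m + of_int n * \<tau>) = f z"
proof -
  have *: "g (z + of_int m * w) = g z" if "\<And>z. g (z + w) = g z" for g :: "complex \<Rightarrow> 'a" and w z m
  proof (induction m rule: int_induct[where k=0])
    case (step1 i)
    then show ?case using that[of "z + of_int i * w"] by (simp add: algebra_simps)
  next
    case (step2 i)
    then show ?case using that[of "z + of_int (i - 1) * w"] by (simp add: algebra_simps)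
  qed simp
  show ?thesis
    using *[of f 1, OF assms(1), of z m] *[of f \<tau>, OF assms(2), of "z + of_int m" n] by simp
qed

text \<open>The derivative at the zero 0. Through it Euler's product enters
  \<open>jac_const\<close>.\<close>

lemma jac_div_tendsto: "((\<lambda>z. jac \<tau> z / z) \<longlongrightarrow> - (2 * of_real pi * \<i>) * euler_phi (qexp \<tau>) ^ 2) (at 0)"
proof -
  have "((\<lambda>z. 1 - qexp z) has_field_derivative - (2 * of_real pi * \<i>)) (at 0)"
    unfolding qexp_def by (auto intro!: derivative_eq_intros)
  then have 1: "((\<lambda>z. (1 - qexp z) / z) \<longlongrightarrow> - (2 * of_real pi * \<i>)) (at 0)"
    by (simp add: has_field_derivative_iff)
  define A where "A z = qexp (- z / 2) *
    qpoch (qexp (\<tau> + z)) (qexp \<tau>) * qpoch (qexp (\<tau> - z)) (qexp \<tau>)" for z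
  have "A holomorphic_on UNIV"
    unfolding A_def [abs_def] by (intro holomorphic_intros) auto
  then have "isCont A 0"
    using holomorphic_on_imp_continuous_on continuous_on_eq_continuous_at open_UNIV by blast
  then have 2: "(A \<longlongrightarrow> A 0) (at 0)" by (simp add: isCont_def)
  have "((\<lambda>z. (1 - qexp z) / z * A z) \<longlongrightarrow> - (2 * of_real pi * \<i>) * A 0) (at 0)"
    by (intro tendsto_mult 1 2)
  moreover have "A 0 = euler_phi (qexp \<tau>) ^ 2" by (simp add: A_def euler_phi_def power2_eq_square)
  moreover have "(\<lambda>z. (1 - qexp z) / z * A z) = (\<lambda>z. jac \<tau> z / z)"
    by (rule ext) (simp add: jac_eq A_def mult_ac)
  ultimately show ?thesis by simp
qed

text \<open>The infinite products at the three half periods combine to the square of Euler's triple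
  product, which is 1, so an elementary value remains.\<close>

lemma jac_half_periods:
  "jac \<tau> (1 / 2) * jac \<tau> (\<tau> / 2) * jac \<tau> ((1 + \<tau>) / 2) = - 2 * qexp (- \<tau> / 2)"
proof -
  define x where "x = qexp (\<tau> / 2)"
  have x2: "qexp \<tau> = x\<^sup>2" by (simp add: x_def power2_eq_square flip: qexp_add)
  have nx: "norm x < 1" using \<tau> by (simp add: x_def)
  have E: "qexp (1 / 2) = - 1" "qexp (\<tau> / 2) = x" "qexp ((1 + \<tau>) / 2) = - x"
          "qexp (\<tau> - \<tau> / 2) = x" "qexp (\<tau> - 1 / 2) = - (x\<^sup>2)" "qexp (\<tau> - (1 + \<tau>) / 2) = - x"
    by (simp_all add: qexp_add qexp_diff add_divide_distrib qexp_half x2 power2_eq_square flip: x_def)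
  have "qexp (- (1 / 2) / 2) = - \<i>"
    using qexp_minus[of "1/4"] by (simp add: qexp_quarter)
  moreover have "qexp (- ((1 + \<tau>) / 2) / 2) = qexp (- (1 / 2) / 2) * qexp (- (\<tau> / 2) / 2)"
    by (simp add: add_divide_distrib diff_divide_distrib flip: qexp_add)
  ultimately have I: "qexp (- (1 / 2) / 2) = - \<i>"
    "qexp (- ((1 + \<tau>) / 2) / 2) = - \<i> * qexp (- (\<tau> / 2) / 2)" by simp_all
  have H: "qexp (- (\<tau> / 2) / 2) * qexp (- (\<tau> / 2) / 2) = qexp (- \<tau> / 2)"
    by (simp flip: qexp_add)
  have M: "qpoch (- 1) (x\<^sup>2) = 2 * qpoch (- (x\<^sup>2)) (x\<^sup>2)"
    using qpoch_rec[of "x\<^sup>2" "-1"] nx by (simp add: norm_power abs_square_less_1)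
  have "jac \<tau> (1 / 2) * jac \<tau> (\<tau> / 2) * jac \<tau> ((1 + \<tau>) / 2) =
      - 2 * (qexp (- (\<tau> / 2) / 2) * qexp (- (\<tau> / 2) / 2)) *
      (qpoch (- (x\<^sup>2)) (x\<^sup>2) * qpoch x (x\<^sup>2) * qpoch (- x) (x\<^sup>2)) ^ 2"
    unfolding jac_def E x2 M I by (simp add: power2_eq_square)
  then show ?thesis unfolding H qpoch_triple_eq_1[OF nx] by simp
qed

end

lemma Im_minus_inverse:
  assumes "Im \<tau> > 0"
  shows "Im (- 1 / \<tau>) > 0"
  using assms by (auto simp: Im_divide sum_power2_gt_zero_iff intro!: divide_pos_pos)

section \<open>Comparison of the theta products for \<tau> and - 1 / \<tau>\<close>

context
  fixes \<tau> :: complex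
  assumes \<tau>: "Im \<tau> > 0"
begin

text \<open>\<open>jac_inv\<close> and \<open>jac \<tau>\<close> have the same quasi-periods and the same zeros, so their quotient is
  entire and doubly periodic, hence constant. Its value \<open>jac_const\<close> at \<open>0\<close> involves the quotient of
  the eta products at \<open>- 1 / \<tau>\<close> and \<open>\<tau>\<close>; multiplying its values at the three half periods gives
  \<open>jac_const ^ 3\<close> in closed form.\<close>

definition jac_inv :: "complex \<Rightarrow> complex" where
  "jac_inv z = qexp (- (z\<^sup>2) / (2 * \<tau>)) * jac (- 1 / \<tau>) (z / \<tau>)"

definition jac_const :: complex where
  "jac_const = (euler_phi (qexp (- 1 / \<tau>)))\<^sup>2 / (\<tau> * (euler_phi (qexp \<tau>))\<^sup>2)"

lemma period_nonzero: "\<tau> \<noteq> 0" using \<tau> by auto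

lemma Im_inverse_period: "Im (- 1 / \<tau>) > 0" by (rule Im_minus_inverse[OF \<tau>])

lemma jac_inv_add_1: "jac_inv (z + 1) = - jac_inv z"
proof -
  \<comment> \<open>Adding the period - 1 / \<tau> to (z + 1) / \<tau> gives z / \<tau>.\<close>
  have "jac (- 1 / \<tau>) (z / \<tau>) =
      - qexp (- (- 1 / \<tau>) / 2) * qexp (- ((z + 1) / \<tau>)) * jac (- 1 / \<tau>) ((z + 1) / \<tau>)"
    using jac_add_period[OF Im_inverse_period, of "(z + 1) / \<tau>"] by (simp add: add_divide_distrib)
  then have "jac_inv z = - (qexp (- (z\<^sup>2) / (2 * \<tau>)) * qexp (- (- 1 / \<tau>) / 2) * qexp (- ((z + 1) / \<tau>))) *
      jac (- 1 / \<tau>) ((z + 1) / \<tau>)"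
    by (simp add: jac_inv_def)
  also have "qexp (- (z\<^sup>2) / (2 * \<tau>)) * qexp (- (- 1 / \<tau>) / 2) * qexp (- ((z + 1) / \<tau>)) =
      qexp (- ((z + 1)\<^sup>2) / (2 * \<tau>))"
    unfolding qexp_add [symmetric] using period_nonzero by (intro arg_cong[of _ _ qexp]) (simp add: field_simps power2_eq_square)
  finally show ?thesis by (simp add: jac_inv_def)
qed

lemma jac_inv_add_period: "jac_inv (z + \<tau>) = - qexp (- \<tau> / 2) * qexp (- z) * jac_inv z"
proof -
  have "qexp (- ((z + \<tau>)\<^sup>2) / (2 * \<tau>)) = qexp (- \<tau> / 2) * qexp (- z) * qexp (- (z\<^sup>2) / (2 * \<tau>))"
    unfolding qexp_add [symmetric] using period_nonzero by (intro arg_cong[of _ _ qexp]) (simp add: field_simps power2_eq_square)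
  moreover have "(z + \<tau>) / \<tau> = z / \<tau> + 1" using period_nonzero by (simp add: field_simps)
  ultimately show ?thesis by (simp only: jac_inv_def jac_add_1[OF Im_inverse_period]) simp
qed

lemma jac_inv_eq_0:
  assumes "jac \<tau> z = 0"
  shows "jac_inv z = 0"
proof -
  obtain m n where "z = of_int m + of_int n * \<tau>" using assms jac_eq_0_iff[OF \<tau>] by blast
  then have "z / \<tau> = of_int n + of_int (- m) * (- 1 / \<tau>)" using period_nonzero by (simp add: field_simps)
  then have "jac (- 1 / \<tau>) (z / \<tau>) = 0" using jac_eq_0_iff[OF Im_inverse_period] by blast
  then show ?thesis by (simp add: jac_inv_def)
qed

lemma holomorphic_on_jac_inv: "jac_inv holomorphic_on A"
proof -
  have "(\<lambda>z. jac (- 1 / \<tau>) (z / \<tau>)) holomorphic_on A"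
  proof -
    have "jac (- 1 / \<tau>) \<circ> (\<lambda>z. z / \<tau>) holomorphic_on A"
      by (intro holomorphic_on_compose holomorphic_on_jac[OF Im_inverse_period] holomorphic_intros period_nonzero)
    then show ?thesis by (simp add: o_def)
  qed
  then show ?thesis
    unfolding jac_inv_def [abs_def] by (intro holomorphic_intros) (use period_nonzero in auto)
qed

lemma jac_quotient_tendsto: "((\<lambda>z. jac_inv z / jac \<tau> z) \<longlongrightarrow> jac_const) (at 0)"
proof -
  let ?\<tau>' = "- 1 / \<tau>" and ?c = "- (2 * of_real pi * \<i>) :: complex"
  have "isCont (\<lambda>z. qexp (- (z\<^sup>2) / (2 * \<tau>))) 0"
    unfolding qexp_def using period_nonzero by (intro continuous_intros) auto
  then have 1: "((\<lambda>z. qexp (- (z\<^sup>2) / (2 * \<tau>))) \<longlongrightarrow> 1) (at 0)"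
    by (simp add: isCont_def)
  have f: "filterlim (\<lambda>z. z / \<tau>) (at 0) (at 0)"
    using period_nonzero by (auto simp: filterlim_at eventually_at_filter intro!: tendsto_eq_intros)
  have 2: "((\<lambda>z. jac ?\<tau>' (z / \<tau>) / (z / \<tau>)) \<longlongrightarrow> ?c * euler_phi (qexp ?\<tau>') ^ 2) (at 0)"
    by (rule filterlim_compose[OF jac_div_tendsto[OF Im_inverse_period] f])
  have ne: "?c * euler_phi (qexp \<tau>) ^ 2 \<noteq> 0"
    using euler_phi_nonzero \<tau> by simp
  have "((\<lambda>z. qexp (- (z\<^sup>2) / (2 * \<tau>)) * (1 / \<tau>) * (jac ?\<tau>' (z / \<tau>) / (z / \<tau>)) / (jac \<tau> z / z)) \<longlongrightarrow>
      1 * (1 / \<tau>) * (?c * euler_phi (qexp ?\<tau>') ^ 2) / (?c * euler_phi (qexp \<tau>) ^ 2)) (at 0)"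
    by (intro tendsto_intros 1 2 jac_div_tendsto[OF \<tau>] ne)
  also have "1 * (1 / \<tau>) * (?c * euler_phi (qexp ?\<tau>') ^ 2) / (?c * euler_phi (qexp \<tau>) ^ 2) = jac_const"
    by (simp add: jac_const_def)
  finally show ?thesis
    by (rule Lim_transform_eventually)
       (use period_nonzero in \<open>auto simp: eventually_at_filter jac_inv_def intro!: always_eventually\<close>)
qed

text \<open>The value at the zeros of \<open>jac \<tau>\<close> is the limit of the quotient at 0;
  periodicity makes it the right value at all other lattice points.\<close>

definition jac_quot :: "complex \<Rightarrow> complex" where
  "jac_quot z = (if jac \<tau> z = 0 then jac_const else jac_inv z / jac \<tau> z)"

lemma jac_quot_add_1: "jac_quot (z + 1) = jac_quot z"
  by (simp add: jac_quot_def jac_inv_add_1 jac_add_1[OF \<tau>])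

lemma jac_quot_add_period: "jac_quot (z + \<tau>) = jac_quot z"
  by (simp add: jac_quot_def jac_inv_add_period jac_add_period[OF \<tau>])

lemmas jac_quot_periodic = lattice_periodic[OF \<tau>, of jac_quot, OF jac_quot_add_1 jac_quot_add_period]

lemma jac_quot_holomorphic_0:
  obtains r where "r > 0" "jac_quot holomorphic_on ball 0 r"
proof
  \<comment> \<open>Nonzero lattice points have norm at least \<open>r\<close>: those with n = 0 are
    nonzero integers, the others have imaginary part at least Im \<tau> in absolute value.\<close>
  define r where "r = min 1 (Im \<tau>)"
  show "r > 0" using \<tau> by (simp add: r_def)
  have only0: "jac \<tau> z \<noteq> 0" if "norm z < r" "z \<noteq> 0" for z
  proof
    assume "jac \<tau> z = 0"
    then obtain m n :: int where z: "z = of_int m + of_int n * \<tau>" using jac_eq_0_iff[OF \<tau>] by blast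
    show False
    proof (cases "n = 0")
      case True
      then have "\<bar>of_int m\<bar> < (1::real)" using that(1) by (simp add: z r_def)
      then have "m = 0" by linarith
      then show False using that(2) True by (simp add: z)
    next
      case False
      then have "1 * Im \<tau> \<le> \<bar>of_int n\<bar> * Im \<tau>" using \<tau> by (intro mult_right_mono) linarith+
      also have "\<dots> = \<bar>Im z\<bar>" using \<tau> by (simp add: z abs_mult)
      also have "\<dots> \<le> norm z" by (rule abs_Im_le_cmod)
      finally show False using that(1) by (simp add: r_def)
    qed
  qed
  have "(\<lambda>z. if z = 0 then jac_const else jac_inv z / jac \<tau> z) holomorphic_on ball 0 r"
  proof (rule removable_singularity[OF _ open_ball jac_quotient_tendsto])
    show "(\<lambda>z. jac_inv z / jac \<tau> z) holomorphic_on ball 0 r - {0}"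
      by (intro holomorphic_intros holomorphic_on_jac_inv holomorphic_on_jac \<tau>) (use only0 in auto)
  qed
  moreover have "jac \<tau> 0 = 0" by (auto simp: jac_eq_0_iff[OF \<tau>] intro!: exI[of _ 0])
  then have "(if z = 0 then jac_const else jac_inv z / jac \<tau> z) = jac_quot z" if "z \<in> ball 0 r" for z
    using only0[of z] that by (auto simp: jac_quot_def)
  ultimately show "jac_quot holomorphic_on ball 0 r"
    using holomorphic_transform by blast

qed

lemma jac_quot_holomorphic: "jac_quot holomorphic_on UNIV"
proof -
  obtain r where r: "r > 0" "jac_quot holomorphic_on ball 0 r" by (rule jac_quot_holomorphic_0)
  have "jac_quot field_differentiable (at z)" for z
  proof (cases "jac \<tau> z = 0")
    case True
    then obtain m n where z: "z = of_int m + of_int n * \<tau>" using jac_eq_0_iff[OF \<tau>] by blast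
    \<comment> \<open>Translation by the lattice point z carries the disc around 0 to one around
      z.\<close>
    have "jac_quot \<circ> (\<lambda>w. w - z) holomorphic_on ball z r"
      by (rule holomorphic_on_compose_gen[OF _ r(2)]) (auto intro!: holomorphic_intros simp: dist_norm norm_minus_commute)
    moreover have "jac_quot \<circ> (\<lambda>w. w - z) = jac_quot"
      using jac_quot_periodic[of "_ - z" m n] by (auto simp: z algebra_simps)
    ultimately show ?thesis
      using r(1) by (simp add: holomorphic_on_imp_differentiable_at)
  next
    case False
    have "open (jac \<tau> -` (- {0}))"
      by (intro open_vimage holomorphic_on_imp_continuous_on holomorphic_on_jac \<tau>) auto
    moreover have "jac_quot holomorphic_on (jac \<tau> -` (- {0}))"
      by (rule holomorphic_transform[of "\<lambda>z. jac_inv z / jac \<tau> z"])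
         (auto simp: jac_quot_def intro!: holomorphic_intros holomorphic_on_jac_inv holomorphic_on_jac \<tau>)
    ultimately show ?thesis
      using False by (auto intro: holomorphic_on_imp_differentiable_at)
  qed
  then show ?thesis by (simp add: holomorphic_on_def field_differentiable_at_within)
qed

lemma jac_inv_eq: "jac_inv z = jac_const * jac \<tau> z"
proof -
  \<comment> \<open>A closed period parallelogram. Taking fractional parts of the real coordinates
    of z shows that \<open>jac_quot\<close> has all its values there, and compactness bounds
    them.\<close>
  define P where "P = (\<lambda>(s, t). of_real s + of_real t * \<tau>) ` ({0..1} \<times> {0..1::real})"
  have "compact P"
    unfolding P_def by (intro compact_continuous_image compact_Times) (auto intro!: continuous_intros simp: case_prod_unfold)
  then have "bounded (jac_quot ` P)"
    by (intro compact_imp_bounded compact_continuous_image holomorphic_on_imp_continuous_on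
        holomorphic_on_subset[OF jac_quot_holomorphic]) auto
  moreover have "range jac_quot \<subseteq> jac_quot ` P"
  proof safe
    fix z
    define t where "t = Im z / Im \<tau>"
    define s where "s = Re z - t * Re \<tau>"
    have z: "z = of_real s + of_real t * \<tau>"
      using \<tau> by (simp add: complex_eq_iff s_def t_def)
    have "of_real (frac s) + of_real (frac t) * \<tau> \<in> P"
      unfolding P_def by (rule image_eqI[of _ _ "(frac s, frac t)"]) (auto simp: frac_lt_1 less_imp_le)
    moreover have "jac_quot z = jac_quot (of_real (frac s) + of_real (frac t) * \<tau>)"
      using jac_quot_periodic[of "of_real (frac s) + of_real (frac t) * \<tau>" "\<lfloor>s\<rfloor>" "\<lfloor>t\<rfloor>"]
      by (simp add: z frac_def algebra_simps)
    ultimately show "jac_quot z \<in> jac_quot ` P" by blast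
  qed
  ultimately have "bounded (range jac_quot)" by (rule bounded_subset)
  then obtain c where c: "\<And>z. jac_quot z = c"
    using Liouville_theorem[OF jac_quot_holomorphic] by (auto simp: constant_on_def)
  have "jac \<tau> 0 = 0" by (auto simp: jac_eq_0_iff[OF \<tau>] intro!: exI[of _ 0])
  then have "c = jac_const" using c[of 0] by (simp add: jac_quot_def)
  then show ?thesis
    using c[of z] jac_inv_eq_0[of z] by (auto simp: jac_quot_def field_simps split: if_splits)
qed

text \<open>Division by \<tau> permutes the half periods of the two lattices up to sign and periods.
  Hence the product of \<open>jac_inv\<close> over the half periods of \<tau> is the elementary
  product for - 1 / \<tau> times Gaussian factors.\<close>

lemma jac_const_cube: "jac_const ^ 3 = \<i> * qexp (\<tau> / 4 + 1 / (4 * \<tau>))"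
proof -
  let ?\<tau>' = "- 1 / \<tau>"
  have 1: "jac_inv (1 / 2) = - qexp (- 1 / (8 * \<tau>)) * jac ?\<tau>' (?\<tau>' / 2)"
  proof -
    have "1 / 2 / \<tau> = - (?\<tau>' / 2)" "- ((1 / 2)\<^sup>2) / (2 * \<tau>) = - 1 / (8 * \<tau>)"
      by (simp_all add: power2_eq_square)
    then show ?thesis unfolding jac_inv_def by (simp only: jac_minus[OF Im_inverse_period]) simp
  qed
  have 2: "jac_inv (\<tau> / 2) = qexp (- \<tau> / 8) * jac ?\<tau>' (1 / 2)"
    using period_nonzero by (simp add: jac_inv_def power2_eq_square)
  have "jac ?\<tau>' ((1 + \<tau>) / 2 / \<tau>) = jac ?\<tau>' (- ((?\<tau>' - 1) / 2))"
    using period_nonzero by (intro arg_cong[of _ _ "jac ?\<tau>'"]) (simp add: field_simps)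
  also have "\<dots> = jac ?\<tau>' ((?\<tau>' - 1) / 2 + 1)"
    by (simp only: jac_minus[OF Im_inverse_period] jac_add_1[OF Im_inverse_period])
  also have "(?\<tau>' - 1) / 2 + 1 = (1 + ?\<tau>') / 2" by (simp add: field_simps)
  finally have 3: "jac_inv ((1 + \<tau>) / 2) = qexp (- ((1 + \<tau>)\<^sup>2) / (8 * \<tau>)) * jac ?\<tau>' ((1 + ?\<tau>') / 2)"
    by (simp add: jac_inv_def power_divide)
  have "jac_const ^ 3 * (jac \<tau> (1 / 2) * jac \<tau> (\<tau> / 2) * jac \<tau> ((1 + \<tau>) / 2)) =
      jac_inv (1 / 2) * jac_inv (\<tau> / 2) * jac_inv ((1 + \<tau>) / 2)"
    by (simp add: jac_inv_eq power3_eq_cube)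
  also have "\<dots> = - (qexp (- 1 / (8 * \<tau>)) * qexp (- \<tau> / 8) * qexp (- ((1 + \<tau>)\<^sup>2) / (8 * \<tau>))) *
      (jac ?\<tau>' (1 / 2) * jac ?\<tau>' (?\<tau>' / 2) * jac ?\<tau>' ((1 + ?\<tau>') / 2))"
    unfolding 1 2 3 by (simp only: mult_ac mult_minus_left mult_minus_right)
  finally have "jac_const ^ 3 * (- 2 * qexp (- \<tau> / 2)) =
        - (qexp (- 1 / (8 * \<tau>)) * qexp (- \<tau> / 8) * qexp (- ((1 + \<tau>)\<^sup>2) / (8 * \<tau>))) * (- 2 * qexp (- ?\<tau>' / 2))"
    by (simp only: jac_half_periods[OF \<tau>] jac_half_periods[OF Im_inverse_period])
  moreover have "X * a = - (b * c)" if "X * (- 2 * a) = - b * (- 2 * c)" for X a b c :: complex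
    using that by simp (metis minus_minus)
  ultimately have "jac_const ^ 3 * qexp (- \<tau> / 2) =
      - (qexp (- 1 / (8 * \<tau>)) * qexp (- \<tau> / 8) * qexp (- ((1 + \<tau>)\<^sup>2) / (8 * \<tau>)) * qexp (- ?\<tau>' / 2))"
    by blast
  \<comment> \<open>The cross term of (1 + \<tau>)^2 / (8 \<tau>) is 1 / 4, the source of the factor
    \<i>.\<close>
  also have "qexp (- 1 / (8 * \<tau>)) * qexp (- \<tau> / 8) * qexp (- ((1 + \<tau>)\<^sup>2) / (8 * \<tau>)) * qexp (- ?\<tau>' / 2) =
      qexp (- (1 / 4)) * qexp (\<tau> / 4 + 1 / (4 * \<tau>)) * qexp (- \<tau> / 2)"
    unfolding qexp_add [symmetric] using period_nonzero by (intro arg_cong[of _ _ qexp]) (simp add: field_simps power2_eq_square)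
  finally have "jac_const ^ 3 * qexp (- \<tau> / 2) = \<i> * qexp (\<tau> / 4 + 1 / (4 * \<tau>)) * qexp (- \<tau> / 2)"
    by (simp only: qexp_minus qexp_quarter) simp
  then show ?thesis by (simp only: mult_cancel_right qexp_nonzero simp_thms)
qed

end

section \<open>The discriminant and its behaviour under inversion\<close>

definition Delta :: "complex \<Rightarrow> complex" where
  "Delta \<tau> = qexp \<tau> * euler_phi (qexp \<tau>) ^ 24"

lemma Delta_nonzero: "Im \<tau> > 0 \<Longrightarrow> Delta \<tau> \<noteq> 0"
  by (simp add: Delta_def euler_phi_nonzero)

lemma Delta_add_1: "Delta (\<tau> + 1) = Delta \<tau>"
  by (simp add: Delta_def qexp_add)

text \<open>The twelfth power is taken because \<open>jac_const\<close> is known through its cube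
  and the factor \<i> in the cube disappears in the fourth power. As \<open>jac_const\<close>
  contains squares of \<open>euler_phi\<close> and one factor 1 / \<tau>, this yields both the
  exponent 24 and the weight 12.\<close>

lemma Delta_minus_inverse:
  assumes \<tau>: "Im \<tau> > 0"
  shows "Delta (- 1 / \<tau>) = \<tau> ^ 12 * Delta \<tau>"
proof -
  have period_nonzero: "\<tau> \<noteq> 0" using \<tau> by auto
  have "jac_const \<tau> ^ 12 = (jac_const \<tau> ^ 3) ^ 4" by (simp flip: power_mult)
  also have "\<dots> = qexp (of_nat 4 * (\<tau> / 4 + 1 / (4 * \<tau>)))"
    unfolding jac_const_cube[OF \<tau>] qexp_of_nat_mult by (simp add: power_mult_distrib)
  also have "of_nat 4 * (\<tau> / 4 + 1 / (4 * \<tau>)) = \<tau> - (- 1 / \<tau>)"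
    by (simp add: algebra_simps)
  also have "qexp \<dots> = qexp \<tau> / qexp (- 1 / \<tau>)" by (rule qexp_diff)
  finally have "euler_phi (qexp (- 1 / \<tau>)) ^ 24 / (\<tau> ^ 12 * euler_phi (qexp \<tau>) ^ 24) = qexp \<tau> / qexp (- 1 / \<tau>)"
    unfolding jac_const_def[OF \<tau>] by (simp add: power_divide power_mult_distrib flip: power_mult)
  moreover have "euler_phi (qexp \<tau>) \<noteq> 0" using euler_phi_nonzero \<tau> by simp
  ultimately show ?thesis
    using period_nonzero by (simp add: Delta_def field_simps)
qed

lemma holomorphic_on_Delta: "Delta holomorphic_on {\<tau>. Im \<tau> > 0}"
proof -
  have "(\<lambda>\<tau>. euler_phi (qexp \<tau>)) holomorphic_on {\<tau>. Im \<tau> > 0}"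
  proof -
    have "euler_phi \<circ> qexp holomorphic_on {\<tau>. Im \<tau> > 0}"
      by (rule holomorphic_on_compose_gen[OF _ holomorphic_on_euler_phi])
         (auto simp: qexp_def norm_exp_eq_Re intro!: holomorphic_intros)
    then show ?thesis by (simp add: o_def)
  qed
  then show ?thesis unfolding Delta_def [abs_def] by (intro holomorphic_intros)
qed

section \<open>Power series with natural coefficients\<close>

definition taylor_coeff :: "(complex \<Rightarrow> complex) \<Rightarrow> nat \<Rightarrow> complex" where
  "taylor_coeff f n = (deriv ^^ n) f 0 / fact n"

text \<open>Series are represented by their sums on the unit disc rather than formally, so that
  infinite products and their quotients can be treated as locally uniform limits of finite
  ones.\<close>

definition nat_coeffs :: "(complex \<Rightarrow> complex) \<Rightarrow> bool" where
  "nat_coeffs f \<longleftrightarrow> f holomorphic_on ball 0 1 \<and> (\<forall>n. taylor_coeff f n \<in> \<nat>)"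

lemma taylor_coeff_sums:
  assumes "f holomorphic_on ball 0 1" "norm x < 1"
  shows "(\<lambda>n. taylor_coeff f n * x ^ n) sums f x"
  using holomorphic_power_series[OF assms(1), of x] assms(2) by (simp add: taylor_coeff_def)

lemma taylor_coeff_cong:
  assumes "\<And>x. norm x < 1 \<Longrightarrow> f x = g x"
  shows "taylor_coeff f n = taylor_coeff g n"
proof -
  have "eventually (\<lambda>x. x \<in> ball 0 1) (nhds (0::complex))"
    by (rule eventually_nhds_in_open) auto
  then have "eventually (\<lambda>x. f x = g x) (nhds 0)"
    by eventually_elim (use assms in auto)
  then show ?thesis unfolding taylor_coeff_def by (simp cong: higher_deriv_cong_ev)
qed

lemma nat_coeffs_cong:
  assumes "nat_coeffs f" "\<And>x. norm x < 1 \<Longrightarrow> f x = g x"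
  shows "nat_coeffs g"
  using assms taylor_coeff_cong[of f g] holomorphic_transform[of f "ball 0 1" g] by (auto simp: nat_coeffs_def)

lemma taylor_coeff_eqI:
  assumes "\<And>x. norm x < 1 \<Longrightarrow> (\<lambda>n. a n * x ^ n) sums f x"
  shows "taylor_coeff f n = a n"
proof -
  define F where "F = Abs_fps a"
  have "fps_conv_radius F \<ge> norm (1 / 2 :: complex)"
    unfolding fps_conv_radius_def F_def
    by (rule conv_radius_geI) (use assms[of "1/2"] in \<open>simp add: sums_iff\<close>)
  then have R: "fps_conv_radius F > 0" by (rule less_le_trans[rotated]) auto
  have "taylor_coeff f n = taylor_coeff (eval_fps F) n"
    by (rule taylor_coeff_cong) (use assms in \<open>simp add: eval_fps_def F_def sums_iff\<close>)
  also have "\<dots> = fps_nth F n"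
    using fps_nth_conv_deriv[OF R, of n] by (simp add: taylor_coeff_def)
  finally show ?thesis by (simp add: F_def)
qed

lemma taylor_coeff_mult:
  assumes "f holomorphic_on ball 0 1" "g holomorphic_on ball 0 1"
  shows "taylor_coeff (\<lambda>x. f x * g x) n = (\<Sum>i\<le>n. taylor_coeff f i * taylor_coeff g (n - i))"
proof -
  have "taylor_coeff (\<lambda>x. f x * g x) n =
      (\<Sum>i = 0..n. of_nat (n choose i) * (deriv ^^ i) f 0 * (deriv ^^ (n-i)) g 0) / fact n"
    unfolding taylor_coeff_def by (subst higher_deriv_mult[OF assms]) auto
  also have "\<dots> = (\<Sum>i\<le>n. taylor_coeff f i * taylor_coeff g (n - i))"
    unfolding sum_divide_distrib atLeast0AtMost
  proof (rule sum.cong)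
    fix i assume "i \<in> {..n}"
    then show "of_nat (n choose i) * (deriv ^^ i) f 0 * (deriv ^^ (n-i)) g 0 / fact n = taylor_coeff f i * taylor_coeff g (n - i)"
      using binomial_fact[of i n, where ?'a = complex] by (simp add: taylor_coeff_def)
  qed simp
  finally show ?thesis .
qed

lemma nat_coeffs_const: "nat_coeffs (\<lambda>_. of_nat k)"
  by (auto simp: nat_coeffs_def taylor_coeff_def)

lemma nat_coeffs_0: "nat_coeffs (\<lambda>_. 0)" and nat_coeffs_1: "nat_coeffs (\<lambda>_. 1)"
  using nat_coeffs_const[of 0] nat_coeffs_const[of 1] by simp_all

lemma nat_coeffs_ident: "nat_coeffs (\<lambda>x. x)"
  by (auto simp: nat_coeffs_def taylor_coeff_def)

lemma nat_coeffs_add: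
  assumes "nat_coeffs f" "nat_coeffs g"
  shows "nat_coeffs (\<lambda>x. f x + g x)"
  using assms higher_deriv_add[of f "ball 0 1" g 0]
  by (auto simp: nat_coeffs_def taylor_coeff_def add_divide_distrib intro!: holomorphic_intros)

lemma nat_coeffs_mult:
  assumes "nat_coeffs f" "nat_coeffs g"
  shows "nat_coeffs (\<lambda>x. f x * g x)"
proof -
  have "(\<Sum>i\<in>I. a i) \<in> \<nat>" if "\<And>i. i \<in> I \<Longrightarrow> a i \<in> \<nat>" for I :: "nat set" and a :: "nat \<Rightarrow> complex"
    using that by (induction I rule: infinite_finite_induct) auto
  then show ?thesis
    using assms by (auto simp: nat_coeffs_def taylor_coeff_mult intro!: holomorphic_intros Nats_mult)
qed

lemma nat_coeffs_power: "nat_coeffs f \<Longrightarrow> nat_coeffs (\<lambda>x. f x ^ k)"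
  by (induction k) (auto intro: nat_coeffs_1 nat_coeffs_mult)

lemma nat_coeffs_sum: "(\<And>i. i \<in> I \<Longrightarrow> nat_coeffs (f i)) \<Longrightarrow> nat_coeffs (\<lambda>x. \<Sum>i\<in>I. f i x)"
  by (induction I rule: infinite_finite_induct) (auto intro: nat_coeffs_0 nat_coeffs_add)

lemma nat_coeffs_prod: "(\<And>i. i \<in> I \<Longrightarrow> nat_coeffs (f i)) \<Longrightarrow> nat_coeffs (\<lambda>x. \<Prod>i\<in>I. f i x)"
  by (induction I rule: infinite_finite_induct) (auto intro: nat_coeffs_1 nat_coeffs_mult)

section \<open>Locally uniform limits on the unit disc\<close>

definition loc_unif :: "(nat \<Rightarrow> complex \<Rightarrow> complex) \<Rightarrow> (complex \<Rightarrow> complex) \<Rightarrow> bool" where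
  "loc_unif F f \<longleftrightarrow> (\<forall>N. F N holomorphic_on ball 0 1) \<and>
     (\<forall>r. 0 < r \<longrightarrow> r < 1 \<longrightarrow> uniform_limit (cball 0 r) F f sequentially)"

lemma loc_unif_holomorphic:
  assumes "loc_unif F f"
  shows "f holomorphic_on ball 0 1"
proof (rule holomorphic_uniform_sequence[OF open_ball])
  show "F N holomorphic_on ball 0 1" for N using assms by (simp add: loc_unif_def)
  fix x :: complex assume x: "x \<in> ball 0 1"
  define r where "r = (1 + norm x) / 2"
  have r: "0 < r" "r < 1" "norm x + (1 - norm x) / 2 = r"
    using x by (auto simp: r_def field_simps add_pos_nonneg)
  have sub: "cball x ((1 - norm x) / 2) \<subseteq> cball 0 r"
    using r(3) by (simp add: cball_subset_cball_iff)
  show "\<exists>d>0. cball x d \<subseteq> ball 0 1 \<and> uniform_limit (cball x d) F f sequentially"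
  proof (intro exI conjI)
    show "cball x ((1 - norm x) / 2) \<subseteq> ball 0 1" using sub r by auto
    show "uniform_limit (cball x ((1 - norm x) / 2)) F f sequentially"
      by (rule uniform_limit_on_subset[OF _ sub]) (use assms r in \<open>auto simp: loc_unif_def\<close>)
  qed (use x in auto)
qed

lemma loc_unif_bounded:
  assumes "f holomorphic_on ball 0 1" "r < 1"
  shows "bounded (f ` cball 0 r)"
  by (intro compact_imp_bounded compact_continuous_image holomorphic_on_imp_continuous_on
      holomorphic_on_subset[OF assms(1)]) (use assms(2) in auto)

lemma loc_unif_cong:
  assumes "loc_unif F f" "\<And>N x. norm x < 1 \<Longrightarrow> F N x = G N x" "\<And>x. norm x < 1 \<Longrightarrow> f x = g x"
  shows "loc_unif G g"
  unfolding loc_unif_def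
proof (intro conjI allI impI)
  show "G N holomorphic_on ball 0 1" for N
    using assms(1,2) holomorphic_transform[of "F N" "ball 0 1" "G N"] by (auto simp: loc_unif_def)
  fix r :: real assume "0 < r" "r < 1"
  then show "uniform_limit (cball 0 r) G g sequentially"
    using assms by (subst uniform_limit_cong'[where g=F and i=f]) (auto simp: loc_unif_def)
qed

lemma loc_unif_mult:
  assumes "loc_unif F f" "loc_unif G g"
  shows "loc_unif (\<lambda>N x. F N x * G N x) (\<lambda>x. f x * g x)"
  using assms loc_unif_bounded loc_unif_holomorphic
  unfolding loc_unif_def by (auto intro!: holomorphic_intros uniform_lim_mult)

lemma loc_unif_diff:
  assumes "loc_unif F f" "loc_unif G g"
  shows "loc_unif (\<lambda>N x. F N x - G N x) (\<lambda>x. f x - g x)"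
  using assms unfolding loc_unif_def by (auto intro!: holomorphic_intros uniform_limit_minus)

lemma loc_unif_const: "f holomorphic_on ball 0 1 \<Longrightarrow> loc_unif (\<lambda>_. f) f"
  by (auto simp: loc_unif_def uniform_limit_const)

lemma loc_unif_divide:
  assumes "loc_unif F f" "loc_unif G g" "\<And>x. norm x < 1 \<Longrightarrow> g x \<noteq> 0" "\<And>N x. norm x < 1 \<Longrightarrow> G N x \<noteq> 0"
  shows "loc_unif (\<lambda>N x. F N x / G N x) (\<lambda>x. f x / g x)"
  unfolding loc_unif_def
proof (intro conjI allI impI)
  show "(\<lambda>x. F N x / G N x) holomorphic_on ball 0 1" for N
    using assms unfolding loc_unif_def by (auto intro!: holomorphic_intros)
  fix r :: real assume r: "0 < r" "r < 1"
  have "continuous_on (cball 0 r) (\<lambda>x. norm (g x))"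
    by (intro continuous_intros holomorphic_on_imp_continuous_on
        holomorphic_on_subset[OF loc_unif_holomorphic[OF assms(2)]]) (use r in auto)
  then obtain y where y: "y \<in> cball 0 r" "\<forall>x\<in>cball 0 r. norm (g y) \<le> norm (g x)"
    using continuous_attains_inf[of "cball 0 r" "\<lambda>x. norm (g x)"] r by auto
  show "uniform_limit (cball 0 r) (\<lambda>N x. F N x / G N x) (\<lambda>x. f x / g x) sequentially"
  proof (rule uniform_lim_divide)
    show "norm (g y) > 0" using assms(3)[of y] y r by auto
    show "norm (g y) \<le> norm (g x)" if "x \<in> cball 0 r" for x using y that by auto
  qed (use assms r loc_unif_bounded loc_unif_holomorphic in \<open>auto simp: loc_unif_def\<close>)
qed

lemma loc_unif_compose:
  assumes "loc_unif F f" "s holomorphic_on ball 0 1" "\<And>x. norm x < 1 \<Longrightarrow> norm (s x) \<le> norm x"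
  shows "loc_unif (\<lambda>N x. F N (s x)) (\<lambda>x. f (s x))"
  unfolding loc_unif_def
proof (intro conjI allI impI)
  have "s ` ball 0 1 \<subseteq> ball 0 1" using assms(3) by force
  then show "(\<lambda>x. F N (s x)) holomorphic_on ball 0 1" for N
    using holomorphic_on_compose_gen[OF assms(2), of "F N" "ball 0 1"] assms(1)
    by (auto simp: loc_unif_def o_def)
  fix r :: real assume r: "0 < r" "r < 1"
  have sub: "s ` cball 0 r \<subseteq> cball 0 r"
  proof clarsimp
    fix x :: complex assume "norm x \<le> r"
    then show "norm (s x) \<le> r" using assms(3)[of x] r by simp
  qed
  have lim: "uniform_limit (cball 0 r) F f sequentially" using assms(1) r by (simp add: loc_unif_def)
  show "uniform_limit (cball 0 r) (\<lambda>N x. F N (s x)) (\<lambda>x. f (s x)) sequentially"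
    unfolding uniform_limit_iff
  proof (intro allI impI)
    fix e :: real assume "e > 0"
    then have "\<forall>\<^sub>F N in sequentially. \<forall>x\<in>cball 0 r. dist (F N x) (f x) < e"
      using lim unfolding uniform_limit_iff by blast
    then show "\<forall>\<^sub>F N in sequentially. \<forall>x\<in>cball 0 r. dist (F N (s x)) (f (s x)) < e"
      by eventually_elim (use sub in blast)
  qed
qed

lemma loc_unif_subseq:
  assumes "loc_unif F f" "strict_mono h"
  shows "loc_unif (\<lambda>N. F (h N)) f"
  using assms filterlim_compose[OF _ filterlim_subseq[OF assms(2)]] by (auto simp: loc_unif_def)

text \<open>By Cauchy's inequality on the circle of radius 1/2 each coefficient converges, and the
  natural numbers are closed in the plane.\<close>

lemma nat_coeffs_limit:
  assumes lim: "loc_unif F f" and F: "\<And>N. nat_coeffs (F N)"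
  shows "nat_coeffs f"
  unfolding nat_coeffs_def
proof (intro conjI allI)
  show hol: "f holomorphic_on ball 0 1" by (rule loc_unif_holomorphic[OF lim])
  fix n
  have "(\<lambda>N. taylor_coeff (F N) n) \<longlonglongrightarrow> taylor_coeff f n"
  proof (rule LIMSEQ_I)
    fix e :: real assume e: "e > 0"
    \<comment> \<open>Chosen so that the bound \<open>d / (1/2)^n\<close> from Cauchy's inequality
      is e / 2.\<close>
    define d where "d = e * (1/2)^n / 2"
    have d: "d > 0" using e by (simp add: d_def)
    have "uniform_limit (cball 0 (1/2)) F f sequentially" using lim by (simp add: loc_unif_def)
    then have "\<forall>\<^sub>F N in sequentially. \<forall>x\<in>cball 0 (1/2). dist (F N x) (f x) < d"
      using d by (auto simp: uniform_limit_iff)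
    then obtain N0 where N0: "\<And>N x. N \<ge> N0 \<Longrightarrow> x \<in> cball 0 (1/2) \<Longrightarrow> dist (F N x) (f x) < d"
      unfolding eventually_sequentially by blast
    show "\<exists>N0. \<forall>N\<ge>N0. norm (taylor_coeff (F N) n - taylor_coeff f n) < e"
    proof (intro exI allI impI)
      fix N assume N: "N \<ge> N0"
      let ?g = "\<lambda>x. F N x - f x"
      have FN: "F N holomorphic_on ball 0 1" using F by (simp add: nat_coeffs_def)
      have holg: "?g holomorphic_on ball 0 1" by (intro holomorphic_intros FN hol)
      have "norm ((deriv ^^ n) ?g 0) \<le> fact n * d / (1/2)^n"
      proof (rule Cauchy_inequality)
        show "?g holomorphic_on ball 0 (1/2)" by (rule holomorphic_on_subset[OF holg]) auto
        show "continuous_on (cball 0 (1/2)) ?g"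
          by (intro holomorphic_on_imp_continuous_on holomorphic_on_subset[OF holg]) auto
        show "norm (?g x) \<le> d" if "norm (0 - x) = 1/2" for x
          using N0[OF N, of x] that by (simp add: dist_norm less_imp_le)
      qed auto
      also have "(deriv ^^ n) ?g 0 = fact n * (taylor_coeff (F N) n - taylor_coeff f n)"
        by (subst higher_deriv_diff[OF FN hol]) (auto simp: taylor_coeff_def field_simps)
      finally have "norm (taylor_coeff (F N) n - taylor_coeff f n) \<le> d / (1/2)^n"
        by (simp add: norm_mult times_divide_eq_right [symmetric] del: times_divide_eq_right)
      also have "\<dots> < e" using e by (simp add: d_def)
      finally show "norm (taylor_coeff (F N) n - taylor_coeff f n) < e" .
    qed
  qed
  then show "taylor_coeff f n \<in> \<nat>"
    by (rule Lim_in_closed_set[rotated 3]) (use F in \<open>auto simp: nat_coeffs_def\<close>)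
qed

section \<open>Coefficientwise comparison\<close>

definition coeff_le :: "(complex \<Rightarrow> complex) \<Rightarrow> (complex \<Rightarrow> complex) \<Rightarrow> bool" where
  "coeff_le f g \<longleftrightarrow> nat_coeffs f \<and> nat_coeffs (\<lambda>x. g x - f x)"

lemma coeff_le_nat_coeffs: "coeff_le f g \<Longrightarrow> nat_coeffs f" "coeff_le f g \<Longrightarrow> nat_coeffs g"
  using nat_coeffs_add[of f "\<lambda>x. g x - f x"] by (auto simp: coeff_le_def)

lemma coeff_le_refl: "nat_coeffs f \<Longrightarrow> coeff_le f f"
  by (simp add: coeff_le_def nat_coeffs_0)

lemma coeff_le_mult:
  assumes "coeff_le f g" "coeff_le f' g'"
  shows "coeff_le (\<lambda>x. f x * f' x) (\<lambda>x. g x * g' x)"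
proof -
  have "nat_coeffs (\<lambda>x. g x * (g' x - f' x) + (g x - f x) * f' x)"
    using assms coeff_le_nat_coeffs(2)[OF assms(1)] by (intro nat_coeffs_add nat_coeffs_mult) (auto simp: coeff_le_def)
  moreover have "(\<lambda>x. g x * (g' x - f' x) + (g x - f x) * f' x) = (\<lambda>x. g x * g' x - f x * f' x)"
    by (simp add: algebra_simps)
  ultimately show ?thesis using assms by (auto simp: coeff_le_def intro: nat_coeffs_mult)
qed

lemma coeff_le_add:
  assumes "coeff_le f g" "coeff_le f' g'"
  shows "coeff_le (\<lambda>x. f x + f' x) (\<lambda>x. g x + g' x)"
proof -
  have "nat_coeffs (\<lambda>x. (g x - f x) + (g' x - f' x))"
    using assms by (intro nat_coeffs_add) (auto simp: coeff_le_def)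
  moreover have "(\<lambda>x. (g x - f x) + (g' x - f' x)) = (\<lambda>x. (g x + g' x) - (f x + f' x))"
    by (simp add: algebra_simps)
  ultimately show ?thesis using assms by (auto simp: coeff_le_def intro: nat_coeffs_add)
qed

lemma coeff_le_power: "coeff_le f g \<Longrightarrow> coeff_le (\<lambda>x. f x ^ k) (\<lambda>x. g x ^ k)"
  by (induction k) (auto intro: coeff_le_mult coeff_le_refl nat_coeffs_1)

lemma coeff_le_trans:
  assumes "coeff_le f g" "coeff_le g h"
  shows "coeff_le f h"
proof -
  have "nat_coeffs (\<lambda>x. (g x - f x) + (h x - g x))"
    using assms by (intro nat_coeffs_add) (auto simp: coeff_le_def)
  then show ?thesis using assms by (simp add: coeff_le_def)
qed

lemma coeff_le_prod:
  "(\<And>i. i \<in> I \<Longrightarrow> coeff_le (f i) (g i)) \<Longrightarrow> coeff_le (\<lambda>x. \<Prod>i\<in>I. f i x) (\<lambda>x. \<Prod>i\<in>I. g i x)"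
  by (induction I rule: infinite_finite_induct) (auto intro: coeff_le_mult coeff_le_refl nat_coeffs_1)

lemma coeff_le_cong:
  assumes "coeff_le f g" "\<And>x. norm x < 1 \<Longrightarrow> f x = f' x" "\<And>x. norm x < 1 \<Longrightarrow> g x = g' x"
  shows "coeff_le f' g'"
  using assms nat_coeffs_cong[of f f'] nat_coeffs_cong[of "\<lambda>x. g x - f x" "\<lambda>x. g' x - f' x"] by (auto simp: coeff_le_def)

lemma coeff_le_limit:
  assumes "loc_unif F f" "loc_unif G g" "\<And>N. coeff_le (F N) (G N)"
  shows "coeff_le f g"
  using nat_coeffs_limit[OF assms(1)] nat_coeffs_limit[OF loc_unif_diff[OF assms(2,1)]] assms(3) by (auto simp: coeff_le_def)

lemma coeff_le_taylor_coeff: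
  assumes "coeff_le f g"
  obtains a b where "taylor_coeff f n = of_nat a" "taylor_coeff g n = of_nat b" "a \<le> b"
proof -
  have hol: "f holomorphic_on ball 0 1" "g holomorphic_on ball 0 1"
    using coeff_le_nat_coeffs[OF assms] by (auto simp: nat_coeffs_def)
  obtain a where a: "taylor_coeff f n = of_nat a"
    using assms unfolding coeff_le_def nat_coeffs_def by (metis Nats_cases)
  obtain k where k: "taylor_coeff (\<lambda>x. g x - f x) n = of_nat k"
    using assms unfolding coeff_le_def nat_coeffs_def by (metis Nats_cases)
  have "taylor_coeff (\<lambda>x. g x - f x) n = taylor_coeff g n - taylor_coeff f n"
    unfolding taylor_coeff_def by (subst higher_deriv_diff[OF hol(2,1)]) (auto simp: diff_divide_distrib)
  then have "taylor_coeff g n = of_nat (a + k)" using a k by (simp add: algebra_simps)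
  then show thesis using that[of a "a + k"] a by simp
qed

lemma nat_coeffs_ident_power: "nat_coeffs (\<lambda>x. x ^ k)"
  by (intro nat_coeffs_power nat_coeffs_ident)

lemma nat_coeffs_geometric: "nat_coeffs (\<lambda>x. 1 / (1 - x ^ Suc k))"
proof -
  have "loc_unif (\<lambda>N x. (1 - (x ^ Suc k) ^ N) / (1 - x ^ Suc k)) (\<lambda>x. (1 - 0) / (1 - x ^ Suc k))"
  proof (rule loc_unif_divide)
    have ne: "x ^ Suc k \<noteq> 1" if "norm x < 1" for x :: complex
      using that by (metis norm_one norm_power power_Suc_less_one norm_ge_zero less_irrefl norm_zero
          power_0_Suc zero_neq_one order_le_less)
    show "1 - x ^ Suc k \<noteq> 0" "1 - x ^ Suc k \<noteq> 0" if "norm x < 1" for x :: complex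
      using ne[OF that] by auto
    show "loc_unif (\<lambda>N x. 1 - x ^ Suc k) (\<lambda>x. 1 - x ^ Suc k)"
      by (intro loc_unif_const holomorphic_intros)
    show "loc_unif (\<lambda>N x. 1 - (x ^ Suc k) ^ N) (\<lambda>x. 1 - 0)"
      unfolding loc_unif_def
    proof (intro conjI allI impI)
      show "(\<lambda>x. 1 - (x ^ Suc k) ^ N) holomorphic_on ball 0 1" for N by (intro holomorphic_intros)
      fix r :: real assume r: "0 < r" "r < 1"
      have "uniform_limit (cball 0 r) (\<lambda>N x. (x ^ Suc k) ^ N) (\<lambda>x. 0 :: complex) sequentially"
        unfolding uniform_limit_iff
      proof (intro allI impI)
        fix e :: real assume e: "e > 0"
        have "(\<lambda>N. r ^ N) \<longlonglongrightarrow> 0" using r by (intro LIMSEQ_realpow_zero) auto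
        then have "\<forall>\<^sub>F N in sequentially. r ^ N < e" using e by (rule order_tendstoD(2))
        then show "\<forall>\<^sub>F N in sequentially. \<forall>x\<in>cball 0 r. dist ((x ^ Suc k) ^ N) (0::complex) < e"
        proof eventually_elim
          case (elim N)
          show ?case
          proof
            fix x :: complex assume x: "x \<in> cball 0 r"
            have "norm x ^ Suc k \<le> r * 1"
              unfolding power_Suc using x r by (intro mult_mono power_le_one) auto
            then have "(norm x ^ Suc k) ^ N \<le> r ^ N" by (intro power_mono) auto
            then show "dist ((x ^ Suc k) ^ N) 0 < e" using elim by (simp add: norm_power norm_mult)
          qed
        qed
      qed
      from uniform_limit_minus[OF uniform_limit_const this]
      show "uniform_limit (cball 0 r) (\<lambda>N x. 1 - (x ^ Suc k) ^ N) (\<lambda>x. 1 - 0 :: complex) sequentially" .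
    qed
  qed
  then have "loc_unif (\<lambda>N x. \<Sum>i<N. (x ^ Suc k) ^ i) (\<lambda>x. 1 / (1 - x ^ Suc k))"
  proof (rule loc_unif_cong)
    fix N and x :: complex assume "norm x < 1"
    then have "x ^ Suc k \<noteq> 1"
      by (metis norm_one norm_power power_Suc_less_one norm_ge_zero less_irrefl norm_zero
          power_0_Suc zero_neq_one order_le_less)
    then show "(1 - (x ^ Suc k) ^ N) / (1 - x ^ Suc k) = (\<Sum>i<N. (x ^ Suc k) ^ i)"
      using one_diff_power_eq[of "x ^ Suc k" N] by simp
  qed simp
  moreover have "nat_coeffs (\<lambda>x. \<Sum>i<N. (x ^ Suc k) ^ i)" for N
    by (intro nat_coeffs_sum nat_coeffs_power nat_coeffs_ident)
  ultimately show ?thesis by (rule nat_coeffs_limit)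
qed

lemma power_Suc_neq_1: "norm (x :: complex) < 1 \<Longrightarrow> x ^ Suc k \<noteq> 1"
  by (metis norm_one norm_power power_Suc_less_one norm_ge_zero less_irrefl norm_zero
      power_0_Suc zero_neq_one order_le_less)

lemma loc_unif_euler_phi: "loc_unif (\<lambda>N x. \<Prod>n<N. 1 - x ^ Suc n) euler_phi"
  unfolding loc_unif_def by (auto intro!: holomorphic_intros euler_phi_uniform_limit[simplified])

lemma loc_unif_inverse_euler_phi: "loc_unif (\<lambda>N x. \<Prod>n<N. 1 / (1 - x ^ Suc n)) (\<lambda>x. 1 / euler_phi x)"
proof -
  have "loc_unif (\<lambda>N x. 1 / (\<Prod>n<N. 1 - x ^ Suc n)) (\<lambda>x. 1 / euler_phi x)"
    by (rule loc_unif_divide[OF loc_unif_const loc_unif_euler_phi])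
       (use power_Suc_neq_1 euler_phi_nonzero in \<open>auto intro!: holomorphic_intros\<close>)
  then show ?thesis by (rule loc_unif_cong) (simp_all add: prod_dividef)
qed

lemma norm_power_le_self: "norm (x :: complex) < 1 \<Longrightarrow> m \<ge> 1 \<Longrightarrow> norm (x ^ m) \<le> norm x"
  using power_decreasing[of 1 m "norm x"] by (simp add: norm_power)

text \<open>Each factor 1 - x^(m n) is divisible by 1 - x^n. The quotient thus counts partitions in
  which every part occurs fewer than m times.\<close>

lemma loc_unif_euler_phi_quotient:
  assumes m: "m \<ge> 1"
  shows "loc_unif (\<lambda>N x. \<Prod>n<N. \<Sum>j<m. (x ^ Suc n) ^ j) (\<lambda>x. euler_phi (x ^ m) / euler_phi x)"
proof -
  have "loc_unif (\<lambda>N x. (\<Prod>n<N. 1 - (x ^ m) ^ Suc n) / (\<Prod>n<N. 1 - x ^ Suc n)) (\<lambda>x. euler_phi (x ^ m) / euler_phi x)"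
    by (rule loc_unif_divide[OF loc_unif_compose[OF loc_unif_euler_phi] loc_unif_euler_phi])
       (use m power_Suc_neq_1 euler_phi_nonzero norm_power_le_self in \<open>auto intro!: holomorphic_intros\<close>)
  then show ?thesis
  proof (rule loc_unif_cong)
    fix N and x :: complex assume x: "norm x < 1"
    have "(\<Prod>n<N. 1 - (x ^ m) ^ Suc n) = (\<Prod>n<N. (1 - x ^ Suc n) * (\<Sum>j<m. (x ^ Suc n) ^ j))"
    proof (rule prod.cong)
      fix n
      have "(x ^ m) ^ Suc n = (x ^ Suc n) ^ m" by (metis power_mult mult.commute)
      then show "1 - (x ^ m) ^ Suc n = (1 - x ^ Suc n) * (\<Sum>j<m. (x ^ Suc n) ^ j)"
        by (simp only: one_diff_power_eq)
    qed simp
    also have "\<dots> = (\<Prod>n<N. 1 - x ^ Suc n) * (\<Prod>n<N. \<Sum>j<m. (x ^ Suc n) ^ j)"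
      by (rule prod.distrib)
    finally show "(\<Prod>n<N. 1 - (x ^ m) ^ Suc n) / (\<Prod>n<N. 1 - x ^ Suc n) = (\<Prod>n<N. \<Sum>j<m. (x ^ Suc n) ^ j)"
      using power_Suc_neq_1[OF x] by simp
  qed simp
qed

lemma coeff_le_geometric: "coeff_le (\<lambda>x. \<Sum>j<m. (x ^ Suc n) ^ j) (\<lambda>x. 1 / (1 - x ^ Suc n))"
  unfolding coeff_le_def
proof
  show "nat_coeffs (\<lambda>x. \<Sum>j<m. (x ^ Suc n) ^ j)" by (intro nat_coeffs_sum nat_coeffs_power nat_coeffs_ident)
  have "nat_coeffs (\<lambda>x. (x ^ Suc n) ^ m * (1 / (1 - x ^ Suc n)))"
    by (intro nat_coeffs_mult nat_coeffs_power nat_coeffs_ident nat_coeffs_geometric)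
  then show "nat_coeffs (\<lambda>x. 1 / (1 - x ^ Suc n) - (\<Sum>j<m. (x ^ Suc n) ^ j))"
  proof (rule nat_coeffs_cong)
    fix x :: complex assume "norm x < 1"
    then have ne: "1 - x ^ Suc n \<noteq> 0" using power_Suc_neq_1 by auto
    have "1 - (x ^ Suc n) ^ m = (1 - x ^ Suc n) * (\<Sum>j<m. (x ^ Suc n) ^ j)" by (rule one_diff_power_eq)
    then show "(x ^ Suc n) ^ m * (1 / (1 - x ^ Suc n)) = 1 / (1 - x ^ Suc n) - (\<Sum>j<m. (x ^ Suc n) ^ j)"
      using ne by (simp add: field_simps del: power_Suc)
  qed
qed

text \<open>The exponents m, ..., 2 m - 1 on the left all occur in the full geometric
  series.\<close>

lemma coeff_le_power_geometric: "coeff_le (\<lambda>x. x ^ m * (\<Sum>j<m. (x ^ Suc 0) ^ j)) (\<lambda>x. 1 / (1 - x ^ Suc 0))"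
proof (rule coeff_le_trans)
  have "nat_coeffs (\<lambda>x. (\<Sum>j<2*m. (x ^ Suc 0) ^ j) - x ^ m * (\<Sum>j<m. (x ^ Suc 0) ^ j))"
  proof -
    have "(\<Sum>j<2*m. x ^ j) = (\<Sum>j<m. x ^ j) + x ^ m * (\<Sum>j<m. x ^ j)" for x :: complex
    proof -
      have "(\<Sum>j<m + k. x ^ j) = (\<Sum>j<m. x ^ j) + (\<Sum>j<k. x ^ (m + j))" for k
        by (induction k) (simp_all add: add.assoc)
      from this[of m] show ?thesis by (simp add: power_add sum_distrib_left mult_2)
    qed
    then show ?thesis by (simp add: nat_coeffs_sum nat_coeffs_ident_power)
  qed
  then show "coeff_le (\<lambda>x. x ^ m * (\<Sum>j<m. (x ^ Suc 0) ^ j)) (\<lambda>x. \<Sum>j<2*m. (x ^ Suc 0) ^ j)"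
    by (auto simp: coeff_le_def intro!: nat_coeffs_mult nat_coeffs_sum nat_coeffs_power nat_coeffs_ident)
  show "coeff_le (\<lambda>x. \<Sum>j<2*m. (x ^ Suc 0) ^ j) (\<lambda>x. 1 / (1 - x ^ Suc 0))" by (rule coeff_le_geometric)
qed

text \<open>Partitions with bounded repetition are among all partitions. In the second claim the
  additional \<open>x ^ m\<close> is absorbed by the factor for parts of size 1, which then occur
  between m and 2 m - 1 times.\<close>

lemma coeff_le_euler_phi_quotient:
  assumes m: "m \<ge> 1"
  shows "coeff_le (\<lambda>x. euler_phi (x ^ m) / euler_phi x) (\<lambda>x. 1 / euler_phi x)"
    and "coeff_le (\<lambda>x. x ^ m * (euler_phi (x ^ m) / euler_phi x)) (\<lambda>x. 1 / euler_phi x)"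
proof -
  show "coeff_le (\<lambda>x. euler_phi (x ^ m) / euler_phi x) (\<lambda>x. 1 / euler_phi x)"
    by (rule coeff_le_limit[OF loc_unif_euler_phi_quotient[OF m] loc_unif_inverse_euler_phi]) (intro coeff_le_prod coeff_le_geometric)
  show "coeff_le (\<lambda>x. x ^ m * (euler_phi (x ^ m) / euler_phi x)) (\<lambda>x. 1 / euler_phi x)"
  proof (rule coeff_le_limit)
    \<comment> \<open>The partial products have at least one factor, so that the one with n = 0 is
      there to absorb \<open>x ^ m\<close>.\<close>
    have Suc: "strict_mono Suc" by (simp add: strict_mono_def)
    show "loc_unif (\<lambda>N x. \<Prod>n<Suc N. 1 / (1 - x ^ Suc n)) (\<lambda>x. 1 / euler_phi x)"
      by (rule loc_unif_subseq[OF loc_unif_inverse_euler_phi Suc])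
    show "loc_unif (\<lambda>N x. x ^ m * (\<Prod>n<Suc N. \<Sum>j<m. (x ^ Suc n) ^ j)) (\<lambda>x. x ^ m * (euler_phi (x ^ m) / euler_phi x))"
      by (intro loc_unif_mult loc_unif_const holomorphic_intros loc_unif_subseq[OF loc_unif_euler_phi_quotient[OF m] Suc])
    show "coeff_le (\<lambda>x. x ^ m * (\<Prod>n<Suc N. \<Sum>j<m. (x ^ Suc n) ^ j)) (\<lambda>x. \<Prod>n<Suc N. 1 / (1 - x ^ Suc n))" for N
    proof -
      have "coeff_le (\<lambda>x. (x ^ m * (\<Sum>j<m. (x ^ Suc 0) ^ j)) * (\<Prod>n<N. \<Sum>j<m. (x ^ Suc (Suc n)) ^ j))
          (\<lambda>x. 1 / (1 - x ^ Suc 0) * (\<Prod>n<N. 1 / (1 - x ^ Suc (Suc n))))"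
        by (intro coeff_le_mult coeff_le_power_geometric coeff_le_prod coeff_le_geometric)
      then show ?thesis by (simp only: prod.lessThan_Suc_shift mult.assoc)
    qed
  qed
qed

text \<open>All coefficients on the left are 1, so those on the right are positive. In the end this
  makes every graded piece nonzero.\<close>

lemma coeff_le_geometric_euler_phi: "coeff_le (\<lambda>x. 1 / (1 - x)) (\<lambda>x. (1 / euler_phi x) ^ Suc k)"
proof -
  have Suc: "strict_mono Suc" by (simp add: strict_mono_def)
  have g1: "coeff_le (\<lambda>x. 1) (\<lambda>x. 1 / (1 - x ^ Suc n))" for n
    using coeff_le_geometric[where m = 1 and n = n] by simp
  have 1: "coeff_le (\<lambda>x. 1 / (1 - x)) (\<lambda>x. 1 / euler_phi x)"
  proof (rule coeff_le_limit[OF _ loc_unif_subseq[OF loc_unif_inverse_euler_phi Suc]])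
    show "loc_unif (\<lambda>_ x. 1 / (1 - x)) (\<lambda>x. 1 / (1 - x))"
      by (intro loc_unif_const holomorphic_intros) auto
    fix N
    have "coeff_le (\<lambda>x. 1 / (1 - x ^ Suc 0) * (\<Prod>n<N. 1)) (\<lambda>x. 1 / (1 - x ^ Suc 0) * (\<Prod>n<N. 1 / (1 - x ^ Suc (Suc n))))"
      by (intro coeff_le_mult coeff_le_prod g1 coeff_le_refl nat_coeffs_geometric)
    then show "coeff_le (\<lambda>x. 1 / (1 - x)) (\<lambda>x. \<Prod>n<Suc N. 1 / (1 - x ^ Suc n))"
      unfolding prod.lessThan_Suc_shift by simp
  qed
  have "coeff_le (\<lambda>x. 1) (\<lambda>x. 1 / euler_phi x)"
    using coeff_le_trans[OF _ 1] g1[of 0] by simp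
  from coeff_le_mult[OF 1 coeff_le_power[OF this, of k]] show ?thesis by simp
qed

section \<open>Gaussian binomial coefficients and the product over odd exponents\<close>

fun qbin :: "nat \<Rightarrow> nat \<Rightarrow> complex \<Rightarrow> complex" where
  "qbin n 0 q = 1"
| "qbin 0 (Suc j) q = 0"
| "qbin (Suc n) (Suc j) q = qbin n (Suc j) q + q ^ (n - j) * qbin n j q"

lemma qbin_eq_0: "n < j \<Longrightarrow> qbin n j q = 0"
  by (induction n j q rule: qbin.induct) auto

text \<open>The usual product formula, cleared of denominators. The recursion for
  \<open>qbin\<close> is the q-Pascal rule, which keeps the coefficients polynomials with natural
  coefficients.\<close>

lemma qbin_formula:
  "j \<le> n \<Longrightarrow> qbin n j q * (\<Prod>i<j. 1 - q ^ Suc i) * (\<Prod>i<n - j. 1 - q ^ Suc i) = (\<Prod>i<n. 1 - q ^ Suc i)"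
proof (induction n j q rule: qbin.induct)
  case (3 n j q)
  let ?P = "\<lambda>k. \<Prod>i<k. 1 - q ^ Suc i"
  have P: "?P (Suc k) = ?P k * (1 - q ^ Suc k)" for k by simp
  have second: "qbin n j q * ?P j * ?P (n - j) = ?P n" using 3 by simp
  have first: "qbin n (Suc j) q * ?P (Suc j) * ?P (n - j) = (1 - q ^ (n - j)) * ?P n"
  proof (cases "Suc j \<le> n")
    case True
    then have "n - j = Suc (n - Suc j)" by simp
    then have "?P (n - j) = ?P (n - Suc j) * (1 - q ^ (n - j))" using P by metis
    then show ?thesis using "3.IH"(1)[OF True] by (simp only: mult_ac)
  next
    \<comment> \<open>Here j = n, so \<open>qbin n (Suc j) q\<close> and 1 - q^(n - j) both
      vanish.\<close>
    case False
    then show ?thesis using 3 by (simp add: qbin_eq_0)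
  qed
  have "qbin (Suc n) (Suc j) q * ?P (Suc j) * ?P (Suc n - Suc j) =
      qbin n (Suc j) q * ?P (Suc j) * ?P (n - j) + q ^ (n - j) * (1 - q ^ Suc j) * (qbin n j q * ?P j * ?P (n - j))"
  proof -
    have "(A + E * B) * (X * c) * Y = A * (X * c) * Y + E * c * (B * X * Y)" for A B E X Y c :: complex
      by (simp add: algebra_simps)
    then show ?thesis unfolding qbin.simps(3) diff_Suc_Suc P .
  qed
  also have "\<dots> = (1 - q ^ (n - j) * q ^ Suc j) * ?P n"
  proof -
    have "(1 - E) * Y + E * (1 - w) * Y = (1 - E * w) * Y" for E w Y :: complex
      by (simp add: algebra_simps)
    then show ?thesis unfolding first second .
  qed
  also have "q ^ (n - j) * q ^ Suc j = q ^ Suc n"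
    using "3.prems" by (simp flip: power_add)
  finally show ?case by (simp only: P mult_ac)
qed simp_all

text \<open>The inductive step for the q-binomial bounds: the q-Pascal rule produces two terms of
  the previous stage, and the new factor \<open>1 + x ^ e\<close> of the product leaves room for one
  copy of each.\<close>

lemma coeff_le_mult_one_plus:
  assumes "coeff_le f T" "coeff_le g T"
  shows "coeff_le (\<lambda>x. f x + x ^ e * g x) (\<lambda>x. (1 + x ^ e) * T x)"
proof -
  have "coeff_le (\<lambda>x. f x + x ^ e * g x) (\<lambda>x. T x + x ^ e * T x)"
    by (intro coeff_le_add coeff_le_mult assms coeff_le_refl nat_coeffs_ident_power)
  then show ?thesis by (simp add: ring_distribs)
qed

lemma nat_coeffs_odd_prod: "nat_coeffs (\<lambda>x. \<Prod>i<n. 1 + x ^ f i)"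
  by (intro nat_coeffs_prod nat_coeffs_add nat_coeffs_1 nat_coeffs_ident_power)

lemma coeff_le_le_one_plus:
  assumes "coeff_le f T"
  shows "coeff_le f (\<lambda>x. (1 + x ^ e) * T x)" "coeff_le (\<lambda>x. x ^ e * f x) (\<lambda>x. (1 + x ^ e) * T x)"
proof -
  have "coeff_le (\<lambda>x. 0) T" using coeff_le_nat_coeffs[OF assms] by (simp add: coeff_le_def nat_coeffs_0)
  from coeff_le_mult_one_plus[OF assms this] coeff_le_mult_one_plus[OF this assms]
  show "coeff_le f (\<lambda>x. (1 + x ^ e) * T x)" "coeff_le (\<lambda>x. x ^ e * f x) (\<lambda>x. (1 + x ^ e) * T x)" by simp_all
qed

text \<open>The next two lemmas bound a single term of the \<open>q\<close>-binomial theorem by the whole product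
  \<open>(\<Prod>i<a. 1 + x ^ (2 * i + 1)) * (\<Prod>i<b. 1 + x ^ (2 * i + 1)) =
   (\<Sum>j\<le>a + b. x ^ ((j - a)^2) * qbin (a + b) j (x^2))\<close>; in the first one only \<open>n \<le> a\<close> of the
  factors with negative exponents have been used, and \<open>p = a - n\<close>.\<close>

lemma coeff_le_qbin_one_sided:
  "j \<le> n \<Longrightarrow> coeff_le (\<lambda>x. x ^ ((n - j) * (n - j + 2 * p)) * qbin n j (x\<^sup>2)) (\<lambda>x. \<Prod>i<n. 1 + x ^ (2 * (p + i) + 1))"
proof (induction n arbitrary: j p)
  case 0
  then show ?case by (simp add: coeff_le_refl nat_coeffs_1)
next
  case (Suc n)
  let ?T = "\<lambda>x. \<Prod>i<n. 1 + x ^ (2 * (Suc p + i) + 1)"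
  \<comment> \<open>Splitting off the factor with i = 0 raises p by one in the remaining
    product.\<close>
  have T: "(\<lambda>x. \<Prod>i<Suc n. 1 + x ^ (2 * (p + i) + 1)) = (\<lambda>x :: complex. (1 + x ^ (2 * p + 1)) * ?T x)"
    unfolding prod.lessThan_Suc_shift by simp
  show ?case
  proof (cases j)
    case 0
    have "(Suc n - 0) * (Suc n - 0 + 2 * p) = 2 * p + 1 + (n - 0) * (n - 0 + 2 * Suc p)"
      by (simp add: algebra_simps)
    then show ?thesis
      unfolding T 0 using coeff_le_le_one_plus(2)[OF Suc.IH[of 0 "Suc p"], of "2 * p + 1"]
      by (simp only: power_add mult.assoc qbin.simps)
  next
    case (Suc j')
    then have j': "j' \<le> n" using Suc.prems by simp
    define r where "r = n - j'"
    have IH2: "coeff_le (\<lambda>x. x ^ (r * (r + 2 * Suc p)) * qbin n j' (x\<^sup>2)) ?T"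
      unfolding r_def by (rule Suc.IH[OF j'])
    have e2: "r * (r + 2 * Suc p) = r * (r + 2 * p) + 2 * r" by (simp add: algebra_simps)
    have main: "coeff_le (\<lambda>x. x ^ (r * (r + 2 * p)) * (qbin n (Suc j') (x\<^sup>2) + (x\<^sup>2) ^ r * qbin n j' (x\<^sup>2)))
        (\<lambda>x. (1 + x ^ (2 * p + 1)) * ?T x)"
    proof (cases "r = 0")
      case True
      then have "n = j'" using j' by (simp add: r_def)
      then have "qbin n (Suc j') y = 0" for y by (simp add: qbin_eq_0)
      then show ?thesis
        using coeff_le_le_one_plus(1)[OF IH2, of "2 * p + 1"]
        by (simp only: True mult_zero_left power_0 mult_1 add_0_left)
    next
      case False
      then obtain s where s: "r = Suc s" by (cases r) auto
      have IH1: "coeff_le (\<lambda>x. x ^ (s * (s + 2 * Suc p)) * qbin n (Suc j') (x\<^sup>2)) ?T"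
      proof -
        have "n - Suc j' = s" "Suc j' \<le> n" using s by (simp_all add: r_def)
        then show ?thesis using Suc.IH[of "Suc j'" "Suc p"] by (simp only:)
      qed
      \<comment> \<open>In the q-Pascal rule, the term with \<open>Suc j'\<close> uses the summand
        x^(2 p + 1) of the factor split off and the term with \<open>j'\<close> uses its summand 1;
        the exponents then match by \<open>e1\<close> and \<open>e2\<close>.\<close>
      have e1: "r * (r + 2 * p) = 2 * p + 1 + s * (s + 2 * Suc p)" by (simp add: s algebra_simps)
      have "coeff_le (\<lambda>x. x ^ (r * (r + 2 * Suc p)) * qbin n j' (x\<^sup>2) + x ^ (2 * p + 1) * (x ^ (s * (s + 2 * Suc p)) * qbin n (Suc j') (x\<^sup>2)))
        (\<lambda>x. (1 + x ^ (2 * p + 1)) * ?T x)"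
        by (rule coeff_le_mult_one_plus[OF IH2 IH1])
      then show ?thesis
      proof (rule coeff_le_cong)
        fix x :: complex
        have alg: "X * B + E * (S * A) = P * (A + R * B)" if "X = P * R" "P = E * S" for X B E S A P R :: complex
          using that by (simp add: algebra_simps)
        have "x ^ (r * (r + 2 * Suc p)) = x ^ (r * (r + 2 * p)) * (x\<^sup>2) ^ r"
          unfolding e2 by (simp add: power_add power_mult)
        moreover have "x ^ (r * (r + 2 * p)) = x ^ (2 * p + 1) * x ^ (s * (s + 2 * Suc p))"
          unfolding e1 by (simp only: power_add)
        ultimately show "x ^ (r * (r + 2 * Suc p)) * qbin n j' (x\<^sup>2) + x ^ (2 * p + 1) * (x ^ (s * (s + 2 * Suc p)) * qbin n (Suc j') (x\<^sup>2)) =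
          x ^ (r * (r + 2 * p)) * (qbin n (Suc j') (x\<^sup>2) + (x\<^sup>2) ^ r * qbin n j' (x\<^sup>2))"
          by (rule alg)
      qed simp
    qed
    then show ?thesis
      unfolding T Suc diff_Suc_Suc qbin.simps(3) r_def [symmetric] .
  qed
qed

text \<open>By truncated subtraction, the exponent is \<open>(j - a)^2\<close>.\<close>

lemma coeff_le_qbin:
  "coeff_le (\<lambda>x. x ^ ((j - a) * (j - a) + (a - j) * (a - j)) * qbin (a + b) j (x\<^sup>2))
     (\<lambda>x. (\<Prod>i<a. 1 + x ^ (2 * i + 1)) * (\<Prod>i<b. 1 + x ^ (2 * i + 1)))"
proof (induction b arbitrary: j)
  case 0
  show ?case
  proof (cases "j \<le> a")
    case True
    then show ?thesis using coeff_le_qbin_one_sided[OF True, of 0] by simp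
  next
    case False
    then show ?thesis
      using nat_coeffs_odd_prod[where n = a and f = "\<lambda>i. 2 * i + 1"] by (simp add: qbin_eq_0 coeff_le_def nat_coeffs_0)
  qed
next
  case (Suc b)
  let ?T = "\<lambda>x. (\<Prod>i<a. 1 + x ^ (2 * i + 1)) * (\<Prod>i<b. 1 + x ^ (2 * i + 1)) :: complex"
  let ?e = "\<lambda>j. (j - a) * (j - a) + (a - j) * (a - j)"
  have T: "(\<lambda>x. (\<Prod>i<a. 1 + x ^ (2 * i + 1)) * (\<Prod>i<Suc b. 1 + x ^ (2 * i + 1))) =
      (\<lambda>x :: complex. (1 + x ^ (2 * b + 1)) * ?T x)"
    by (simp add: mult_ac)
  show ?case
  proof (cases j)
    case 0
    then show ?thesis unfolding T using coeff_le_le_one_plus(1)[OF Suc.IH[of 0], of "2 * b + 1"] by simp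
  next
    case (Suc j')
    have "coeff_le (\<lambda>x. x ^ ?e j * qbin (a + b) j (x\<^sup>2) + x ^ (2 * b + 1) * (x ^ ?e j' * qbin (a + b) j' (x\<^sup>2)))
        (\<lambda>x. (1 + x ^ (2 * b + 1)) * ?T x)"
      by (rule coeff_le_mult_one_plus[OF Suc.IH Suc.IH])
    then show ?thesis
      unfolding T
    proof (rule coeff_le_cong)
      fix x :: complex
      show "x ^ ?e j * qbin (a + b) j (x\<^sup>2) + x ^ (2 * b + 1) * (x ^ ?e j' * qbin (a + b) j' (x\<^sup>2)) =
          x ^ ?e j * qbin (a + Suc b) j (x\<^sup>2)"
      proof (cases "j' \<le> a + b")
        case True
        \<comment> \<open>For u = j' - a this is 2 b + 1 + u^2 = (u + 1)^2 + 2 (b - u). The cases on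
          the sign of u resolve the truncated subtractions.\<close>
        have "2 * b + 1 + ?e j' = ?e j + 2 * (a + b - j')"
        proof -
          consider k where "a = j' + Suc k" | k where "j' = a + k"
            by (metis less_imp_Suc_add add_Suc_right le_Suc_ex not_less)
          then show ?thesis using True by cases (simp_all add: Suc algebra_simps)
        qed
        then have "x ^ (2 * b + 1) * x ^ ?e j' = x ^ ?e j * (x\<^sup>2) ^ (a + b - j')"
          by (simp only: power_add [symmetric] power_mult [symmetric])
        then show ?thesis by (simp only: Suc add_Suc_right qbin.simps ring_distribs mult.assoc [symmetric])
      next
        case False
        then show ?thesis by (simp add: Suc qbin_eq_0)
      qed
    qed simp
  qed
qed

text \<open>This is the product of all 1 + x^(2 i + 1), because the factors of
  \<open>euler_phi (- x)\<close> with even exponents are those of the denominator. The quotient form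
  is the one in which Delta((\<tau> + 1) / 2) / Delta(\<tau>) presents itself for x =
  \<open>qexp (\<tau> / 2)\<close>.\<close>

definition odd_phi :: "complex \<Rightarrow> complex" where
  "odd_phi x = euler_phi (- x) / euler_phi (x\<^sup>2)"

lemma loc_unif_euler_phi_square: "loc_unif (\<lambda>N x. \<Prod>n<N. 1 - (x\<^sup>2) ^ Suc n) (\<lambda>x. euler_phi (x\<^sup>2))"
  by (rule loc_unif_compose[OF loc_unif_euler_phi]) (auto intro!: holomorphic_intros norm_power_le_self)

lemma norm_square_less_1: "norm (x :: complex) < 1 \<Longrightarrow> norm (x\<^sup>2) < 1"
  using norm_power_le_self[of x 2] by simp

lemma prod_square_neq_0:
  assumes "norm (x :: complex) < 1"
  shows "(\<Prod>n<N. 1 - (x\<^sup>2) ^ Suc n) \<noteq> 0"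
  using power_Suc_neq_1[OF norm_square_less_1[OF assms]] by (simp del: power_Suc)

lemma loc_unif_odd_phi: "loc_unif (\<lambda>N x. \<Prod>i<N. 1 + x ^ (2 * i + 1)) odd_phi"
proof -
  have "loc_unif (\<lambda>N x. \<Prod>n<N. 1 - (- x) ^ Suc n) (\<lambda>x. euler_phi (- x))"
    by (rule loc_unif_compose[OF loc_unif_euler_phi]) (auto intro!: holomorphic_intros)
  then have "loc_unif (\<lambda>N x. \<Prod>n<2 * N. 1 - (- x) ^ Suc n) (\<lambda>x. euler_phi (- x))"
    by (rule loc_unif_subseq) (auto simp: strict_mono_def)
  then have "loc_unif (\<lambda>N x. (\<Prod>n<2 * N. 1 - (- x) ^ Suc n) / (\<Prod>n<N. 1 - (x\<^sup>2) ^ Suc n))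
      (\<lambda>x. euler_phi (- x) / euler_phi (x\<^sup>2))"
    by (rule loc_unif_divide[OF _ loc_unif_euler_phi_square])
       (use prod_square_neq_0 euler_phi_nonzero norm_square_less_1 in auto)
  then show ?thesis
  proof (rule loc_unif_cong)
    fix N and x :: complex assume x: "norm x < 1"
    have "(\<Prod>n<2 * N. 1 - (- x) ^ Suc n) = (\<Prod>i<N. 1 + x ^ (2 * i + 1)) * (\<Prod>n<N. 1 - (x\<^sup>2) ^ Suc n)"
    proof (induction N)
      case (Suc N)
      have e: "(- x) ^ Suc (2 * N) = - (x ^ (2 * N + 1))" "(- x) ^ Suc (Suc (2 * N)) = (x\<^sup>2) ^ Suc N"
        by (simp_all add: power_minus' power_mult power2_eq_square)
      have "(\<Prod>n<2 * Suc N. 1 - (- x) ^ Suc n) =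
          (\<Prod>n<2 * N. 1 - (- x) ^ Suc n) * (1 - (- x) ^ Suc (2 * N)) * (1 - (- x) ^ Suc (Suc (2 * N)))"
        by simp
      then show ?case unfolding Suc e by (simp del: power_Suc add: mult_ac)
    qed simp
    then show "(\<Prod>n<2 * N. 1 - (- x) ^ Suc n) / (\<Prod>n<N. 1 - (x\<^sup>2) ^ Suc n) = (\<Prod>i<N. 1 + x ^ (2 * i + 1))"
      using prod_square_neq_0[OF x, of N] by (simp del: power_Suc)
  qed (simp add: odd_phi_def)
qed

text \<open>The limit of the central coefficient bound, as the central term of the \<open>q\<close>-binomial theorem
  tends to \<open>1 / euler_phi (x^2)\<close>.\<close>

lemma coeff_le_odd_phi: "coeff_le (\<lambda>x. 1 / euler_phi (x\<^sup>2)) (\<lambda>x. odd_phi x * odd_phi x)"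
proof (rule coeff_le_limit[OF _ loc_unif_mult[OF loc_unif_odd_phi loc_unif_odd_phi]])
  let ?P = "\<lambda>N (x :: complex). \<Prod>n<N. 1 - (x\<^sup>2) ^ Suc n"
  have sub: "loc_unif (\<lambda>N. ?P (N + N)) (\<lambda>x. euler_phi (x\<^sup>2))"
    by (rule loc_unif_subseq[OF loc_unif_euler_phi_square]) (auto simp: strict_mono_def)
  have "loc_unif (\<lambda>N x. ?P (N + N) x / (?P N x * ?P N x)) (\<lambda>x. euler_phi (x\<^sup>2) / (euler_phi (x\<^sup>2) * euler_phi (x\<^sup>2)))"
    by (rule loc_unif_divide[OF sub loc_unif_mult[OF loc_unif_euler_phi_square loc_unif_euler_phi_square]])
       (use prod_square_neq_0 euler_phi_nonzero norm_square_less_1 in auto)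
  then show "loc_unif (\<lambda>N x. qbin (N + N) N (x\<^sup>2)) (\<lambda>x. 1 / euler_phi (x\<^sup>2))"
  proof (rule loc_unif_cong)
    fix N and x :: complex assume x: "norm x < 1"
    have "qbin (N + N) N (x\<^sup>2) * ?P N x * ?P N x = ?P (N + N) x"
      using qbin_formula[of N "N + N" "x\<^sup>2"] by simp
    then show "?P (N + N) x / (?P N x * ?P N x) = qbin (N + N) N (x\<^sup>2)"
      using prod_square_neq_0[OF x, of N] by (simp add: divide_eq_eq mult.assoc del: power_Suc)
  qed simp
  show "coeff_le (\<lambda>x. qbin (N + N) N (x\<^sup>2)) (\<lambda>x. (\<Prod>i<N. 1 + x ^ (2 * i + 1)) * (\<Prod>i<N. 1 + x ^ (2 * i + 1)))" for N
    using coeff_le_qbin[of N N N] by simp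
qed

lemma sums_even_reindex:
  fixes a :: "nat \<Rightarrow> complex"
  assumes "\<And>k. odd k \<Longrightarrow> f k = 0"
  shows "(\<lambda>n. f (2 * n)) sums s \<longleftrightarrow> f sums (s :: complex)"
  by (rule sums_mono_reindex) (use assms in \<open>auto simp: strict_mono_def elim!: oddE evenE\<close>)

text \<open>\<open>b m\<close> and \<open>a\<close> are the coefficient sequences of \<open>q\<close> times the level \<open>m\<close> function
  \<open>Delta (m * \<tau>) / Delta \<tau>\<close> and the level one function constructed below.\<close>

lemma coefficient_domination:
  obtains a :: "nat \<Rightarrow> nat" and b :: "nat \<Rightarrow> nat \<Rightarrow> nat" where
    "\<And>x. norm x < 1 \<Longrightarrow> (\<lambda>n. of_nat (a n) * (x\<^sup>2) ^ n) sums
       (2 ^ 24 * (x\<^sup>2) ^ 3 * (euler_phi ((x\<^sup>2)\<^sup>2) / euler_phi (x\<^sup>2)) ^ 48 + (odd_phi x ^ 48 + odd_phi (- x) ^ 48))"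
    "\<And>m x. m \<ge> 1 \<Longrightarrow> norm x < 1 \<Longrightarrow>
       (\<lambda>n. of_nat (b m n) * x ^ n) sums (x ^ m * (euler_phi (x ^ m) / euler_phi x) ^ 24)"
    "\<And>m n. m \<ge> 1 \<Longrightarrow> b m n \<le> a n" "\<And>n. a n > 0"
proof
  \<comment> \<open>The series through which the two families are compared: it dominates every
    \<open>B m\<close>, and \<open>U (x\<^sup>2)\<close> is dominated by \<open>R\<close>.\<close>
  define U where "U x = (1 / euler_phi x) ^ 24" for x
  define A where "A x = 2 ^ 24 * x ^ 3 * (euler_phi (x\<^sup>2) / euler_phi x) ^ 48" for x
  define R where "R x = odd_phi x ^ 48" for x
  define B where "B m x = x ^ m * (euler_phi (x ^ m) / euler_phi x) ^ 24" for m x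
  have nat_eq: "of_nat (nat \<lfloor>Re z\<rfloor>) = z" if "z \<in> \<nat>" for z
    using that by (auto elim: Nats_cases)
  have A: "nat_coeffs A"
    unfolding A_def [abs_def]
    using nat_coeffs_mult[OF nat_coeffs_mult[OF nat_coeffs_const[of "2 ^ 24"] nat_coeffs_ident_power[of 3]]
        nat_coeffs_power[OF coeff_le_nat_coeffs(1)[OF coeff_le_euler_phi_quotient(1)[of 2]], of 48]]
    by simp
  have RU: "coeff_le (\<lambda>x. U (x\<^sup>2)) R"
  proof (rule coeff_le_cong[OF coeff_le_power[OF coeff_le_odd_phi, of 24]])
    show "(odd_phi x * odd_phi x) ^ 24 = R x" for x
      by (simp add: R_def power_mult_distrib flip: power_add)
  qed (simp add: U_def)
  have U1: "coeff_le (\<lambda>x. 1 / (1 - x)) U"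
    using coeff_le_geometric_euler_phi[of 23] by (simp add: U_def [abs_def])
  have p24: "v * v ^ 23 = v ^ 24" for v :: complex
    using power_Suc[of v 23] by simp
  have BU: "coeff_le (B m) U" if "m \<ge> 1" for m
  \<comment> \<open>One of the 24 factors takes \<open>x ^ m\<close>, the other 23 are bounded
    without it.\<close>
  proof (rule coeff_le_cong[OF coeff_le_mult[OF coeff_le_euler_phi_quotient(2) coeff_le_power[OF coeff_le_euler_phi_quotient(1)]]])
    show "m \<ge> 1" "m \<ge> 1" by fact+
    show "x ^ m * (euler_phi (x ^ m) / euler_phi x) * (euler_phi (x ^ m) / euler_phi x) ^ 23 = B m x" for x
      by (simp only: B_def mult.assoc p24)
    show "1 / euler_phi x * (1 / euler_phi x) ^ 23 = U x" for x
      by (simp only: U_def p24)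
  qed
  have R: "nat_coeffs R" and Uh: "U holomorphic_on ball 0 1"
    using coeff_le_nat_coeffs[OF RU] coeff_le_nat_coeffs[OF U1] by (auto simp: nat_coeffs_def)
  \<comment> \<open>In R(x) + R(- x) the odd coefficients cancel and the even ones double, so
    coefficient 2 n of \<open>R\<close> belongs to the n-th power of x^2.\<close>
  define a where "a n = nat \<lfloor>Re (2 * taylor_coeff R (2 * n) + taylor_coeff A n)\<rfloor>" for n
  define b where "b m n = nat \<lfloor>Re (taylor_coeff (B m) n)\<rfloor>" for m n
  have a: "of_nat (a n) = 2 * taylor_coeff R (2 * n) + taylor_coeff A n" for n
    unfolding a_def by (rule nat_eq) (use A R in \<open>auto simp: nat_coeffs_def intro!: Nats_add Nats_mult\<close>)
  have b: "of_nat (b m n) = taylor_coeff (B m) n" if "m \<ge> 1" for m n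
    unfolding b_def by (rule nat_eq) (use coeff_le_nat_coeffs[OF BU[OF that]] in \<open>auto simp: nat_coeffs_def\<close>)
  show "(\<lambda>n. of_nat (b m n) * x ^ n) sums (x ^ m * (euler_phi (x ^ m) / euler_phi x) ^ 24)"
    if "m \<ge> 1" "norm x < 1" for m x
    using taylor_coeff_sums[of "B m" x] coeff_le_nat_coeffs[OF BU[OF that(1)]] that by (simp add: b nat_coeffs_def B_def)
  show "(\<lambda>n. of_nat (a n) * (x\<^sup>2) ^ n) sums
       (2 ^ 24 * (x\<^sup>2) ^ 3 * (euler_phi ((x\<^sup>2)\<^sup>2) / euler_phi (x\<^sup>2)) ^ 48 + (odd_phi x ^ 48 + odd_phi (- x) ^ 48))"
    if x: "norm x < 1" for x
  proof -
    have "(\<lambda>k. taylor_coeff R k * x ^ k + taylor_coeff R k * (- x) ^ k) sums (R x + R (- x))"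
      using R x by (intro sums_add taylor_coeff_sums) (auto simp: nat_coeffs_def)
    then have "(\<lambda>n. taylor_coeff R (2 * n) * x ^ (2 * n) + taylor_coeff R (2 * n) * (- x) ^ (2 * n)) sums (R x + R (- x))"
      by (subst sums_even_reindex) auto
    moreover have "taylor_coeff R (2 * n) * x ^ (2 * n) + taylor_coeff R (2 * n) * (- x) ^ (2 * n) = 2 * taylor_coeff R (2 * n) * (x\<^sup>2) ^ n" for n
      by (simp add: power_mult)
    ultimately have 1: "(\<lambda>n. 2 * taylor_coeff R (2 * n) * (x\<^sup>2) ^ n) sums (R x + R (- x))"
      by (simp only:)
    have 2: "(\<lambda>n. taylor_coeff A n * (x\<^sup>2) ^ n) sums A (x\<^sup>2)"
      using A norm_square_less_1[OF x] by (intro taylor_coeff_sums) (auto simp: nat_coeffs_def)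
    show ?thesis
      using sums_add[OF 2 1] by (simp add: a A_def R_def ring_distribs add.commute)
  qed
  have cfU: "taylor_coeff (\<lambda>x. U (x\<^sup>2)) (2 * n) = taylor_coeff U n" for n
  proof -
    have "taylor_coeff (\<lambda>x. U (x\<^sup>2)) (2 * n) = (if even (2 * n) then taylor_coeff U (2 * n div 2) else 0)"
    proof (rule taylor_coeff_eqI)
      fix x :: complex assume "norm x < 1"
      then have "(\<lambda>n. taylor_coeff U n * (x\<^sup>2) ^ n) sums U (x\<^sup>2)"
        using Uh norm_square_less_1 by (intro taylor_coeff_sums) auto
      then show "(\<lambda>k. (if even k then taylor_coeff U (k div 2) else 0) * x ^ k) sums U (x\<^sup>2)"
        by (subst sums_even_reindex [symmetric]) (simp_all add: power_mult)
    qed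
    then show ?thesis by simp
  qed
  have u: "\<exists>u. taylor_coeff U n = of_nat u \<and> u \<ge> 1 \<and> u \<le> a n" for n
  proof -
    have "taylor_coeff (\<lambda>x. 1 / (1 - x)) n = 1"
      by (rule taylor_coeff_eqI) (use geometric_sums in auto)
    then obtain u where u: "taylor_coeff U n = of_nat u" "u \<ge> 1"
      using coeff_le_taylor_coeff[OF U1, of n] by (metis of_nat_1 of_nat_eq_iff)
    obtain u' r where r: "taylor_coeff U n = of_nat u'" "taylor_coeff R (2 * n) = of_nat r" "u' \<le> r"
      using coeff_le_taylor_coeff[OF RU, of "2 * n"] cfU by metis
    obtain s where "taylor_coeff A n = of_nat s" using A by (auto simp: nat_coeffs_def elim: Nats_cases)
    then have "of_nat (a n) = (of_nat (2 * r + s) :: complex)" using a[of n] r by simp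
    then have "a n = 2 * r + s" by (simp only: of_nat_eq_iff)
    moreover have "u = u'" using u r by simp
    ultimately show ?thesis using u r(3) by auto
  qed
  show "a n > 0" for n using u[of n] by auto
  show "b m n \<le> a n" if m: "m \<ge> 1" for m n
  proof -
    obtain p u' where "taylor_coeff (B m) n = of_nat p" "taylor_coeff U n = of_nat u'" "p \<le> u'"
      using coeff_le_taylor_coeff[OF BU[OF m], of n] by metis
    then show ?thesis using u[of n] b[OF m, of n] by auto
  qed
qed

section \<open>Modular functions\<close>

lemma Im_moebius_pos:
  fixes a b c d :: int
  assumes \<tau>: "Im \<tau> > 0" and det: "a * d - b * c = 1"
  shows "of_int c * \<tau> + of_int d \<noteq> 0"
    and "Im ((of_int a * \<tau> + of_int b) / (of_int c * \<tau> + of_int d)) > 0"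
proof -
  show ne: "of_int c * \<tau> + of_int d \<noteq> 0"
  proof
    assume *: "of_int c * \<tau> + of_int d = 0"
    then have "Im (of_int c * \<tau> + of_int d) = 0" by simp
    then have "c = 0" using \<tau> by simp
    then show False using * det by simp
  qed
  let ?D = "(of_int c * Re \<tau> + of_int d)\<^sup>2 + (of_int c * Im \<tau>)\<^sup>2"
  have D: "?D > 0"
    using ne by (auto simp: sum_power2_gt_zero_iff complex_eq_iff)
  have "real_of_int (a * d - b * c) = 1" by (simp only: det of_int_1)
  then have det': "real_of_int a * of_int d - of_int b * of_int c = 1" by simp
  have "Im ((of_int a * \<tau> + of_int b) / (of_int c * \<tau> + of_int d)) =
      ((of_int a * of_int d - of_int b * of_int c) * Im \<tau>) / ?D"
    by (simp add: Im_divide algebra_simps)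
  also have "\<dots> = Im \<tau> / ?D" by (simp only: det' mult_1)
  finally show "Im ((of_int a * \<tau> + of_int b) / (of_int c * \<tau> + of_int d)) > 0"
    using \<tau> D by simp
qed

lemma periodic_of_int:
  fixes f :: "complex \<Rightarrow> complex"
  assumes "\<And>\<tau>. Im \<tau> > 0 \<Longrightarrow> f (\<tau> + 1) = f \<tau>" "Im \<tau> > 0"
  shows "f (\<tau> + of_int k) = f \<tau>"
proof (induction k rule: int_induct[where k = 0])
  case (step1 i)
  then show ?case using assms(1)[of "\<tau> + of_int i"] assms(2) by (simp add: add.assoc)
next
  case (step2 i)
  then show ?case using assms(1)[of "\<tau> + of_int (i - 1)"] assms(2) by (simp add: add.assoc)
qed simp

text \<open>The Euclidean algorithm on the lower row shows that \<open>\<tau> + 1\<close> and \<open>- 1 / \<tau>\<close> generate.\<close>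

lemma modular_generators:
  fixes f :: "complex \<Rightarrow> complex" and a b c d :: int
  assumes T: "\<And>\<tau>. Im \<tau> > 0 \<Longrightarrow> f (\<tau> + 1) = f \<tau>"
    and S: "\<And>\<tau>. Im \<tau> > 0 \<Longrightarrow> f (- 1 / \<tau>) = \<tau> ^ k * f \<tau>"
    and k: "even k"
  shows "Im \<tau> > 0 \<Longrightarrow> a * d - b * c = 1 \<Longrightarrow>
    f ((of_int a * \<tau> + of_int b) / (of_int c * \<tau> + of_int d)) = (of_int c * \<tau> + of_int d) ^ k * f \<tau>"
proof (induction "nat \<bar>c\<bar>" arbitrary: a b c d \<tau> rule: less_induct)
  case less
  show ?case
  proof (cases "c = 0")
    case True
    then have "a * d = 1" using less.prems by simp
    then consider "a = 1" "d = 1" | "a = - 1" "d = - 1" by (auto simp: zmult_eq_1_iff)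
    then show ?thesis
    proof cases
      case 1
      then show ?thesis using True periodic_of_int[where f = f and k = b, OF T] less.prems by simp
    next
      case 2
      then have "(of_int a * \<tau> + of_int b) / (of_int c * \<tau> + of_int d) = \<tau> + of_int (- b)"
        using True by simp
      moreover have "(of_int (- 1) :: complex) ^ k = 1" using k by simp
      ultimately show ?thesis
        using True 2 periodic_of_int[where f = f and k = "- b", OF T] less.prems by (simp del: of_int_minus)
    qed
  next
    case False
    define l where "l = d div c"
    define d' where "d' = d mod c"
    define b' where "b' = b - l * a"
    have d: "d = d' + l * c" by (simp add: d'_def l_def)
    have b: "b = b' + l * a" by (simp add: b'_def)
    \<comment> \<open>In terms of \<sigma> the lower row (c, d) becomes (d mod c, - c), on which the
      induction hypothesis applies.\<close>
    define \<sigma> where "\<sigma> = - 1 / (\<tau> + of_int l)"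
    have Im: "Im (\<tau> + of_int l) > 0" using less.prems by simp
    then have period_nonzero: "\<tau> + of_int l \<noteq> 0" by (metis less_irrefl zero_complex.sel(2))
    have \<sigma>: "Im \<sigma> > 0" unfolding \<sigma>_def by (rule Im_minus_inverse[OF Im])
    have det': "b' * (- c) - (- a) * d' = 1"
      using less.prems(2) by (simp add: b d algebra_simps)
    have lt: "nat \<bar>d'\<bar> < nat \<bar>c\<bar>"
      using False abs_mod_less[of c d] by (simp add: d'_def)
    have IH: "f ((of_int b' * \<sigma> + of_int (- a)) / (of_int d' * \<sigma> + of_int (- c))) =
        (of_int d' * \<sigma> + of_int (- c)) ^ k * f \<sigma>"
      by (rule less.hyps[OF lt \<sigma> det'])
    have f\<sigma>: "f \<sigma> = (\<tau> + of_int l) ^ k * f \<tau>"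
      unfolding \<sigma>_def S[OF Im] by (simp only: periodic_of_int[where f = f, OF T less.prems(1)])
    have num: "(of_int b' * \<sigma> + of_int (- a)) * (\<tau> + of_int l) = - (of_int a * \<tau> + of_int b)"
      and den: "(of_int d' * \<sigma> + of_int (- c)) * (\<tau> + of_int l) = - (of_int c * \<tau> + of_int d)"
      using period_nonzero by (simp_all add: \<sigma>_def b d field_simps)
    have "(of_int b' * \<sigma> + of_int (- a)) / (of_int d' * \<sigma> + of_int (- c)) =
        (of_int a * \<tau> + of_int b) / (of_int c * \<tau> + of_int d)"
      using num den period_nonzero by (metis minus_divide_divide mult_divide_mult_cancel_right)
    moreover have "(of_int d' * \<sigma> + of_int (- c)) ^ k * f \<sigma> = (of_int c * \<tau> + of_int d) ^ k * f \<tau>"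
    proof -
      have "(of_int d' * \<sigma> + of_int (- c)) ^ k * (\<tau> + of_int l) ^ k = (of_int c * \<tau> + of_int d) ^ k"
        unfolding power_mult_distrib [symmetric] den by (simp only: power_minus_even[OF k])
      then show ?thesis unfolding f\<sigma> by (simp only: mult.assoc [symmetric])
    qed
    ultimately show ?thesis using IH by simp
  qed
qed

lemma Delta_moebius:
  fixes a b c d :: int
  assumes "Im \<tau> > 0" "a * d - b * c = 1"
  shows "Delta ((of_int a * \<tau> + of_int b) / (of_int c * \<tau> + of_int d)) =
    (of_int c * \<tau> + of_int d) ^ 12 * Delta \<tau>"
  by (rule modular_generators[where f = Delta and k = 12, OF _ _ _ assms])
     (rule Delta_add_1, rule Delta_minus_inverse, assumption, simp)

lemma det_mat_2:
  assumes "A \<in> carrier_mat 2 2"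
  shows "Determinant.det A = A $$ (0, 0) * A $$ (1, 1) - A $$ (0, 1) * (A $$ (1, 0) :: int)"
proof -
  have "Determinant.det (mat_delete A 0 j) = mat_delete A 0 j $$ (0, 0)" if "j < 2" for j
    using assms by (intro det_single) (auto simp: mat_delete_def)
  then show ?thesis
    using laplace_expansion_row[OF assms, of 0] assms
    by (simp add: numeral_2_eq_2 cofactor_def mat_delete_def)
qed

lemma SL2Z_det: "A \<in> SL2Z \<Longrightarrow> A $$ (0, 0) * A $$ (1, 1) - A $$ (0, 1) * A $$ (1, 0) = 1"
  using det_mat_2 by (auto simp: SL2Z_def)

lemma moebius_upper_half_plane:
  assumes "A \<in> SL2Z" "\<tau> \<in> upper_half_plane"
  shows "moebius A \<tau> \<in> upper_half_plane"
  using Im_moebius_pos(2)[OF _ SL2Z_det[OF assms(1)]] assms(2)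
  by (simp add: upper_half_plane_def moebius_def)

lemma strictly_of_level_cong:
  assumes f: "strictly_of_level N f" and eq: "\<And>\<tau>. \<tau> \<in> upper_half_plane \<Longrightarrow> f \<tau> = g \<tau>"
  shows "strictly_of_level N g"
proof -
  have "g (moebius A \<tau>) = f (moebius A \<tau>)" if "A \<in> SL2Z" "\<tau> \<in> upper_half_plane" for A \<tau>
    using eq moebius_upper_half_plane[OF that] by simp
  moreover have "Gamma0 M \<subseteq> SL2Z" for M by (auto simp: Gamma0_def)
  ultimately have "Gamma0_invariant M g \<longleftrightarrow> Gamma0_invariant M f"
    "at_most_poles_at_cusps g \<longleftrightarrow> at_most_poles_at_cusps f" for M
    using eq by (auto simp: Gamma0_invariant_def at_most_poles_at_cusps_def subset_iff)
  moreover have "g holomorphic_on upper_half_plane"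
    using f eq holomorphic_transform by (auto simp: strictly_of_level_def weakly_holomorphic_modular_function_def)
  ultimately show ?thesis
    using f by (simp add: strictly_of_level_def weakly_holomorphic_modular_function_def)
qed

section \<open>The functions of level m\<close>

definition delta_quotient :: "nat \<Rightarrow> complex \<Rightarrow> complex" where
  "delta_quotient m \<tau> = Delta (of_nat m * \<tau>) / Delta \<tau>"

lemma holomorphic_on_Delta_scale:
  assumes "r > 0"
  shows "(\<lambda>\<tau>. Delta (of_real r * \<tau> + of_real s)) holomorphic_on {\<tau>. Im \<tau> > 0}"
proof -
  have "Delta \<circ> (\<lambda>\<tau>. of_real r * \<tau> + of_real s) holomorphic_on {\<tau>. Im \<tau> > 0}"
    by (rule holomorphic_on_compose_gen[OF _ holomorphic_on_Delta])
       (use assms in \<open>auto intro!: holomorphic_intros\<close>)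
  then show ?thesis by (simp add: o_def)
qed

lemma holomorphic_on_delta_quotient:
  assumes "m \<ge> 1"
  shows "delta_quotient m holomorphic_on {\<tau>. Im \<tau> > 0}"
  using holomorphic_on_Delta_scale[of "of_nat m" 0] assms Delta_nonzero
  unfolding delta_quotient_def [abs_def]
  by (auto intro!: holomorphic_intros holomorphic_on_Delta)

lemma delta_quotient_qexp:
  assumes "Im \<tau> > 0"
  shows "qexp \<tau> * delta_quotient m \<tau> =
    qexp \<tau> ^ m * (euler_phi (qexp \<tau> ^ m) / euler_phi (qexp \<tau>)) ^ 24"
  using assms by (simp add: delta_quotient_def Delta_def qexp_of_nat_mult power_divide)

text \<open>Conjugation by diag(m, 1) takes A to the matrix with rows (a, b m) and (c / m, d), which
  is integral on \<open>Gamma0 m\<close>. Its automorphy factor at m \<tau> is that of A at \<tau>,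
  so the two cancel.\<close>

lemma delta_quotient_invariant:
  assumes m: "m \<ge> 1" and A: "A \<in> Gamma0 m" and \<tau>: "Im \<tau> > 0"
  shows "delta_quotient m (moebius A \<tau>) = delta_quotient m \<tau>"
proof -
  define a b c d where "a = A $$ (0, 0)" and "b = A $$ (0, 1)" and "c = A $$ (1, 0)" and "d = A $$ (1, 1)"
  have det: "a * d - b * c = 1" using SL2Z_det A by (simp add: Gamma0_def a_def b_def c_def d_def)
  obtain c' where c': "c = int m * c'" using A by (auto simp: Gamma0_def c_def dvd_def)
  have det': "a * d - (b * int m) * c' = 1" using det by (simp add: c' mult_ac)
  have m\<tau>: "Im (of_nat m * \<tau>) > 0" using m \<tau> by simp
  let ?j = "of_int c * \<tau> + of_int d"
  have j: "?j \<noteq> 0" by (rule Im_moebius_pos(1)[OF \<tau> det])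
  have den: "of_int c' * (of_nat m * \<tau>) + of_int d = ?j" by (simp add: c')
  have "of_nat m * moebius A \<tau> = (of_int a * (of_nat m * \<tau>) + of_int (b * int m)) / ?j"
    by (simp add: moebius_def a_def b_def c_def d_def algebra_simps)
  also have "Delta \<dots> = ?j ^ 12 * Delta (of_nat m * \<tau>)"
    using Delta_moebius[OF m\<tau> det'] unfolding den .
  finally have "Delta (of_nat m * moebius A \<tau>) = ?j ^ 12 * Delta (of_nat m * \<tau>)" .
  moreover have "Delta (moebius A \<tau>) = ?j ^ 12 * Delta \<tau>"
    using Delta_moebius[OF \<tau> det] by (simp add: moebius_def a_def b_def c_def d_def)
  ultimately show ?thesis using j by (simp add: delta_quotient_def)
qed

lemma analytic_on_euler_phi_0:
  assumes "f analytic_on {0}" "f 0 = 0"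
  shows "(\<lambda>x. euler_phi (f x)) analytic_on {0}"
proof -
  have "euler_phi analytic_on {0}"
    using holomorphic_on_euler_phi by (intro holomorphic_on_imp_analytic_at[OF _ open_ball]) auto
  then have "euler_phi \<circ> f analytic_on {0}"
    by (intro analytic_on_compose assms(1)) (simp add: assms(2))
  then show ?thesis by (simp add: o_def)
qed

text \<open>At the cusp \<open>A \<infinity>\<close>, the integer matrix \<open>diag(m, 1) A\<close> of determinant \<open>m\<close> is factored as an
  element of \<open>SL2Z\<close> times an upper triangular matrix.\<close>

lemma delta_quotient_poles:
  assumes m: "m \<ge> 1"
  shows "at_most_poles_at_cusps (\<lambda>\<tau>. C * delta_quotient m \<tau>)"
  unfolding at_most_poles_at_cusps_def
proof
  fix A assume A: "A \<in> SL2Z"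
  define a b c d where "a = A $$ (0, 0)" and "b = A $$ (0, 1)" and "c = A $$ (1, 0)" and "d = A $$ (1, 1)"
  have det: "a * d - b * c = 1" using SL2Z_det[OF A] by (simp add: a_def b_def c_def d_def)
  \<comment> \<open>The first column (m a, c) of diag(m, 1) A divided by its gcd \<alpha> is the
    first column (p, r) of the \<open>SL2Z\<close> factor, whose second column (s, u) comes from
    Bezout. The triangular factor has rows (\<alpha>, \<beta>) and (0, \<delta>).\<close>
  define \<alpha> where "\<alpha> = gcd (int m * a) c"
  have "int m * a \<noteq> 0 \<or> c \<noteq> 0" using m det by auto
  then have \<alpha>: "\<alpha> > 0" by (auto simp: \<alpha>_def)
  obtain p where p: "int m * a = \<alpha> * p" using gcd_dvd1[of "int m * a" c] unfolding \<alpha>_def dvd_def by blast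
  obtain r where r: "c = \<alpha> * r" using gcd_dvd2[of "int m * a" c] unfolding \<alpha>_def dvd_def by blast
  obtain u v where uv: "u * (int m * a) + v * c = \<alpha>"
    using bezout_int[of "int m * a" c] by (auto simp: \<alpha>_def)
  define s where "s = - v"
  have "u * (\<alpha> * p) + v * (\<alpha> * r) = \<alpha>" using uv by (simp only: p r)
  then have "\<alpha> * (p * u - s * r) = \<alpha> * 1" by (simp add: s_def algebra_simps)
  then have det1: "p * u - s * r = 1" using \<alpha> by simp
  define \<beta> where "\<beta> = u * int m * b - s * d"
  define \<delta> where "\<delta> = p * d - r * int m * b"
  have "\<alpha> * \<delta> = int m * (a * d - b * c)"
    using p r by (simp add: \<delta>_def algebra_simps)
  then have \<alpha>\<delta>: "\<alpha> * \<delta> = int m" by (simp add: det)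
  then have \<delta>: "\<delta> > 0" using \<alpha> m by (metis One_nat_def Suc_le_D of_nat_0_less_iff zero_less_Suc zero_less_mult_pos)
  have e1: "p * \<beta> + s * \<delta> = int m * b * (p * u - s * r)"
    and e2: "r * \<beta> + u * \<delta> = d * (p * u - s * r)"
    by (simp_all add: \<beta>_def \<delta>_def algebra_simps)
  define \<zeta> where "\<zeta> = qexp (of_int \<beta> / of_int \<delta>)"
  \<comment> \<open>As \<alpha> \<delta> = m, the coefficient \<alpha> / \<delta> of \<tau> in the
    triangular transform is \<alpha>^2 / m. So m serves as the width and \<alpha>^2 is the exponent
    of the local parameter.\<close>
  define k where "k = nat (\<alpha> * \<alpha>)"
  have k: "k > 0" using \<alpha> by (simp add: k_def)
  define F where "F Q = C * (\<zeta> * Q ^ k * euler_phi (\<zeta> * Q ^ k) ^ 24) /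
      (of_int \<delta> ^ 12 * (Q ^ m * euler_phi (Q ^ m) ^ 24))" for Q
  show "\<exists>h>0. \<exists>F. F meromorphic_on {0} \<and> (\<forall>\<tau>\<in>upper_half_plane.
      C * delta_quotient m (moebius A \<tau>) = F (exp (2 * of_real pi * \<i> * \<tau> / of_nat h)))"
  proof (intro exI conjI ballI)
    show "m > 0" using m by simp
    have "(\<lambda>Q. euler_phi (\<zeta> * Q ^ k)) analytic_on {0}" "(\<lambda>Q. euler_phi (Q ^ m)) analytic_on {0}"
      using k m by (auto intro!: analytic_on_euler_phi_0 analytic_intros)
    then show "F meromorphic_on {0}"
      unfolding F_def [abs_def] by (intro meromorphic_intros) (auto intro: analytic_on_imp_meromorphic_on)
    fix \<tau> assume "\<tau> \<in> upper_half_plane"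
    then have \<tau>: "Im \<tau> > 0" by (simp add: upper_half_plane_def)
    let ?j = "of_int c * \<tau> + of_int d"
    have j: "?j \<noteq> 0" by (rule Im_moebius_pos(1)[OF \<tau> det])
    define w where "w = (of_int \<alpha> * \<tau> + of_int \<beta>) / of_int \<delta>"
    have \<delta>0: "of_int \<delta> \<noteq> (0 :: complex)" using \<delta> by simp
    have "w = of_real (of_int \<alpha> / of_int \<delta>) * \<tau> + of_real (of_int \<beta> / of_int \<delta>)"
      by (simp add: w_def add_divide_distrib)
    then have "Im w = of_int \<alpha> / of_int \<delta> * Im \<tau>" by simp
    then have w: "Im w > 0" using \<tau> \<alpha> \<delta> by simp
    have num: "of_int p * w + of_int s = of_nat m * (of_int a * \<tau> + of_int b) / of_int \<delta>"
    proof -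
      have "of_int p * w + of_int s = (of_int (\<alpha> * p) * \<tau> + of_int (p * \<beta> + s * \<delta>)) / of_int \<delta>"
        using \<delta>0 by (simp add: w_def field_simps)
      also have "\<dots> = (of_int (int m * a) * \<tau> + of_int (int m * b)) / of_int \<delta>"
        by (simp only: p [symmetric] e1 det1 mult_1_right)
      finally show ?thesis by (simp add: algebra_simps)
    qed
    have den: "of_int r * w + of_int u = ?j / of_int \<delta>"
    proof -
      have "of_int r * w + of_int u = (of_int (\<alpha> * r) * \<tau> + of_int (r * \<beta> + u * \<delta>)) / of_int \<delta>"
        using \<delta>0 by (simp add: w_def field_simps)
      then show ?thesis by (simp only: r [symmetric] e2 det1 mult_1_right)
    qed
    have "of_nat m * moebius A \<tau> = (of_int p * w + of_int s) / (of_int r * w + of_int u)"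
      unfolding num den using \<delta>0 by (simp add: moebius_def a_def b_def c_def d_def)
    then have 1: "Delta (of_nat m * moebius A \<tau>) = (?j / of_int \<delta>) ^ 12 * Delta w"
      using Delta_moebius[OF w det1] unfolding den by simp
    have 2: "Delta (moebius A \<tau>) = ?j ^ 12 * Delta \<tau>"
      using Delta_moebius[OF \<tau> det] by (simp add: moebius_def a_def b_def c_def d_def)
    define Q where "Q = qexp (\<tau> / of_nat m)"
    have Qm: "qexp \<tau> = Q ^ m" using m by (simp add: Q_def flip: qexp_of_nat_mult)
    have "w = of_nat k * (\<tau> / of_nat m) + of_int \<beta> / of_int \<delta>"
    proof -
      have mm: "of_nat m = (of_int \<alpha> * of_int \<delta> :: complex)"
        using \<alpha>\<delta> by (metis of_int_mult of_int_of_nat_eq)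
      have kk: "of_nat k = (of_int \<alpha> * of_int \<alpha> :: complex)"
        using \<alpha> by (simp add: k_def of_nat_nat)
      show ?thesis unfolding mm kk w_def using \<alpha> \<delta>0 by (simp add: field_simps)
    qed
    then have Qw: "qexp w = \<zeta> * Q ^ k"
      by (simp only: qexp_add qexp_of_nat_mult Q_def \<zeta>_def mult.commute)
    have "C * delta_quotient m (moebius A \<tau>) = F Q"
      unfolding delta_quotient_def 1 2 using j by (simp add: F_def Delta_def Qm Qw power_divide)
    then show "C * delta_quotient m (moebius A \<tau>) = F (exp (2 * of_real pi * \<i> * \<tau> / of_nat m))"
      by (simp add: Q_def qexp_def)
  qed
qed

text \<open>The two sides vanish to the different orders s^2 and 1 at q = 0. An identity of this
  kind is what invariance under a larger group would imply.\<close>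

lemma Delta_scale_rigid:
  assumes s: "s > 1"
  shows "\<exists>\<tau>. Im \<tau> > 0 \<and> of_nat s ^ 12 * Delta (of_nat (s * s) * \<tau>) \<noteq> Delta \<tau>"
proof (rule ccontr)
  assume "\<not> ?thesis"
  then have eq: "of_nat s ^ 12 * Delta (of_nat (s * s) * \<tau>) = Delta \<tau>" if "Im \<tau> > 0" for \<tau>
    using that by blast
  define k where "k = s * s - 1"
  have "s * s > 1" using one_less_mult[of s s] s by simp
  then have k: "s * s = Suc k" "k > 0" by (simp_all add: k_def)
  \<comment> \<open>The difference of both sides divided by q. It would vanish along a sequence
    tending to 0, but its value at 0 is - 1.\<close>
  define g where "g x = of_nat s ^ 12 * (x ^ k * euler_phi (x ^ Suc k) ^ 24) - euler_phi x ^ 24" for x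
  have g0: "g (qexp \<tau>) = 0" if "Im \<tau> > 0" for \<tau>
  proof -
    have "qexp \<tau> * g (qexp \<tau>) = of_nat s ^ 12 * Delta (of_nat (s * s) * \<tau>) - Delta \<tau>"
      unfolding g_def Delta_def qexp_of_nat_mult k(1) by (simp add: algebra_simps)
    then show ?thesis using eq[OF that] by simp
  qed
  have "g analytic_on {0}"
    unfolding g_def by (auto intro!: analytic_intros analytic_on_euler_phi_0)
  then have "isCont g 0" by (rule analytic_at_imp_isCont)
  moreover have "(\<lambda>n. qexp (\<i> * of_nat (Suc n))) \<longlonglongrightarrow> 0"
  proof -
    have "norm (qexp \<i>) < 1" by simp
    then have "(\<lambda>n. qexp \<i> ^ Suc n) \<longlonglongrightarrow> 0" by (intro LIMSEQ_Suc LIMSEQ_power_zero)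
    then show ?thesis by (simp only: qexp_of_nat_mult [symmetric] mult.commute)
  qed
  ultimately have "(\<lambda>n. g (qexp (\<i> * of_nat (Suc n)))) \<longlonglongrightarrow> g 0"
    by (rule isCont_tendsto_compose)
  moreover have "g (qexp (\<i> * of_nat (Suc n))) = 0" for n by (rule g0) simp
  ultimately have "g 0 = 0" by (simp add: LIMSEQ_const_iff)
  then show False using k(2) by (simp add: g_def zero_power)
qed

text \<open>The single matrix with rows (1, 0) and (M, 1) suffices. For m = M s and w = M \<tau>,
  invariance under it gives a transformation law for Delta(s w) under w -> w / (w + 1), and together
  with translations and inversion this forces the identity refuted in
  \<open>Delta_scale_rigid\<close>.\<close>

lemma delta_quotient_not_invariant:
  assumes m: "m \<ge> 1" and M: "M dvd m" "M \<noteq> m" and C: "C \<noteq> 0"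
  shows "\<not> Gamma0_invariant M (\<lambda>\<tau>. C * delta_quotient m \<tau>)"
proof
  assume inv: "Gamma0_invariant M (\<lambda>\<tau>. C * delta_quotient m \<tau>)"
  obtain s where ms: "m = M * s" using M(1) by (auto simp: dvd_def)
  have M0: "M > 0" and s: "s > 1" using m M(2) by (auto simp: ms intro: Suc_lessI)
  define A :: "int mat" where "A = mat 2 2 (\<lambda>(i, j). if i = j then 1 else if i = 1 then int M else 0)"
  have Ae: "A $$ (0, 0) = 1" "A $$ (0, 1) = 0" "A $$ (1, 0) = int M" "A $$ (1, 1) = 1"
    by (simp_all add: A_def)
  have "A \<in> carrier_mat 2 2" by (simp add: A_def)
  then have A: "A \<in> Gamma0 M"
    by (simp add: Gamma0_def SL2Z_def det_mat_2 Ae del: One_nat_def)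
  have key: "Delta (of_nat s * w / (w + 1)) = (w + 1) ^ 12 * Delta (of_nat s * w)" if w: "Im w > 0" for w
  proof -
    define \<tau> where "\<tau> = w / of_nat M"
    have \<tau>: "Im \<tau> > 0" using w M0 by (simp add: \<tau>_def Im_divide_of_nat)
    have w\<tau>: "of_nat M * \<tau> = w" using M0 by (simp add: \<tau>_def)
    have mo: "moebius A \<tau> = \<tau> / (w + 1)" by (simp add: moebius_def Ae w\<tau> del: One_nat_def)
    have D: "Delta (\<tau> / (w + 1)) = (w + 1) ^ 12 * Delta \<tau>"
      using Delta_moebius[OF \<tau>, of 1 1 0 "int M"] by (simp add: w\<tau>)
    have period_nonzero: "w + 1 \<noteq> 0" using w by (metis add.commute eq_neg_iff_add_eq_0 Im_complex_of_real complex_Im_of_int less_irrefl of_int_1 of_int_minus)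
    have eq: "delta_quotient m (\<tau> / (w + 1)) = delta_quotient m \<tau>"
      using inv A \<tau> C by (auto simp: Gamma0_invariant_def upper_half_plane_def mo [symmetric])
    have "Delta (of_nat m * (\<tau> / (w + 1))) = (w + 1) ^ 12 * Delta (of_nat m * \<tau>)"
    proof -
      have "X = p * Y" if "X / (p * D) = Y / D" "p \<noteq> 0" "D \<noteq> 0" for X Y p D :: complex
        using that by (simp add: field_simps)
      then show ?thesis
        using eq Delta_nonzero[OF \<tau>] period_nonzero
        unfolding delta_quotient_def D by (metis power_not_zero)
    qed
    moreover have "of_nat m * \<tau> = of_nat s * w" by (simp add: ms mult_ac flip: w\<tau>)
    ultimately show ?thesis by simp
  qed
  obtain \<tau> where \<tau>: "Im \<tau> > 0" "of_nat s ^ 12 * Delta (of_nat (s * s) * \<tau>) \<noteq> Delta \<tau>"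
    using Delta_scale_rigid[OF s] by blast
  \<comment> \<open>With w = s \<tau> the argument s (w - 1) / w equals s - 1 / \<tau>, so that the
    law for Delta evaluates it.\<close>
  define w where "w = of_nat s * \<tau>"
  have w: "Im w > 0" "w \<noteq> 0" using \<tau>(1) s by (auto simp: w_def)
  have per: "Delta (z + of_int n) = Delta z" if "Im z > 0" for z n
    using periodic_of_int[of Delta] Delta_add_1 that by blast
  have "Delta (of_nat s * (w - 1) / w) = w ^ 12 * Delta (of_nat s * (w - 1))"
    using key[of "w - 1"] w by simp
  also have "of_nat s * (w - 1) / w = - 1 / \<tau> + of_int (int s)"
    using w s by (simp add: w_def field_simps)
  also have "Delta \<dots> = \<tau> ^ 12 * Delta \<tau>"
    by (simp only: per[OF Im_minus_inverse[OF \<tau>(1)]] Delta_minus_inverse[OF \<tau>(1)])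
  also have "of_nat s * (w - 1) = of_nat s * w + of_int (- int s)" by (simp add: algebra_simps)
  also have "Delta \<dots> = Delta (of_nat s * w)" by (rule per) (use w s in simp)
  finally have "\<tau> ^ 12 * Delta \<tau> = \<tau> ^ 12 * (of_nat s ^ 12 * Delta (of_nat (s * s) * \<tau>))"
    by (simp add: w_def power_mult_distrib mult_ac)
  moreover have "\<tau> \<noteq> 0" using \<tau>(1) by auto
  ultimately show False using \<tau>(2) by simp
qed

lemma delta_quotient_strictly_of_level:
  assumes m: "m \<ge> 1" and C: "C \<noteq> 0"
  shows "strictly_of_level m (\<lambda>\<tau>. C * delta_quotient m \<tau>)"
  unfolding strictly_of_level_def weakly_holomorphic_modular_function_def
proof (intro conjI allI impI)
  show "(\<lambda>\<tau>. C * delta_quotient m \<tau>) holomorphic_on upper_half_plane"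
    unfolding upper_half_plane_def by (intro holomorphic_intros holomorphic_on_delta_quotient m)
  show "Gamma0_invariant m (\<lambda>\<tau>. C * delta_quotient m \<tau>)"
    using delta_quotient_invariant[OF m] by (simp add: Gamma0_invariant_def upper_half_plane_def)
qed (use delta_quotient_poles delta_quotient_not_invariant assms in auto)

text \<open>The sum over the cosets of \<open>Gamma0 2\<close> of the square of \<open>2^12 * Delta (2 * \<tau>) / Delta \<tau>\<close>.\<close>

definition trace_quotient :: "complex \<Rightarrow> complex" where
  "trace_quotient \<tau> = 2 ^ 24 * (Delta (2 * \<tau>) / Delta \<tau>) ^ 2 + (Delta (\<tau> / 2) / Delta \<tau>) ^ 2 +
     (Delta ((\<tau> + 1) / 2) / Delta \<tau>) ^ 2"

lemma holomorphic_on_trace_quotient: "trace_quotient holomorphic_on {\<tau>. Im \<tau> > 0}"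
  using holomorphic_on_Delta_scale[of 2 0] holomorphic_on_Delta_scale[of "1/2" 0]
    holomorphic_on_Delta_scale[of "1/2" "1/2"] Delta_nonzero
  unfolding trace_quotient_def [abs_def]
  by (auto simp: add_divide_distrib intro!: holomorphic_intros holomorphic_on_Delta)

lemma trace_quotient_add_1: "trace_quotient (\<tau> + 1) = trace_quotient \<tau>"
proof -
  have "Delta (2 * (\<tau> + 1)) = Delta (2 * \<tau>)"
    using Delta_add_1[of "2 * \<tau>"] Delta_add_1[of "2 * \<tau> + 1"] by (simp add: algebra_simps)
  moreover have "Delta ((\<tau> + 1 + 1) / 2) = Delta (\<tau> / 2)"
    using Delta_add_1[of "\<tau> / 2"] by (simp add: field_simps)
  ultimately show ?thesis by (simp add: trace_quotient_def Delta_add_1)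
qed

text \<open>Inversion exchanges the first two summands, where 2^24 compensates the powers of 2, and
  fixes the third.\<close>

lemma trace_quotient_minus_inverse:
  assumes \<tau>: "Im \<tau> > 0"
  shows "trace_quotient (- 1 / \<tau>) = trace_quotient \<tau>"
proof -
  have period_nonzero: "\<tau> \<noteq> 0" using \<tau> by auto
  have 1: "Delta (2 * (- 1 / \<tau>)) = (\<tau> / 2) ^ 12 * Delta (\<tau> / 2)"
    using Delta_minus_inverse[of "\<tau> / 2"] \<tau> by simp
  have 2: "Delta ((- 1 / \<tau>) / 2) = (2 * \<tau>) ^ 12 * Delta (2 * \<tau>)"
    using Delta_minus_inverse[of "2 * \<tau>"] \<tau> by (simp add: mult.commute)
  \<comment> \<open>The matrix with rows (1, - 1) and (2, - 1) maps (\<tau> + 1) / 2 to this point,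
    with automorphy factor \<tau>.\<close>
  have "(- 1 / \<tau> + 1) / 2 = (of_int 1 * ((\<tau> + 1) / 2) + of_int (- 1)) / (of_int 2 * ((\<tau> + 1) / 2) + of_int (- 1))"
    using period_nonzero by (simp add: field_simps)
  also have "Delta \<dots> = (of_int 2 * ((\<tau> + 1) / 2) + of_int (- 1)) ^ 12 * Delta ((\<tau> + 1) / 2)"
    by (rule Delta_moebius) (use \<tau> in auto)
  also have "of_int 2 * ((\<tau> + 1) / 2) + of_int (- 1) = \<tau>" by (simp add: field_simps)
  finally have 3: "Delta ((- 1 / \<tau> + 1) / 2) = \<tau> ^ 12 * Delta ((\<tau> + 1) / 2)" .
  have alg: "2 ^ 24 * (((t / 2) ^ 12 * B) / (t ^ 12 * D)) ^ 2 + (((2 * t) ^ 12 * A) / (t ^ 12 * D)) ^ 2 +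
      ((t ^ 12 * E) / (t ^ 12 * D)) ^ 2 = 2 ^ 24 * (A / D) ^ 2 + (B / D) ^ 2 + (E / D) ^ 2"
    if "t \<noteq> 0" for t A B D E :: complex
    using that by (simp add: power_mult_distrib power_divide)
  show ?thesis
    unfolding trace_quotient_def 1 2 3 Delta_minus_inverse[OF \<tau>] by (rule alg[OF period_nonzero])
qed

lemma trace_quotient_moebius:
  assumes "A \<in> SL2Z" "\<tau> \<in> upper_half_plane"
  shows "trace_quotient (moebius A \<tau>) = trace_quotient \<tau>"
proof -
  have \<tau>: "Im \<tau> > 0" using assms(2) by (simp add: upper_half_plane_def)
  have "trace_quotient (moebius A \<tau>) =
      (of_int (A $$ (1, 0)) * \<tau> + of_int (A $$ (1, 1))) ^ 0 * trace_quotient \<tau>"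
    unfolding moebius_def
    by (rule modular_generators[where f = trace_quotient and k = 0, OF _ _ _ \<tau> SL2Z_det[OF assms(1)]])
       (rule trace_quotient_add_1, simp only: trace_quotient_minus_inverse power_0 mult_1, simp)
  then show ?thesis by simp
qed

text \<open>The summands with half arguments are series in \<open>qexp (\<tau> / 2)\<close>; the
  hypotheses say that the whole sum is 1/q times a power series in q. By invariance this one
  expansion serves at every cusp, with width 1.\<close>

lemma trace_quotient_strictly_of_level:
  assumes S: "S holomorphic_on ball 0 1"
    and eq: "\<And>\<tau>. Im \<tau> > 0 \<Longrightarrow> qexp \<tau> * trace_quotient \<tau> = S (qexp \<tau>)"
  shows "strictly_of_level 1 (\<lambda>\<tau>. C * trace_quotient \<tau>)"
  unfolding strictly_of_level_def weakly_holomorphic_modular_function_def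
proof (intro conjI)
  show "(\<lambda>\<tau>. C * trace_quotient \<tau>) holomorphic_on upper_half_plane"
    unfolding upper_half_plane_def by (intro holomorphic_intros holomorphic_on_trace_quotient)
  show "Gamma0_invariant 1 (\<lambda>\<tau>. C * trace_quotient \<tau>)"
    using trace_quotient_moebius by (auto simp: Gamma0_invariant_def Gamma0_def)
  show "at_most_poles_at_cusps (\<lambda>\<tau>. C * trace_quotient \<tau>)"
    unfolding at_most_poles_at_cusps_def
  proof
    fix A assume A: "A \<in> SL2Z"
    have "S analytic_on {0}" by (rule holomorphic_on_imp_analytic_at[OF S open_ball]) simp
    then have F: "(\<lambda>x. C * (S x / x)) meromorphic_on {0}"
      by (intro meromorphic_intros analytic_on_imp_meromorphic_on)
    have "C * trace_quotient (moebius A \<tau>) = C * (S (qexp \<tau>) / qexp \<tau>)" if "\<tau> \<in> upper_half_plane" for \<tau>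
      using trace_quotient_moebius[OF A that] eq[of \<tau>] that
      by (simp add: upper_half_plane_def field_simps)
    then show "\<exists>h>0. \<exists>F. F meromorphic_on {0} \<and> (\<forall>\<tau>\<in>upper_half_plane.
        C * trace_quotient (moebius A \<tau>) = F (exp (2 * of_real pi * \<i> * \<tau> / of_nat h)))"
      using F by (intro exI[of _ "1::nat"] conjI exI[of _ "\<lambda>x. C * (S x / x)"]) (auto simp: qexp_def)
  qed
qed simp

section \<open>Characters\<close>

text \<open>The change of basis that makes all matrices preserving \<open>W\<close> block
  triangular: the first k columns of \<open>P\<close> span \<open>W\<close>, and its inverse
  \<open>Q\<close> sends \<open>W\<close> to vectors supported on the first k coordinates.\<close>

lemma (in vec_space) exists_adapted_basis:
  assumes W: "VectorSpace.subspace class_ring W V" "W \<noteq> {0\<^sub>v n}" "W \<noteq> carrier_vec n"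
  obtains P Q k where "P \<in> carrier_mat n n" "Q \<in> carrier_mat n n" "P * Q = 1\<^sub>m n" "Q * P = 1\<^sub>m n"
    "0 < k" "k < n" "\<And>j. j < k \<Longrightarrow> col P j \<in> W"
    "\<And>w i. w \<in> W \<Longrightarrow> k \<le> i \<Longrightarrow> i < n \<Longrightarrow> (Q *\<^sub>v w) $ i = 0"
proof -
  have sub: "submodule class_ring W V"
    using W(1) by (simp add: VectorSpace.subspace_def)
  have Wc: "W \<subseteq> carrier_vec n" using submodule.subset[OF sub] by simp
  have W0: "0\<^sub>v n \<in> W" using submodule.zero_closed[OF sub] by simp
  \<comment> \<open>An independent subset of \<open>W\<close> of largest size, which exists as sizes
    are at most n, spans \<open>W\<close>.\<close>
  define Q0 where "Q0 A \<longleftrightarrow> A \<subseteq> W \<and> lin_indpt A" for A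
  have bound: "finite A \<and> card A \<le> n" if "Q0 A" for A
  proof -
    have "A \<subseteq> carrier_vec n" "lin_indpt A" using that Wc by (auto simp: Q0_def)
    then show ?thesis using li_le_dim[OF fin_dim] dim_is_n by simp
  qed
  have "lin_indpt {}" unfolding lin_dep_def by blast
  then have "Q0 {}" by (simp add: Q0_def)
  then obtain A where A: "Q0 A" and Amax: "\<And>B. Q0 B \<Longrightarrow> card B \<le> card A"
    using ex_has_greatest_nat[of Q0 "{}" card "Suc n"] bound by (metis le_imp_less_Suc)
  have Af: "finite A" "card A \<le> n" using bound[OF A] by auto
  have AW: "A \<subseteq> W" and Ali: "lin_indpt A" using A by (auto simp: Q0_def)
  have Ac: "A \<subseteq> carrier_vec n" using AW Wc by auto
  have WspA: "w \<in> span A" if w: "w \<in> W" for w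
  proof (cases "w \<in> A")
    case True
    then show ?thesis using span_mem[of A w] Ac by auto
  next
    case False
    show ?thesis
    proof (rule ccontr)
      assume "w \<notin> span A"
      then have "lin_indpt (A \<union> {w})"
        using lin_dep_iff_in_span[of A w] Ac Ali w Wc False by auto
      then have "card (A \<union> {w}) \<le> card A" using Amax AW w by (auto simp: Q0_def)
      then show False using False Af by simp
    qed
  qed
  have spAW: "span A \<subseteq> W"
    using span_is_subset[OF AW sub] by simp
  have "set (unit_vecs n) \<subseteq> carrier_vec n" by (rule unit_vecs_carrier)
  moreover have "A \<subseteq> span (set (unit_vecs n))" using Ac by (simp only: span_unit_vecs_is_carrier)
  ultimately have "\<exists>C. finite C \<and> C \<subseteq> carrier_vec n \<and> C \<subseteq> span (set (unit_vecs n)) \<and> C \<inter> A = {} \<and>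
      int (card C) \<le> int (card (set (unit_vecs n :: 'a vec list))) - int (card A) \<and>
      span (A \<union> C) = span (set (unit_vecs n))"
    by (intro replacement Af Ali finite_set)
  then obtain C where C: "finite C" "C \<subseteq> carrier_vec n" "C \<inter> A = {}"
     "int (card C) \<le> int (card (set (unit_vecs n :: 'a vec list))) - int (card A)"
     "span (A \<union> C) = span (set (unit_vecs n))"
    by metis
  have cardU: "card (set (unit_vecs n :: 'a vec list)) = n"
    using distinct_card[OF unit_vecs_distinct] by simp
  then have cardC: "card C + card A \<le> n" using C(4) by linarith
  have spAC: "span (A \<union> C) = carrier_vec n" using C(5) by (simp add: span_unit_vecs_is_carrier)
  obtain as where as: "set as = A" "distinct as" using finite_distinct_list[OF Af(1)] by blast
  obtain cs where cs: "set cs = C" "distinct cs" using finite_distinct_list[OF C(1)] by blast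
  define k where "k = card A"
  have lenas: "length as = k" using as distinct_card k_def by metis
  have lencs: "length cs = card C" using cs distinct_card by metis
  \<comment> \<open>The zero vectors bring the list to length n. Since the list spans,
    \<open>P\<close> has a right inverse, and for square matrices this is two-sided.\<close>
  define ws where "ws = as @ cs @ replicate (n - (card C + card A)) (0\<^sub>v n)"
  have lenws: "length ws = n" using cardC by (simp add: ws_def lenas lencs k_def)
  have wsc: "set ws \<subseteq> carrier_vec n" using Ac C(2) by (auto simp: ws_def as cs)
  have wsc': "\<forall>w\<in>set ws. dim_vec w = n" using wsc by (meson carrier_vecD subsetD)
  have spws: "span (set ws) = carrier_vec n"
  proof
    show "span (set ws) \<subseteq> carrier_vec n" using span_closed[of "set ws"] wsc by blast
    have "A \<union> C \<subseteq> set ws" by (simp add: ws_def as cs) blast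
    then have "span (A \<union> C) \<subseteq> span (set ws)" by (rule span_is_monotone)
    then show "carrier_vec n \<subseteq> span (set ws)" using spAC by simp
  qed
  define P where "P = mat_of_cols n ws"
  have P: "P \<in> carrier_mat n n" using mat_of_cols_carrier(1)[of n ws] by (simp only: P_def lenws)
  have "\<exists>c. P *\<^sub>v vec n c = v" if "v \<in> carrier_vec n" for v
  proof -
    have "v \<in> span_list ws" using that spws span_list_as_span[OF wsc] by simp
    then obtain c where "v = lincomb_list c ws" by (rule in_span_listE)
    also have "\<dots> = P *\<^sub>v vec n c"
      unfolding P_def using lincomb_list_as_mat_mult[of ws c] wsc' lenws by simp
    finally show ?thesis by blast
  qed
  then have "\<forall>j. \<exists>c. j < n \<longrightarrow> P *\<^sub>v vec n c = unit_vec n j" by (meson unit_vec_carrier)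
  then obtain c where c: "\<And>j. j < n \<Longrightarrow> P *\<^sub>v vec n (c j) = unit_vec n j" by metis
  define Q where "Q = mat n n (\<lambda>(i, j). c j i)"
  have Q: "Q \<in> carrier_mat n n" by (simp add: Q_def)
  have PQ: "P * Q = 1\<^sub>m n"
  proof (rule mat_col_eqI)
    fix j assume "j < dim_col (1\<^sub>m n :: 'a mat)"
    then have j: "j < n" by simp
    have "col (P * Q) j = P *\<^sub>v col Q j" by (rule col_mult2[OF P Q j])
    also have "col Q j = vec n (c j)" using j by (auto simp: Q_def col_def)
    finally show "col (P * Q) j = col (1\<^sub>m n) j" using c j by simp
  qed (use P Q in auto)
  then have QP: "Q * P = 1\<^sub>m n" by (rule mat_mult_left_right_inverse[OF P Q])
  have colP: "col P j \<in> W" if "j < k" for j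
  proof -
    have "j < n" "j < length as" using that Af lenas by (auto simp: k_def)
    then have "col P j = as ! j"
      using lenws wsc lenas by (simp add: P_def col_mat_of_cols ws_def nth_append subset_iff)
    moreover have "as ! j \<in> A" using that lenas as(1) nth_mem by blast
    ultimately show ?thesis using AW by auto
  qed
  have asc: "\<forall>w\<in>set as. dim_vec w = n" using Ac as(1) by (meson carrier_vecD subsetD)
  have Qw: "(Q *\<^sub>v w) $ i = 0" if w: "w \<in> W" and i: "k \<le> i" "i < n" for w i
  proof -
    have "w \<in> span_list as" using WspA[OF w] span_list_as_span[of as] Ac by (simp add: as)
    then obtain a where "w = lincomb_list a as" by (rule in_span_listE)
    also have "\<dots> = mat_of_cols n as *\<^sub>v vec k a"
      using lincomb_list_as_mat_mult[of as a] asc lenas by simp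
    also have "\<dots> = P *\<^sub>v vec n (\<lambda>l. if l < k then a l else 0)"
    proof (rule eq_vecI)
      fix r assume "r < dim_vec (P *\<^sub>v vec n (\<lambda>l. if l < k then a l else 0))"
      then have r: "r < n" using P by simp
      have kn: "k \<le> n" using Af by (simp add: k_def)
      have "(mat_of_cols n as *\<^sub>v vec k a) $ r = (\<Sum>l<k. as ! l $ r * a l)"
        using r lenas by (simp add: scalar_prod_def mat_of_cols_index lessThan_atLeast0)
      also have "\<dots> = (\<Sum>l<n. if l < k then as ! l $ r * a l else 0)"
        using kn by (simp add: sum.If_cases) (auto intro!: sum.cong)
      also have "\<dots> = (\<Sum>l<n. P $$ (r, l) * (if l < k then a l else 0))"
        using r lenws lenas by (auto intro!: sum.cong simp: P_def mat_of_cols_index ws_def nth_append)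
      also have "\<dots> = (P *\<^sub>v vec n (\<lambda>l. if l < k then a l else 0)) $ r"
        using r P by (simp add: scalar_prod_def lessThan_atLeast0)
      finally show "(mat_of_cols n as *\<^sub>v vec k a) $ r = (P *\<^sub>v vec n (\<lambda>l. if l < k then a l else 0)) $ r" .
    qed (use P in auto)
    finally have "Q *\<^sub>v w = (Q * P) *\<^sub>v vec n (\<lambda>l. if l < k then a l else 0)"
      using assoc_mult_mat_vec[OF Q P, of "vec n (\<lambda>l. if l < k then a l else 0)"] by simp
    also have "\<dots> = vec n (\<lambda>l. if l < k then a l else 0)" by (simp add: QP)
    finally show ?thesis using i by simp
  qed
  have "k > 0"
  proof (rule ccontr)
    assume "\<not> k > 0"
    then have "A = {}" using Af by (simp add: k_def)
    then have "W \<subseteq> {0\<^sub>v n}" using WspA span_empty by auto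
    then show False using W0 W(2) by auto
  qed
  moreover have "k < n"
  proof (rule ccontr)
    assume "\<not> k < n"
    then have "card C = 0" using cardC by (simp add: k_def)
    then have "C = {}" using C(1) by simp
    then have "carrier_vec n \<subseteq> W" using spAC spAW by simp
    then show False using Wc W(3) by auto
  qed
  ultimately show thesis using that[OF P Q PQ QP] colP Qw by blast
qed

lemma mat_mult_index:
  assumes "A \<in> carrier_mat n n" "B \<in> carrier_mat n n" "i < n" "j < n"
  shows "(A * B) $$ (i, j) = (\<Sum>l<n. A $$ (i, l) * B $$ (l, j))"
  using assms by (simp add: scalar_prod_def lessThan_atLeast0)

lemma mat_trace_comm:
  assumes "A \<in> carrier_mat n n" "B \<in> carrier_mat n n"
  shows "mat_trace (A * B) = mat_trace (B * A)"
proof -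
  have "mat_trace (A * B) = (\<Sum>i<n. \<Sum>l<n. A $$ (i, l) * B $$ (l, i))"
    using assms by (auto simp: mat_trace_def mat_mult_index[OF assms] simp del: index_mult_mat(1))
  also have "\<dots> = (\<Sum>l<n. \<Sum>i<n. B $$ (l, i) * A $$ (i, l))"
    by (subst sum.swap) (simp add: mult.commute)
  also have "\<dots> = mat_trace (B * A)"
    using assms by (auto simp: mat_trace_def mat_mult_index[OF assms(2,1)] simp del: index_mult_mat(1))
  finally show ?thesis .
qed

lemma units_of_ring_mat:
  "carrier (units_of (ring_mat TYPE(complex) n ())) =
     {A \<in> carrier_mat n n. \<exists>B\<in>carrier_mat n n. B * A = 1\<^sub>m n \<and> A * B = 1\<^sub>m n}"
  "x \<otimes>\<^bsub>units_of (ring_mat TYPE(complex) n ())\<^esub> y = x * y"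
  "\<one>\<^bsub>units_of (ring_mat TYPE(complex) n ())\<^esub> = 1\<^sub>m n"
  by (auto simp: units_of_def Units_def ring_mat_simps)

lemma group_units_of_ring_mat: "group (units_of (ring_mat TYPE(complex) n ()))"
proof -
  interpret semiring "ring_mat TYPE(complex) n ()" by (rule semiring_mat)
  show ?thesis by (rule units_group)
qed

lemma representation_iff:
  assumes "group G"
  shows "representation G n \<rho> \<longleftrightarrow>
    (\<forall>g\<in>carrier G. \<rho> g \<in> carrier_mat n n) \<and>
    (\<forall>g\<in>carrier G. \<forall>h\<in>carrier G. \<rho> (g \<otimes>\<^bsub>G\<^esub> h) = \<rho> g * \<rho> h) \<and> \<rho> \<one>\<^bsub>G\<^esub> = 1\<^sub>m n"
    (is "_ \<longleftrightarrow> ?R")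
proof -
  interpret G: group G by fact
  show ?thesis
  proof
    assume r: "representation G n \<rho>"
    then have "\<rho> \<one>\<^bsub>G\<^esub> = 1\<^sub>m n"
      using hom_one[of \<rho> G "units_of (ring_mat TYPE(complex) n ())"] assms group_units_of_ring_mat
      by (simp add: representation_def units_of_ring_mat)
    with r show ?R by (auto simp: representation_def hom_def units_of_ring_mat)
  next
    assume R: ?R
    have "\<rho> g \<in> carrier (units_of (ring_mat TYPE(complex) n ()))" if g: "g \<in> carrier G" for g
    proof -
      have "\<rho> (inv\<^bsub>G\<^esub> g) * \<rho> g = 1\<^sub>m n" "\<rho> g * \<rho> (inv\<^bsub>G\<^esub> g) = 1\<^sub>m n"
        using R g by (metis G.inv_closed G.l_inv, metis G.inv_closed G.r_inv)
      moreover have "\<rho> g \<in> carrier_mat n n" "\<rho> (inv\<^bsub>G\<^esub> g) \<in> carrier_mat n n"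
        using R g by auto
      ultimately show ?thesis unfolding units_of_ring_mat by blast
    qed
    then show "representation G n \<rho>"
      using R by (auto simp: representation_def hom_def units_of_ring_mat)
  qed
qed

section \<open>Virtual modules and their traces\<close>

lemma virtual_trace_superset:
  assumes "finite S" "Poly_Mapping.keys M \<subseteq> S"
  shows "virtual_trace g M = (\<Sum>C\<in>S. of_int (Poly_Mapping.lookup M C) * irr_character C g)"
  unfolding virtual_trace_def
  by (rule sum.mono_neutral_left) (use assms in \<open>auto simp: in_keys_iff\<close>)

lemma virtual_trace_0 [simp]: "virtual_trace g 0 = 0"
  by (simp add: virtual_trace_def)

lemma virtual_trace_add: "virtual_trace g (M + N) = virtual_trace g M + virtual_trace g N"
proof -
  let ?S = "Poly_Mapping.keys M \<union> Poly_Mapping.keys N"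
  have "virtual_trace g (M + N) = (\<Sum>C\<in>?S. of_int (Poly_Mapping.lookup (M + N) C) * irr_character C g)"
    by (rule virtual_trace_superset) (use keys_add[of M N] in auto)
  also have "\<dots> = (\<Sum>C\<in>?S. of_int (Poly_Mapping.lookup M C) * irr_character C g) +
      (\<Sum>C\<in>?S. of_int (Poly_Mapping.lookup N C) * irr_character C g)"
    by (simp add: lookup_add ring_distribs sum.distrib)
  also have "\<dots> = virtual_trace g M + virtual_trace g N"
    by (subst (1 2) virtual_trace_superset[of ?S]) auto
  finally show ?thesis .
qed

lemma virtual_trace_cmul: "virtual_trace g (frag_cmul k M) = of_int k * virtual_trace g M"
proof -
  have "virtual_trace g (frag_cmul k M) =
      (\<Sum>C\<in>Poly_Mapping.keys M. of_int (Poly_Mapping.lookup (frag_cmul k M) C) * irr_character C g)"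
    by (rule virtual_trace_superset) (use keys_cmul[of k M] in auto)
  then show ?thesis
    by (simp add: virtual_trace_def sum_distrib_left mult.assoc)
qed

lemma virtual_trace_sum: "virtual_trace g (\<Sum>i\<in>I. M i) = (\<Sum>i\<in>I. virtual_trace g (M i))"
  by (induction I rule: infinite_finite_induct) (auto simp: virtual_trace_add)

lemma virtual_modules_iff: "M \<in> virtual_modules G \<longleftrightarrow> Poly_Mapping.keys M \<subseteq> Irr G"
  by (simp add: virtual_modules_def)

lemma virtual_modules_closed:
  shows "0 \<in> virtual_modules G"
    and "M \<in> virtual_modules G \<Longrightarrow> N \<in> virtual_modules G \<Longrightarrow> M + N \<in> virtual_modules G"
    and "M \<in> virtual_modules G \<Longrightarrow> frag_cmul k M \<in> virtual_modules G"
    and "(\<And>i. i \<in> I \<Longrightarrow> f i \<in> virtual_modules G) \<Longrightarrow> (\<Sum>i\<in>I. f i) \<in> virtual_modules G"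
proof -
  show add: "M + N \<in> virtual_modules G" if "M \<in> virtual_modules G" "N \<in> virtual_modules G" for M N
    using that keys_add[of M N] unfolding virtual_modules_iff by blast
  show "frag_cmul k M \<in> virtual_modules G" if "M \<in> virtual_modules G" for M
    using that keys_cmul[of k M] unfolding virtual_modules_iff by blast
  show zero: "0 \<in> virtual_modules G" by (simp add: virtual_modules_iff)
  show "(\<And>i. i \<in> I \<Longrightarrow> f i \<in> virtual_modules G) \<Longrightarrow> (\<Sum>i\<in>I. f i) \<in> virtual_modules G"
    by (induction I rule: infinite_finite_induct) (auto simp: zero intro: add)
qed

lemma genuine_closed:
  "genuine 0" "genuine M \<Longrightarrow> genuine N \<Longrightarrow> genuine (M + N)" "genuine (frag_of C)"
  by (auto simp: genuine_def lookup_add)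

lemma irr_character_class:
  assumes "group G" "\<rho> \<in> irreps G" "g \<in> carrier G"
  shows "irr_character (rep_iso G `` {\<rho>}) g = mat_trace (\<rho> g)"
proof -
  have "mat_trace (\<sigma> g) = mat_trace (\<rho> g)" if "(\<rho>, \<sigma>) \<in> rep_iso G" for \<sigma>
  proof -
    from that obtain n P where rep: "representation G n \<rho>" "representation G n \<sigma>"
      and "P \<in> Units (ring_mat TYPE(complex) n ())" and eq: "P * \<rho> g = \<sigma> g * P"
      using assms(3) by (auto simp: rep_iso_def)
    then obtain Q where P: "P \<in> carrier_mat n n" and Q: "Q \<in> carrier_mat n n" "P * Q = 1\<^sub>m n" "Q * P = 1\<^sub>m n"
      by (auto simp: Units_def ring_mat_simps)
    have c: "\<rho> g \<in> carrier_mat n n" "\<sigma> g \<in> carrier_mat n n"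
      using rep assms(3) by (auto simp: representation_iff[OF assms(1)])
    have "\<sigma> g = \<sigma> g * (P * Q)" using c Q by simp
    also have "\<dots> = P * \<rho> g * Q" using assoc_mult_mat[OF c(2) P Q(1)] eq by simp
    finally have "mat_trace (\<sigma> g) = mat_trace (Q * (P * \<rho> g))"
      using mat_trace_comm[of "P * \<rho> g" n Q] P c Q by simp
    also have "Q * (P * \<rho> g) = \<rho> g" using assoc_mult_mat[OF Q(1) P c(1)] Q c by simp
    finally show ?thesis .
  qed
  moreover have "(\<rho>, \<rho>) \<in> rep_iso G"
  proof -
    obtain n where n: "irreducible_representation G n \<rho>" using assms(2) by (auto simp: irreps_def)
    then have r: "representation G n \<rho>" by (simp add: irreducible_representation_def)
    have "1\<^sub>m n \<in> Units (ring_mat TYPE(complex) n ())"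
      unfolding Units_def ring_mat_simps by (auto intro!: exI[of _ "1\<^sub>m n"])
    moreover have "\<forall>g\<in>carrier G. 1\<^sub>m n * \<rho> g = \<rho> g * 1\<^sub>m n"
      using r by (auto simp: representation_iff[OF assms(1)])
    ultimately show ?thesis using r assms(2) unfolding rep_iso_def by blast
  qed
  ultimately have "(\<lambda>\<sigma>. mat_trace (\<sigma> g)) ` (rep_iso G `` {\<rho>}) = {mat_trace (\<rho> g)}"
    by (intro equalityI subsetI) blast+
  then show ?thesis by (simp add: irr_character_def)
qed

definition module_char :: "('a, 'b) monoid_scheme \<Rightarrow> ('a \<Rightarrow> complex) \<Rightarrow> bool" where
  "module_char G \<phi> \<longleftrightarrow>
     (\<exists>M\<in>virtual_modules G. genuine M \<and> (\<forall>g\<in>carrier G. virtual_trace g M = \<phi> g))"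

lemma module_char_add:
  assumes "module_char G \<phi>" "module_char G \<psi>"
  shows "module_char G (\<lambda>g. \<phi> g + \<psi> g)"
proof -
  from assms obtain M N where "M \<in> virtual_modules G" "genuine M" "\<forall>g\<in>carrier G. virtual_trace g M = \<phi> g"
    "N \<in> virtual_modules G" "genuine N" "\<forall>g\<in>carrier G. virtual_trace g N = \<psi> g"
    unfolding module_char_def by metis
  then show ?thesis
    unfolding module_char_def
    by (intro bexI[of _ "M + N"]) (auto simp: virtual_trace_add intro: genuine_closed virtual_modules_closed)
qed

lemma module_char_cong:
  assumes "module_char G \<phi>" "\<And>g. g \<in> carrier G \<Longrightarrow> \<phi> g = \<psi> g"
  shows "module_char G \<psi>"
  using assms unfolding module_char_def by auto

lemma frag_of_irrep:
  assumes "group G" "\<rho> \<in> irreps G"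
  shows "frag_of (rep_iso G `` {\<rho>}) \<in> virtual_modules G"
    and "g \<in> carrier G \<Longrightarrow> virtual_trace g (frag_of (rep_iso G `` {\<rho>})) = mat_trace (\<rho> g)"
proof -
  show "frag_of (rep_iso G `` {\<rho>}) \<in> virtual_modules G"
    using assms(2) by (simp add: virtual_modules_iff Irr_def quotientI)
  show "g \<in> carrier G \<Longrightarrow> virtual_trace g (frag_of (rep_iso G `` {\<rho>})) = mat_trace (\<rho> g)"
    using irr_character_class[OF assms] by (simp add: virtual_trace_def)
qed

text \<open>Composition factors suffice here, as traces are additive along invariant subspaces; complete
  reducibility is not needed.\<close>

lemma module_char_representation:
  assumes G: "group G"
  shows "representation G n \<rho> \<Longrightarrow> module_char G (\<lambda>g. mat_trace (\<rho> g))"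
proof (induction n arbitrary: \<rho> rule: less_induct)
  case (less n)
  note rep = less.prems[unfolded representation_iff[OF G]]
  consider "n = 0" | "irreducible_representation G n \<rho>" | "n > 0" "\<not> irreducible_representation G n \<rho>"
    by blast
  then show ?case
  proof cases
    case 1
    then have "\<And>g. g \<in> carrier G \<Longrightarrow> mat_trace (\<rho> g) = 0"
      using rep by (auto simp: mat_trace_def)
    then show ?thesis
      unfolding module_char_def by (intro bexI[of _ 0]) (auto intro: virtual_modules_closed genuine_closed)
  next
    case 2
    then have "\<rho> \<in> irreps G" by (auto simp: irreps_def)
    from frag_of_irrep[OF G this] show ?thesis
      unfolding module_char_def by (auto intro: genuine_closed)
  next
    case 3
    interpret V: vec_space "TYPE(complex)" n .
    from 3 less.prems obtain W where W: "VectorSpace.subspace class_ring W (module_vec TYPE(complex) n)"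
      "W \<noteq> {0\<^sub>v n}" "W \<noteq> carrier_vec n" and inv: "\<forall>g\<in>carrier G. \<forall>w\<in>W. \<rho> g *\<^sub>v w \<in> W"
      by (auto simp: irreducible_representation_def)
    obtain P Q k where PQ: "P \<in> carrier_mat n n" "Q \<in> carrier_mat n n" "P * Q = 1\<^sub>m n" "Q * P = 1\<^sub>m n"
      and k: "0 < k" "k < n" and colP: "\<And>j. j < k \<Longrightarrow> col P j \<in> W"
      and Qw: "\<And>w i. w \<in> W \<Longrightarrow> k \<le> i \<Longrightarrow> i < n \<Longrightarrow> (Q *\<^sub>v w) $ i = 0"
      using V.exists_adapted_basis[OF W] by blast
    define \<sigma> where "\<sigma> g = Q * (\<rho> g * P)" for g
    have \<sigma>c: "\<sigma> g \<in> carrier_mat n n" if "g \<in> carrier G" for g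
      using rep that PQ by (auto simp: \<sigma>_def)
    have \<sigma>_mult: "\<sigma> (g \<otimes>\<^bsub>G\<^esub> h) = \<sigma> g * \<sigma> h" if "g \<in> carrier G" "h \<in> carrier G" for g h
    proof -
      have c: "\<rho> g \<in> carrier_mat n n" "\<rho> h \<in> carrier_mat n n" using rep that by auto
      have "\<sigma> g * \<sigma> h = Q * (\<rho> g * ((P * Q) * (\<rho> h * P)))"
        unfolding \<sigma>_def using PQ(1,2) c by (simp add: assoc_mult_mat[of _ n n _ n _ n])
      also have "\<dots> = Q * (\<rho> g * \<rho> h * P)"
        using PQ(1,2) c by (simp add: PQ(3) assoc_mult_mat[of _ n n _ n _ n])
      finally show ?thesis using rep that by (simp add: \<sigma>_def)
    qed
    have \<sigma>_1: "\<sigma> \<one>\<^bsub>G\<^esub> = 1\<^sub>m n" using rep PQ by (simp add: \<sigma>_def)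
    have \<sigma>_0: "\<sigma> g $$ (i, j) = 0" if g: "g \<in> carrier G" and "k \<le> i" "i < n" "j < k" for g i j
    proof -
      have c: "\<rho> g \<in> carrier_mat n n" using rep g by auto
      have "\<sigma> g $$ (i, j) = col (\<sigma> g) j $ i" using \<sigma>c[OF g] that k by simp
      also have "col (\<sigma> g) j = Q *\<^sub>v (\<rho> g *\<^sub>v col P j)"
        unfolding \<sigma>_def using that k col_mult2[OF PQ(2), of "\<rho> g * P" n j] col_mult2[OF c PQ(1), of j] c PQ by simp
      also have "\<dots> $ i = 0" using that Qw inv colP by blast
      finally show ?thesis .
    qed
    \<comment> \<open>The diagonal blocks afford the subrepresentation on \<open>W\<close> and the
      quotient by it. They are multiplicative because the lower left block vanishes by
      \<open>\<sigma>_0\<close>.\<close>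
    define \<rho>1 where "\<rho>1 g = mat k k (\<lambda>(i, j). \<sigma> g $$ (i, j))" for g
    define \<rho>2 where "\<rho>2 g = mat (n - k) (n - k) (\<lambda>(i, j). \<sigma> g $$ (i + k, j + k))" for g
    have split: "(\<Sum>l<n. f l) = (\<Sum>l<k. f l) + (\<Sum>l<n - k. f (l + k))" for f :: "nat \<Rightarrow> complex"
    proof -
      have "(\<Sum>l\<in>{k..<n}. f l) = (\<Sum>l<n - k. f (l + k))"
        by (rule sum.reindex_bij_witness[of _ "\<lambda>l. l + k" "\<lambda>l. l - k"]) auto
      moreover have "{..<n} = {..<k} \<union> {k..<n}" using k by auto
      ultimately show ?thesis by (simp add: sum.union_disjoint ivl_disj_int)
    qed
    have "representation G k \<rho>1"
      unfolding representation_iff[OF G]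
    proof (intro conjI ballI)
      show "\<rho>1 \<one>\<^bsub>G\<^esub> = 1\<^sub>m k" using k by (auto simp: \<rho>1_def \<sigma>_1)
      fix g h assume gh: "g \<in> carrier G" "h \<in> carrier G"
      show "\<rho>1 (g \<otimes>\<^bsub>G\<^esub> h) = \<rho>1 g * \<rho>1 h"
      proof (rule eq_matI)
        fix i j assume "i < dim_row (\<rho>1 g * \<rho>1 h)" "j < dim_col (\<rho>1 g * \<rho>1 h)"
        then have ij: "i < k" "j < k" by (simp_all add: \<rho>1_def)
        have "\<rho>1 (g \<otimes>\<^bsub>G\<^esub> h) $$ (i, j) = (\<Sum>l<n. \<sigma> g $$ (i, l) * \<sigma> h $$ (l, j))"
          using ij k gh \<sigma>c by (simp add: \<rho>1_def \<sigma>_mult mat_mult_index)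
        also have "\<dots> = (\<Sum>l<k. \<sigma> g $$ (i, l) * \<sigma> h $$ (l, j))"
          using ij gh by (simp add: split \<sigma>_0)
        also have "\<dots> = (\<rho>1 g * \<rho>1 h) $$ (i, j)"
          using ij by (simp add: scalar_prod_def lessThan_atLeast0 \<rho>1_def)
        finally show "\<rho>1 (g \<otimes>\<^bsub>G\<^esub> h) $$ (i, j) = (\<rho>1 g * \<rho>1 h) $$ (i, j)" .
      qed (simp_all add: \<rho>1_def)
    qed (simp add: \<rho>1_def)
    moreover have "representation G (n - k) \<rho>2"
      unfolding representation_iff[OF G]
    proof (intro conjI ballI)
      show "\<rho>2 \<one>\<^bsub>G\<^esub> = 1\<^sub>m (n - k)" using k by (auto simp: \<rho>2_def \<sigma>_1)
      fix g h assume gh: "g \<in> carrier G" "h \<in> carrier G"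
      show "\<rho>2 (g \<otimes>\<^bsub>G\<^esub> h) = \<rho>2 g * \<rho>2 h"
      proof (rule eq_matI)
        fix i j assume "i < dim_row (\<rho>2 g * \<rho>2 h)" "j < dim_col (\<rho>2 g * \<rho>2 h)"
        then have ij: "i < n - k" "j < n - k" by (simp_all add: \<rho>2_def)
        have "\<rho>2 (g \<otimes>\<^bsub>G\<^esub> h) $$ (i, j) = (\<Sum>l<n. \<sigma> g $$ (i + k, l) * \<sigma> h $$ (l, j + k))"
          using ij k gh \<sigma>c by (simp add: \<rho>2_def \<sigma>_mult mat_mult_index)
        also have "\<dots> = (\<Sum>l<n - k. \<sigma> g $$ (i + k, l + k) * \<sigma> h $$ (l + k, j + k))"
          using ij gh by (simp add: split \<sigma>_0)
        also have "\<dots> = (\<rho>2 g * \<rho>2 h) $$ (i, j)"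
          using ij by (simp add: scalar_prod_def lessThan_atLeast0 \<rho>2_def)
        finally show "\<rho>2 (g \<otimes>\<^bsub>G\<^esub> h) $$ (i, j) = (\<rho>2 g * \<rho>2 h) $$ (i, j)" .
      qed (simp_all add: \<rho>2_def)
    qed (simp add: \<rho>2_def)
    ultimately have "module_char G (\<lambda>g. mat_trace (\<rho>1 g) + mat_trace (\<rho>2 g))"
      using less.IH[of k \<rho>1] less.IH[of "n - k" \<rho>2] k by (simp add: module_char_add)
    then show ?thesis
    proof (rule module_char_cong)
      fix g assume g: "g \<in> carrier G"
      have c: "\<rho> g \<in> carrier_mat n n" using rep g by auto
      have "mat_trace (\<rho>1 g) + mat_trace (\<rho>2 g) = mat_trace (\<sigma> g)"
        using \<sigma>c[OF g] by (simp add: mat_trace_def \<rho>1_def \<rho>2_def split)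
      also have "\<dots> = mat_trace (\<rho> g * P * Q)"
        unfolding \<sigma>_def using mat_trace_comm[OF PQ(2), of "\<rho> g * P"] c PQ(1) by simp
      also have "\<rho> g * P * Q = \<rho> g" using assoc_mult_mat[OF c PQ(1,2)] PQ(3) c by simp
      finally show "mat_trace (\<rho>1 g) + mat_trace (\<rho>2 g) = mat_trace (\<rho> g)" .
    qed
  qed
qed

text \<open>Matrices indexed by an arbitrary finite set, so that cosets, group elements and pairs
  can label basis vectors directly.\<close>

lemma module_char_family:
  fixes A :: "'a \<Rightarrow> 'i \<Rightarrow> 'i \<Rightarrow> complex"
  assumes G: "group G" and I: "finite I"
    and mult: "\<And>g h x y. g \<in> carrier G \<Longrightarrow> h \<in> carrier G \<Longrightarrow> x \<in> I \<Longrightarrow> y \<in> I \<Longrightarrow>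
                 A (g \<otimes>\<^bsub>G\<^esub> h) y x = (\<Sum>z\<in>I. A g y z * A h z x)"
    and one: "\<And>x y. x \<in> I \<Longrightarrow> y \<in> I \<Longrightarrow> A \<one>\<^bsub>G\<^esub> y x = (if y = x then 1 else 0)"
  shows "module_char G (\<lambda>g. \<Sum>x\<in>I. A g x x)"
proof -
  obtain e where e: "bij_betw e {..<card I} I"
    using ex_bij_betw_nat_finite[OF I] by (auto simp: lessThan_atLeast0)
  have eI: "e i \<in> I" if "i < card I" for i
    using e that by (auto simp: bij_betw_def)
  have inj: "e i = e j \<longleftrightarrow> i = j" if "i < card I" "j < card I" for i j
    using e that by (auto simp: bij_betw_def inj_on_def)
  define \<rho> where "\<rho> g = mat (card I) (card I) (\<lambda>(i, j). A g (e i) (e j))" for g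
  have "representation G (card I) \<rho>"
    unfolding representation_iff[OF G]
  proof (intro conjI ballI)
    show "\<rho> \<one>\<^bsub>G\<^esub> = 1\<^sub>m (card I)"
      by (rule eq_matI) (auto simp: \<rho>_def one eI inj)
    fix g h assume gh: "g \<in> carrier G" "h \<in> carrier G"
    show "\<rho> (g \<otimes>\<^bsub>G\<^esub> h) = \<rho> g * \<rho> h"
    proof (rule eq_matI)
      fix i j assume "i < dim_row (\<rho> g * \<rho> h)" "j < dim_col (\<rho> g * \<rho> h)"
      then have ij: "i < card I" "j < card I" by (simp_all add: \<rho>_def)
      have "\<rho> (g \<otimes>\<^bsub>G\<^esub> h) $$ (i, j) = (\<Sum>z\<in>I. A g (e i) z * A h z (e j))"
        using ij gh by (simp add: \<rho>_def mult eI)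
      also have "\<dots> = (\<Sum>l<card I. A g (e i) (e l) * A h (e l) (e j))"
        by (rule sum.reindex_bij_betw[OF e, symmetric])
      also have "\<dots> = (\<rho> g * \<rho> h) $$ (i, j)"
        using ij by (simp add: scalar_prod_def lessThan_atLeast0 \<rho>_def)
      finally show "\<rho> (g \<otimes>\<^bsub>G\<^esub> h) $$ (i, j) = (\<rho> g * \<rho> h) $$ (i, j)" .
    qed (simp_all add: \<rho>_def)
  qed (simp add: \<rho>_def)
  from module_char_representation[OF G this] show ?thesis
  proof (rule module_char_cong)
    fix g
    have "mat_trace (\<rho> g) = (\<Sum>i<card I. A g (e i) (e i))" by (simp add: mat_trace_def \<rho>_def)
    also have "\<dots> = (\<Sum>x\<in>I. A g x x)" by (rule sum.reindex_bij_betw[OF e])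
    finally show "mat_trace (\<rho> g) = (\<Sum>x\<in>I. A g x x)" .
  qed
qed

lemma module_char_action:
  assumes G: "group G" and I: "finite I"
    and closed: "\<And>g x. g \<in> carrier G \<Longrightarrow> x \<in> I \<Longrightarrow> act g x \<in> I"
    and mult: "\<And>g h x. g \<in> carrier G \<Longrightarrow> h \<in> carrier G \<Longrightarrow> x \<in> I \<Longrightarrow> act (g \<otimes>\<^bsub>G\<^esub> h) x = act g (act h x)"
    and one: "\<And>x. x \<in> I \<Longrightarrow> act \<one>\<^bsub>G\<^esub> x = x"
  shows "module_char G (\<lambda>g. of_nat (card {x\<in>I. act g x = x}))"
proof -
  have "module_char G (\<lambda>g. \<Sum>x\<in>I. if x = act g x then 1 else 0)"
  proof (rule module_char_family[where A="\<lambda>g y x. if y = act g x then 1 else 0", OF G I])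
    fix g h x y assume *: "g \<in> carrier G" "h \<in> carrier G" "x \<in> I" "y \<in> I"
    have "(\<Sum>z\<in>I. (if y = act g z then 1 else 0) * (if z = act h x then 1 else 0)) =
       (\<Sum>z\<in>I. if z = act h x then if y = act g z then 1 else (0::complex) else 0)"
      by (intro sum.cong) auto
    also have "\<dots> = (if y = act (g \<otimes>\<^bsub>G\<^esub> h) x then 1 else 0)"
      using I closed[OF *(2,3)] mult[OF *(1-3)] by (simp add: sum.delta)
    finally show "(if y = act (g \<otimes>\<^bsub>G\<^esub> h) x then 1 else (0::complex)) =
        (\<Sum>z\<in>I. (if y = act g z then 1 else 0) * (if z = act h x then 1 else 0))" by simp
  qed (auto simp: one)
  moreover have "(\<Sum>x\<in>I. if x = act g x then 1 else (0::complex)) = of_nat (card {x\<in>I. act g x = x})" for g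
  proof -
    have "{x\<in>I. x = act g x} = {x\<in>I. act g x = x}" by auto
    then show ?thesis using I by (simp flip: sum.inter_filter)
  qed
  ultimately show ?thesis by simp
qed

section \<open>Virtual characters and induction over cyclic subgroups\<close>

definition virtual_char :: "('a, 'b) monoid_scheme \<Rightarrow> ('a \<Rightarrow> complex) \<Rightarrow> bool" where
  "virtual_char G \<phi> \<longleftrightarrow> (\<exists>M\<in>virtual_modules G. \<forall>g\<in>carrier G. virtual_trace g M = \<phi> g)"

lemma virtual_char_module_char: "module_char G \<phi> \<Longrightarrow> virtual_char G \<phi>"
  by (auto simp: module_char_def virtual_char_def)

lemma virtual_char_cong:
  assumes "virtual_char G \<phi>" "\<And>g. g \<in> carrier G \<Longrightarrow> \<phi> g = \<psi> g"
  shows "virtual_char G \<psi>"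
  using assms unfolding virtual_char_def by auto

lemma virtual_char_sum:
  assumes "\<And>i. i \<in> I \<Longrightarrow> virtual_char G (\<phi> i)"
  shows "virtual_char G (\<lambda>g. \<Sum>i\<in>I. \<phi> i g)"
proof -
  obtain M where M: "\<And>i. i \<in> I \<Longrightarrow> M i \<in> virtual_modules G"
    "\<And>i g. i \<in> I \<Longrightarrow> g \<in> carrier G \<Longrightarrow> virtual_trace g (M i) = \<phi> i g"
    using assms unfolding virtual_char_def by metis
  then show ?thesis
    unfolding virtual_char_def
    by (intro bexI[of _ "\<Sum>i\<in>I. M i"]) (auto simp: virtual_trace_sum intro: virtual_modules_closed)
qed

text \<open>One shape for two uses: integer multiples, where the subtracted function is 0, and
  differences, where k = 1.\<close>

lemma virtual_char_lin:
  assumes "virtual_char G \<phi>" "virtual_char G \<psi>"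
  shows "virtual_char G (\<lambda>g. of_int k * \<phi> g - \<psi> g)"
proof -
  from assms obtain M N where "M \<in> virtual_modules G" "\<forall>g\<in>carrier G. virtual_trace g M = \<phi> g"
    "N \<in> virtual_modules G" "\<forall>g\<in>carrier G. virtual_trace g N = \<psi> g"
    unfolding virtual_char_def by metis
  then show ?thesis
    unfolding virtual_char_def
    by (intro bexI[of _ "frag_cmul k M + frag_cmul (-1) N"])
       (auto simp: virtual_trace_add virtual_trace_cmul simp del: frag_cmul_minus_one intro!: virtual_modules_closed)
qed

context group
begin

lemma conj_closed:
  assumes "x \<in> carrier G" "g \<in> carrier G"
  shows "inv x \<otimes> g \<otimes> x \<in> carrier G"
  using assms by simp

lemma ord_conj:
  assumes x: "x \<in> carrier G" and g: "g \<in> carrier G"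
  shows "ord (inv x \<otimes> g \<otimes> x) = ord g"
proof -
  have pow: "(inv x \<otimes> g \<otimes> x) [^] (n::nat) = inv x \<otimes> g [^] n \<otimes> x" for n
  proof (induction n)
    case 0
    then show ?case using x by simp
  next
    case (Suc n)
    have "x \<otimes> (inv x \<otimes> (g \<otimes> x)) = g \<otimes> x" using x g by (simp flip: m_assoc)
    then show ?case using Suc x g by (simp add: m_assoc)
  qed
  have "inv x \<otimes> h \<otimes> x = \<one> \<longleftrightarrow> h = \<one>" if h: "h \<in> carrier G" for h
  proof
    assume "inv x \<otimes> h \<otimes> x = \<one>"
    then have "x \<otimes> (inv x \<otimes> h \<otimes> x) \<otimes> inv x = \<one>" using x by simp
    moreover have "x \<otimes> (inv x \<otimes> h \<otimes> x) \<otimes> inv x = h"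
    proof -
      have "x \<otimes> (inv x \<otimes> (h \<otimes> x)) = h \<otimes> x" using x h by (simp flip: m_assoc)
      then show ?thesis using x h by (simp add: m_assoc)
    qed
    ultimately show "h = \<one>" by simp
  qed (use x in simp)
  then have "ord (inv x \<otimes> g \<otimes> x) dvd n \<longleftrightarrow> ord g dvd n" for n
    using x g by (simp flip: pow_eq_id add: pow)
  then show ?thesis by (meson dvd_antisym dvd_refl)
qed

text \<open>The coset x H is fixed by g exactly if x^(-1) g x lies in H, so the count is
  \<open>card H\<close> times the permutation character on the left cosets.\<close>

lemma virtual_char_conj_in_subgroup:
  assumes fin: "finite (carrier G)" and H: "subgroup H G"
  shows "virtual_char G (\<lambda>g. of_nat (card {x\<in>carrier G. inv x \<otimes> g \<otimes> x \<in> H}))"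
proof -
  interpret H: subgroup H G by fact
  have HG: "H \<subseteq> carrier G" by (rule H.subset)
  let ?I = "lcosets H"
  have I: "finite ?I" using fin by (simp add: LCOSETS_def)
  have sub: "C \<subseteq> carrier G" if "C \<in> ?I" for C
    using that H.lcosets_carrier[OF is_group that] by simp
  have mc: "module_char G (\<lambda>g. of_nat (card {C\<in>?I. g <# C = C}))"
  proof (rule module_char_action[OF is_group I])
    fix g C assume "g \<in> carrier G" "C \<in> ?I"
    then show "g <# C \<in> ?I"
      using HG by (auto simp: LCOSETS_def lcos_m_assoc intro!: bexI[of _ "g \<otimes> _"])
  next
    fix g h C assume "g \<in> carrier G" "h \<in> carrier G" "C \<in> ?I"
    then show "g \<otimes> h <# C = g <# (h <# C)" using sub by (simp add: lcos_m_assoc)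
  next
    fix C assume "C \<in> ?I"
    then show "\<one> <# C = C" using sub by (simp add: lcos_mult_one)
  qed
  have memC: "x \<in> C \<longleftrightarrow> x <# H = C" if x: "x \<in> carrier G" and C: "C \<in> ?I" for x C
  proof
    assume "x \<in> C"
    moreover obtain y where y: "y \<in> carrier G" "C = y <# H" using C by (auto simp: LCOSETS_def)
    ultimately show "x <# H = C" using l_repr_independence[OF _ y(1) H] by simp
  next
    assume "x <# H = C"
    then show "x \<in> C" using lcos_self[OF x H] by simp
  qed
  have iff: "inv x \<otimes> g \<otimes> x \<in> H \<longleftrightarrow> g <# (x <# H) = x <# H"
    if x: "x \<in> carrier G" and g: "g \<in> carrier G" for x g
  proof -
    have "g <# (x <# H) = (g \<otimes> x) <# H" using x g HG by (simp add: lcos_m_assoc)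
    moreover have "(g \<otimes> x) <# H = x <# H \<longleftrightarrow> g \<otimes> x \<in> x <# H"
      using memC[of "g \<otimes> x" "x <# H"] x g by (auto simp: LCOSETS_def)
    moreover have "g \<otimes> x \<in> x <# H \<longleftrightarrow> inv x \<otimes> g \<otimes> x \<in> H"
    proof
      assume "g \<otimes> x \<in> x <# H"
      then obtain h where h: "h \<in> H" "g \<otimes> x = x \<otimes> h" by (auto simp: l_coset_def)
      then have "inv x \<otimes> g \<otimes> x = inv x \<otimes> (x \<otimes> h)" using x g by (simp add: m_assoc)
      also have "\<dots> = h" using x h HG by (simp flip: m_assoc)
      finally show "inv x \<otimes> g \<otimes> x \<in> H" using h by simp
    next
      assume a: "inv x \<otimes> g \<otimes> x \<in> H"
      have "x \<otimes> (inv x \<otimes> g \<otimes> x) = g \<otimes> x" using x g by (simp flip: m_assoc)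
      then show "g \<otimes> x \<in> x <# H" using a by (force simp: l_coset_def)
    qed
    ultimately show ?thesis by simp
  qed
  have count: "card {x\<in>carrier G. inv x \<otimes> g \<otimes> x \<in> H} = card H * card {C\<in>?I. g <# C = C}"
    if g: "g \<in> carrier G" for g
  proof -
    let ?F = "{C\<in>?I. g <# C = C}"
    have "{x\<in>carrier G. inv x \<otimes> g \<otimes> x \<in> H} = \<Union> ?F"
    proof (intro equalityI subsetI)
      fix x assume "x \<in> {x\<in>carrier G. inv x \<otimes> g \<otimes> x \<in> H}"
      then have x: "x \<in> carrier G" "inv x \<otimes> g \<otimes> x \<in> H" by auto
      have "x <# H \<in> ?F" using x iff[OF x(1) g] by (auto simp: LCOSETS_def)
      then show "x \<in> \<Union> ?F" using lcos_self[OF x(1) H] by blast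
    next
      fix x assume "x \<in> \<Union> ?F"
      then obtain C where C: "C \<in> ?I" "g <# C = C" "x \<in> C" by auto
      then have x: "x \<in> carrier G" using sub by auto
      have "x <# H = C" using memC[OF x C(1)] C(3) by blast
      then have "inv x \<otimes> g \<otimes> x \<in> H" using iff[OF x g] C(2) by metis
      then show "x \<in> {x\<in>carrier G. inv x \<otimes> g \<otimes> x \<in> H}" using x by blast
    qed
    also have "card (\<Union> ?F) = sum card ?F"
    proof (rule card_Union_disjoint)
      show "pairwise disjnt ?F"
      proof (rule pairwiseI)
        fix C D assume CD: "C \<in> ?F" "D \<in> ?F" "C \<noteq> D"
        show "disjnt C D"
          unfolding disjnt_def
        proof (rule equals0I)
          fix x assume x: "x \<in> C \<inter> D"
          then have "x \<in> carrier G" using sub CD(1) by blast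
          then have "x <# H = C" "x <# H = D" using memC x CD(1,2) by blast+
          then show False using CD(3) by simp
        qed
      qed
      show "\<And>A. A \<in> ?F \<Longrightarrow> finite A" using sub fin finite_subset by fast
    qed
    also have "\<dots> = (\<Sum>C\<in>?F. card H)"
    proof (rule sum.cong)
      fix C assume "C \<in> ?F"
      then obtain y where y: "y \<in> carrier G" "C = y <# H" by (auto simp: LCOSETS_def)
      have "inj_on (\<lambda>h. y \<otimes> h) H" using y HG by (auto simp: inj_on_def)
      moreover have "C = (\<lambda>h. y \<otimes> h) ` H" by (auto simp: y l_coset_def)
      ultimately show "card C = card H" by (simp add: card_image)
    qed simp
    finally show ?thesis by simp
  qed
  \<comment> \<open>The empty sum is the zero character, which brings the multiple into the form of
    \<open>virtual_char_lin\<close>.\<close>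
  have "virtual_char G (\<lambda>g. of_int (int (card H)) * of_nat (card {C\<in>?I. g <# C = C}) - (\<Sum>i\<in>({} :: nat set). 0))"
    by (intro virtual_char_lin virtual_char_module_char mc virtual_char_sum) simp
  then show ?thesis by (rule virtual_char_cong) (simp add: count)
qed

text \<open>An element lies in the cyclic group K exactly if it generates K or a proper cyclic
  subgroup of K. The counts for the latter are virtual characters by induction on the size of K and
  are subtracted from the count for membership.\<close>

lemma virtual_char_conj_generates:
  assumes fin: "finite (carrier G)" and y: "y \<in> carrier G"
  shows "virtual_char G (\<lambda>g. of_nat (card {x\<in>carrier G. generate G {inv x \<otimes> g \<otimes> x} = generate G {y}}))"
  using y
proof (induction "card (generate G {y})" arbitrary: y rule: less_induct)
  case less
  let ?K = "generate G {y}"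
  have K: "subgroup ?K G" using less.prems by (simp add: generate_is_subgroup)
  have KG: "?K \<subseteq> carrier G" using subgroup.subset[OF K] .
  define L where "L = (\<lambda>z. generate G {z}) ` ?K - {?K}"
  have Lfin: "finite L" using KG fin by (auto simp: L_def intro: finite_subset)
  have gen_sub: "generate G {z} \<subseteq> ?K" if "z \<in> ?K" for z
    using that K by (intro generate_subgroup_incl) auto
  have "virtual_char G (\<lambda>g. \<Sum>J\<in>L. of_nat (card {x\<in>carrier G. generate G {inv x \<otimes> g \<otimes> x} = J}))"
  proof (rule virtual_char_sum)
    fix J assume "J \<in> L"
    then obtain z where z: "z \<in> ?K" "J = generate G {z}" "J \<noteq> ?K" by (auto simp: L_def)
    then have "J \<subset> ?K" using gen_sub by auto
    then have "card J < card ?K" using KG fin finite_subset psubset_card_mono by metis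
    then show "virtual_char G (\<lambda>g. of_nat (card {x\<in>carrier G. generate G {inv x \<otimes> g \<otimes> x} = J}))"
      using less.hyps[of z] z KG by auto
  qed
  note virtual_char_lin[OF virtual_char_conj_in_subgroup[OF fin K] this, of 1]
  then show ?case
  proof (rule virtual_char_cong)
    fix g assume g: "g \<in> carrier G"
    let ?S = "\<lambda>J. {x\<in>carrier G. generate G {inv x \<otimes> g \<otimes> x} = J}"
    have mem: "inv x \<otimes> g \<otimes> x \<in> ?K \<longleftrightarrow> generate G {inv x \<otimes> g \<otimes> x} \<in> insert ?K L"
      if x: "x \<in> carrier G" for x
    proof
      assume "inv x \<otimes> g \<otimes> x \<in> ?K"
      then show "generate G {inv x \<otimes> g \<otimes> x} \<in> insert ?K L" by (auto simp: L_def)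
    next
      assume "generate G {inv x \<otimes> g \<otimes> x} \<in> insert ?K L"
      then have "generate G {inv x \<otimes> g \<otimes> x} \<subseteq> ?K" using gen_sub by (auto simp: L_def)
      then show "inv x \<otimes> g \<otimes> x \<in> ?K" using generate.incl[of "inv x \<otimes> g \<otimes> x" "{inv x \<otimes> g \<otimes> x}"] by auto
    qed
    have "{x\<in>carrier G. inv x \<otimes> g \<otimes> x \<in> ?K} = (\<Union>J\<in>insert ?K L. ?S J)"
      using mem by auto
    also have "card \<dots> = (\<Sum>J\<in>insert ?K L. card (?S J))"
      using Lfin fin by (intro card_UN_disjoint) auto
    also have "\<dots> = card (?S ?K) + (\<Sum>J\<in>L. card (?S J))"
      using Lfin by (subst sum.insert) (auto simp: L_def)
    finally have "card {x\<in>carrier G. inv x \<otimes> g \<otimes> x \<in> ?K} = card (?S ?K) + (\<Sum>J\<in>L. card (?S J))" .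
    then have "(of_nat (card {x\<in>carrier G. inv x \<otimes> g \<otimes> x \<in> ?K}) :: complex) =
        of_nat (card (?S ?K)) + (\<Sum>J\<in>L. of_nat (card (?S J)))"
      by (simp only: of_nat_add of_nat_sum)
    then show "of_int 1 * of_nat (card {x\<in>carrier G. inv x \<otimes> g \<otimes> x \<in> ?K}) - (\<Sum>J\<in>L. of_nat (card (?S J))) =
        (of_nat (card (?S ?K)) :: complex)"
      by simp
  qed
qed

text \<open>Conjugation preserves orders. Summing over all cyclic subgroups of order m therefore
  counts every x exactly once if g has order m, and none otherwise.\<close>

lemma virtual_char_ord:
  assumes fin: "finite (carrier G)"
  shows "virtual_char G (\<lambda>g. if ord g = m then of_nat (card (carrier G)) else 0)"
proof -
  define L where "L = (\<lambda>z. generate G {z}) ` {z\<in>carrier G. ord z = m}"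
  have Lfin: "finite L" using fin by (simp add: L_def)
  have "virtual_char G (\<lambda>g. \<Sum>J\<in>L. of_nat (card {x\<in>carrier G. generate G {inv x \<otimes> g \<otimes> x} = J}))"
    using virtual_char_conj_generates[OF fin] by (intro virtual_char_sum) (auto simp: L_def)
  then show ?thesis
  proof (rule virtual_char_cong)
    fix g assume g: "g \<in> carrier G"
    let ?S = "\<lambda>J. {x\<in>carrier G. generate G {inv x \<otimes> g \<otimes> x} = J}"
    have mem: "generate G {inv x \<otimes> g \<otimes> x} \<in> L \<longleftrightarrow> ord g = m" if x: "x \<in> carrier G" for x
    proof
      assume "generate G {inv x \<otimes> g \<otimes> x} \<in> L"
      then obtain z where "z \<in> carrier G" "ord z = m" "generate G {inv x \<otimes> g \<otimes> x} = generate G {z}"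
        by (auto simp: L_def)
      then have "ord (inv x \<otimes> g \<otimes> x) = m"
        using generate_pow_card conj_closed[OF x g] by metis
      then show "ord g = m" using ord_conj[OF x g] by simp
    next
      assume "ord g = m"
      then show "generate G {inv x \<otimes> g \<otimes> x} \<in> L"
        using ord_conj[OF x g] conj_closed[OF x g] by (auto simp: L_def)
    qed
    have U: "(\<Union>J\<in>L. ?S J) = (if ord g = m then carrier G else {})" using mem by auto
    have "card (\<Union>J\<in>L. ?S J) = (\<Sum>J\<in>L. card (?S J))"
      using Lfin fin by (intro card_UN_disjoint) auto
    then have "(\<Sum>J\<in>L. card (?S J)) = card (if ord g = m then carrier G else {})"
      unfolding U by (rule sym)
    also have "\<dots> = (if ord g = m then card (carrier G) else 0)" by simp
    finally have "(\<Sum>J\<in>L. card (?S J)) = (if ord g = m then card (carrier G) else 0)" .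
    then have "(of_nat (\<Sum>J\<in>L. card (?S J)) :: complex) = (if ord g = m then of_nat (card (carrier G)) else 0)" by simp
    then show "(\<Sum>J\<in>L. of_nat (card (?S J))) = (if ord g = m then of_nat (card (carrier G)) else (0::complex))"
      by (simp only: of_nat_sum)
  qed
qed

end

text \<open>The augmentation representation is taken in the basis \<open>x - 1\<close> with \<open>x \<noteq> 1\<close>, where \<open>g\<close> sends
  \<open>x - 1\<close> to \<open>(g x - 1) - (g - 1)\<close>.\<close>

lemma (in group) module_char_mult_augmentation:
  assumes fin: "finite (carrier G)" and rep: "representation G n \<rho>"
  shows "module_char G (\<lambda>g. mat_trace (\<rho> g) * ((if g = \<one> then of_nat (card (carrier G)) else 0) - 1))"
proof -
  note G = is_group
  note R = rep[unfolded representation_iff[OF G]]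
  define I where "I = carrier G - {\<one>}"
  have I: "finite I" using fin by (simp add: I_def)
  define a :: "'a \<Rightarrow> 'a \<Rightarrow> 'a \<Rightarrow> complex"
    where "a g y x = (if y = g \<otimes> x then 1 else 0) - (if y = g then 1 else 0)" for g y x
  \<comment> \<open>The Kronecker product of \<rho> with the augmentation matrices
    \<open>a\<close>.\<close>
  define A where "A g = (\<lambda>(i, y) (j, x). \<rho> g $$ (i, j) * a g y x)" for g
  have a_mult: "a (g \<otimes> h) y x = (\<Sum>z\<in>I. a g y z * a h z x)"
    if gh: "g \<in> carrier G" "h \<in> carrier G" and x: "x \<in> I" and y: "y \<in> I" for g h x y
  proof -
    have xc: "x \<in> carrier G" "x \<noteq> \<one>" using x by (auto simp: I_def)
    have sum1: "(\<Sum>z\<in>I. f z * (if z = w then 1 else 0)) = (if w = \<one> then 0 else f w)"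
      if "w \<in> carrier G" for w and f :: "'a \<Rightarrow> complex"
    proof -
      have "(\<Sum>z\<in>I. f z * (if z = w then 1 else 0)) = (\<Sum>z\<in>I. if z = w then f z else 0)"
        by (intro sum.cong) auto
      then show ?thesis using I that by (auto simp: I_def)
    qed
    \<comment> \<open>The index \<one> stands for the zero vector \<one> - \<one>; hence leaving it
      out of \<open>I\<close> does not change the sums.\<close>
    have a1: "a g y \<one> = 0" using gh by (simp add: a_def)
    have "(\<Sum>z\<in>I. a g y z * a h z x) =
        (\<Sum>z\<in>I. a g y z * (if z = h \<otimes> x then 1 else 0)) - (\<Sum>z\<in>I. a g y z * (if z = h then 1 else 0))"
      unfolding a_def[of h] by (simp add: algebra_simps sum_subtractf)
    also have "\<dots> = a g y (h \<otimes> x) - a g y h"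
      using gh xc a1 by (simp add: sum1)
    also have "\<dots> = a (g \<otimes> h) y x"
      using gh xc by (simp add: a_def m_assoc)
    finally show ?thesis by simp
  qed
  have "module_char G (\<lambda>g. \<Sum>p\<in>{..<n} \<times> I. A g p p)"
  proof (rule module_char_family[where A=A and I="{..<n} \<times> I", OF G])
    show "finite ({..<n} \<times> I)" using I by simp
    fix p p' assume p: "p \<in> {..<n} \<times> I" "p' \<in> {..<n} \<times> I"
    obtain i y j x where eq: "p = (j, x)" "p' = (i, y)" by (metis surj_pair)
    have ij: "i < n" "j < n" "x \<in> I" "y \<in> I" using p by (auto simp: eq)
    have xy: "x \<in> carrier G" "x \<noteq> \<one>" "y \<noteq> \<one>" using ij by (auto simp: I_def)
    show "A \<one> p' p = (if p' = p then 1 else 0)"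
      using R ij xy by (auto simp: A_def eq a_def)
    fix g h assume gh: "g \<in> carrier G" "h \<in> carrier G"
    have c: "\<rho> g \<in> carrier_mat n n" "\<rho> h \<in> carrier_mat n n" using R gh by auto
    have "A (g \<otimes> h) p' p = (\<Sum>l<n. \<rho> g $$ (i, l) * \<rho> h $$ (l, j)) * (\<Sum>z\<in>I. a g y z * a h z x)"
      using R gh ij a_mult mat_mult_index[OF c] by (simp add: A_def eq)
    also have "\<dots> = (\<Sum>l<n. \<Sum>z\<in>I. (\<rho> g $$ (i, l) * \<rho> h $$ (l, j)) * (a g y z * a h z x))"
      by (rule sum_product)
    also have "\<dots> = (\<Sum>q\<in>{..<n} \<times> I. A g p' q * A h q p)"
      by (simp add: sum.cartesian_product A_def eq case_prod_unfold mult_ac)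
    finally show "A (g \<otimes> h) p' p = (\<Sum>q\<in>{..<n} \<times> I. A g p' q * A h q p)" .
  qed
  then show ?thesis
  proof (rule module_char_cong)
    fix g assume g: "g \<in> carrier G"
    have c: "\<rho> g \<in> carrier_mat n n" using R g by auto
    have "(\<Sum>x\<in>I. a g x x) = (if g = \<one> then of_nat (card (carrier G)) else 0) - 1"
    proof (cases "g = \<one>")
      case True
      then have "(\<Sum>x\<in>I. a g x x) = (\<Sum>x\<in>I. 1)"
        by (intro sum.cong) (auto simp: a_def I_def)
      also have "\<dots> = of_nat (card (carrier G)) - 1"
      proof -
        have "card (carrier G) = Suc (card I)" using card_Suc_Diff1[OF fin one_closed] by (simp only: I_def)
        then show ?thesis by simp
      qed
      finally show ?thesis using True by simp
    next
      case False
      have "(\<Sum>x\<in>I. a g x x) = (\<Sum>x\<in>I. if x = g then - 1 else 0)"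
      proof (intro sum.cong refl)
        fix x assume "x \<in> I"
        then have "x \<noteq> g \<otimes> x" using False g r_cancel_one'[of x g] by (auto simp: I_def)
        then show "a g x x = (if x = g then - 1 else 0)" by (simp add: a_def)
      qed
      also have "\<dots> = - 1" using I g False by (simp add: I_def)
      finally show ?thesis using False by simp
    qed
    moreover have "(\<Sum>p\<in>{..<n} \<times> I. A g p p) = (\<Sum>i<n. \<rho> g $$ (i, i)) * (\<Sum>x\<in>I. a g x x)"
      by (simp add: sum_product sum.cartesian_product A_def case_prod_unfold)
    moreover have "(\<Sum>i<n. \<rho> g $$ (i, i)) = mat_trace (\<rho> g)" using c by (simp add: mat_trace_def)
    ultimately show "(\<Sum>p\<in>{..<n} \<times> I. A g p p) =
        mat_trace (\<rho> g) * ((if g = \<one> then of_nat (card (carrier G)) else 0) - 1)"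
      by simp
  qed
qed

text \<open>Every irreducible \<open>\<sigma>\<close> is a constituent of \<open>\<sigma> \<otimes> \<complex>[G] = \<sigma> \<oplus> (\<sigma> \<otimes> augmentation)\<close>,
  whose character vanishes off the identity.\<close>

lemma (in group) irrep_in_multiple_of_regular:
  assumes fin: "finite (carrier G)" and C: "C \<in> Irr G"
  shows "\<exists>M\<in>virtual_modules G. genuine M \<and> Poly_Mapping.lookup M C \<ge> 1 \<and>
     (\<exists>c::nat. \<forall>g\<in>carrier G. virtual_trace g M = (if g = \<one> then of_nat c else 0))"
proof -
  note G = is_group
  obtain \<rho> where \<rho>: "\<rho> \<in> irreps G" "C = rep_iso G `` {\<rho>}"
    using C by (auto simp: Irr_def quotient_def)
  then obtain n where "irreducible_representation G n \<rho>" by (auto simp: irreps_def)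
  then have rep: "representation G n \<rho>" by (simp add: irreducible_representation_def)
  then have tr1: "mat_trace (\<rho> \<one>) = of_nat n"
    by (simp add: representation_iff[OF G] mat_trace_def)
  obtain N where N: "N \<in> virtual_modules G" "genuine N"
    "\<And>g. g \<in> carrier G \<Longrightarrow> virtual_trace g N =
       mat_trace (\<rho> g) * ((if g = \<one> then of_nat (card (carrier G)) else 0) - 1)"
    using module_char_mult_augmentation[OF fin rep] unfolding module_char_def by blast
  have "virtual_trace g (frag_of C + N) = (if g = \<one> then of_nat (n * card (carrier G)) else 0)"
    if "g \<in> carrier G" for g
    using that frag_of_irrep(2)[OF G \<rho>(1)] N(3)
    by (simp add: virtual_trace_add \<rho>(2) tr1 algebra_simps)
  moreover have "frag_of C + N \<in> virtual_modules G"
    using frag_of_irrep(1)[OF G \<rho>(1)] N(1) by (simp add: \<rho>(2) virtual_modules_closed)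
  moreover have "Poly_Mapping.lookup (frag_of C + N) C \<ge> 1"
    using N(2) by (simp add: lookup_add genuine_def)
  ultimately show ?thesis
    using N(2) by (intro bexI[of _ "frag_of C + N"] conjI exI[of _ "n * card (carrier G)"] genuine_closed ballI) auto
qed

text \<open>The range starts at m = 2 because \<open>W1\<close> takes over the role of the identity.
  As its trace vanishes elsewhere, it can be made large enough to outweigh all \<open>W m\<close>
  without affecting other elements.\<close>

lemma (in group) dominating_virtual_modules:
  assumes fin: "finite (carrier G)"
  obtains c :: nat and W1 and W :: "nat \<Rightarrow> 'a virtual_module"
  where "c > 0" "W1 \<in> virtual_modules G" "\<And>m. W m \<in> virtual_modules G"
    "\<And>g. g \<in> carrier G \<Longrightarrow> virtual_trace g W1 = (if g = \<one> then of_nat c else 0)"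
    "\<And>g m. g \<in> carrier G \<Longrightarrow>
       virtual_trace g (W m) = (if ord g = m then of_nat (card (carrier G)) else 0)"
    "\<And>C. (\<Sum>m\<in>{2..card (carrier G)}. \<bar>Poly_Mapping.lookup (W m) C\<bar>) \<le> Poly_Mapping.lookup W1 C"
proof -
  note G = is_group
  have "\<forall>m. \<exists>M\<in>virtual_modules G. \<forall>g\<in>carrier G.
      virtual_trace g M = (if ord g = m then of_nat (card (carrier G)) else 0)"
    using virtual_char_ord[OF fin] unfolding virtual_char_def by blast
  then obtain W where "\<forall>m. W m \<in> virtual_modules G \<and> (\<forall>g\<in>carrier G.
      virtual_trace g (W m) = (if ord g = m then of_nat (card (carrier G)) else 0))"
    unfolding Bex_def by (rule choice[THEN exE])
  then have W: "\<And>m. W m \<in> virtual_modules G"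
    "\<And>g m. g \<in> carrier G \<Longrightarrow> virtual_trace g (W m) = (if ord g = m then of_nat (card (carrier G)) else 0)"
    by blast+
  have "\<exists>M (c::nat). C \<in> Irr G \<longrightarrow> M \<in> virtual_modules G \<and> genuine M \<and> Poly_Mapping.lookup M C \<ge> 1 \<and>
     (\<forall>g\<in>carrier G. virtual_trace g M = (if g = \<one> then of_nat c else 0))" for C
    using irrep_in_multiple_of_regular[OF fin, of C] by blast
  then have "\<forall>C. \<exists>M. \<exists>c::nat. C \<in> Irr G \<longrightarrow> M \<in> virtual_modules G \<and> genuine M \<and> Poly_Mapping.lookup M C \<ge> 1 \<and>
     (\<forall>g\<in>carrier G. virtual_trace g M = (if g = \<one> then of_nat c else 0))"
    by blast
  from choice[OF this] obtain N where "\<forall>C. \<exists>c::nat. C \<in> Irr G \<longrightarrow> N C \<in> virtual_modules G \<and>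
     genuine (N C) \<and> Poly_Mapping.lookup (N C) C \<ge> 1 \<and>
     (\<forall>g\<in>carrier G. virtual_trace g (N C) = (if g = \<one> then of_nat c else 0))" ..
  from choice[OF this] obtain c where Nc: "\<forall>C. C \<in> Irr G \<longrightarrow> N C \<in> virtual_modules G \<and>
     genuine (N C) \<and> Poly_Mapping.lookup (N C) C \<ge> 1 \<and>
     (\<forall>g\<in>carrier G. virtual_trace g (N C) = (if g = \<one> then of_nat (c C) else 0))" ..
  then have N: "\<And>C. C \<in> Irr G \<Longrightarrow> N C \<in> virtual_modules G" "\<And>C. C \<in> Irr G \<Longrightarrow> genuine (N C)"
    "\<And>C. C \<in> Irr G \<Longrightarrow> Poly_Mapping.lookup (N C) C \<ge> 1"
    and c: "\<And>C g. C \<in> Irr G \<Longrightarrow> g \<in> carrier G \<Longrightarrow>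
      virtual_trace g (N C) = (if g = \<one> then of_nat (c C) else 0)"
    by blast+
  have "module_char G (\<lambda>g. of_nat (card {x\<in>carrier G. g \<otimes> x = x}))"
    by (rule module_char_action[OF G fin]) (auto simp: m_assoc)
  then obtain R where R: "R \<in> virtual_modules G" "genuine R"
    "\<And>g. g \<in> carrier G \<Longrightarrow> virtual_trace g R = of_nat (card {x\<in>carrier G. g \<otimes> x = x})"
    unfolding module_char_def by blast
  have R': "virtual_trace g R = (if g = \<one> then of_nat (card (carrier G)) else 0)" if "g \<in> carrier G" for g
  proof -
    have "{x\<in>carrier G. g \<otimes> x = x} = (if g = \<one> then carrier G else {})"
      using that by auto
    then show ?thesis using R(3)[OF that] by simp
  qed
  define S where "S = {2..card (carrier G)}"
  define K where "K = (\<Union>m\<in>S. Poly_Mapping.keys (W m))"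
  have K: "finite K" "K \<subseteq> Irr G" using W(1) by (auto simp: K_def S_def virtual_modules_iff)
  define b where "b C = (\<Sum>m\<in>S. \<bar>Poly_Mapping.lookup (W m) C\<bar>)" for C
  have b: "b C \<ge> 0" for C by (simp add: b_def sum_nonneg)
  \<comment> \<open>\<open>N C\<close> contains \<open>C\<close> at least once, so
    \<open>b C\<close> copies outweigh the multiplicities of \<open>C\<close>. The regular module
    \<open>R\<close> makes the trace at \<one> positive even if \<open>K\<close> is empty.\<close>
  define W1 where "W1 = R + (\<Sum>C\<in>K. frag_cmul (b C) (N C))"
  show thesis
  proof (rule that)
    show "card (carrier G) + (\<Sum>C\<in>K. nat (b C) * c C) > 0"
      using fin by (auto simp: card_gt_0_iff)
    show "W1 \<in> virtual_modules G"
      unfolding W1_def using N(1) K(2) R(1) by (intro virtual_modules_closed) auto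
    show "W m \<in> virtual_modules G" for m by (rule W(1))
    show "virtual_trace g (W m) = (if ord g = m then of_nat (card (carrier G)) else 0)"
      if "g \<in> carrier G" for g m using W(2)[OF that] .
    show "virtual_trace g W1 = (if g = \<one> then of_nat (card (carrier G) + (\<Sum>C\<in>K. nat (b C) * c C)) else 0)"
      if g: "g \<in> carrier G" for g
    proof -
      have "(\<Sum>C\<in>K. virtual_trace g (frag_cmul (b C) (N C))) =
          (\<Sum>C\<in>K. if g = \<one> then of_nat (nat (b C) * c C) else 0)"
        using K(2) g b by (intro sum.cong) (auto simp: virtual_trace_cmul c)
      then show ?thesis
        using g by (simp add: W1_def virtual_trace_add virtual_trace_sum R')
    qed
    show "(\<Sum>m\<in>{2..card (carrier G)}. \<bar>Poly_Mapping.lookup (W m) C\<bar>) \<le> Poly_Mapping.lookup W1 C" for C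
    proof -
      have nn: "0 \<le> b D * Poly_Mapping.lookup (N D) C" if "D \<in> K" for D
        using b N(2) K(2) that by (auto simp: genuine_def)
      have "b C \<le> (\<Sum>D\<in>K. b D * Poly_Mapping.lookup (N D) C)"
      proof (cases "C \<in> K")
        case True
        then have "Poly_Mapping.lookup (N C) C \<ge> 1" using N(3) K(2) by blast
        then have "b C * 1 \<le> b C * Poly_Mapping.lookup (N C) C"
          using b by (intro mult_left_mono) auto
        also have "\<dots> \<le> (\<Sum>D\<in>K. b D * Poly_Mapping.lookup (N D) C)"
          using True K(1) nn by (intro member_le_sum) auto
        finally show ?thesis by simp
      next
        case False
        then have "b C = 0" by (auto simp: b_def K_def in_keys_iff)
        then show ?thesis using nn by (simp add: sum_nonneg)
      qed
      then show ?thesis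
        using R(2) by (simp add: W1_def b_def S_def lookup_add lookup_sum genuine_def add_increasing)
    qed
  qed
qed

section \<open>The graded virtual module\<close>

lemma trace_quotient_qexp:
  assumes \<tau>: "Im \<tau> > 0" and x: "x = qexp (\<tau> / 2)"
  shows "qexp \<tau> * trace_quotient \<tau> =
    2 ^ 24 * (x\<^sup>2) ^ 3 * (euler_phi ((x\<^sup>2)\<^sup>2) / euler_phi (x\<^sup>2)) ^ 48 + (odd_phi x ^ 48 + odd_phi (- x) ^ 48)"
proof -
  have q: "qexp \<tau> = x\<^sup>2" by (simp add: x power2_eq_square flip: qexp_add)
  have q2: "qexp (2 * \<tau>) = (x\<^sup>2)\<^sup>2"
    using qexp_of_nat_mult[of 2 \<tau>] by (simp add: q)
  have q3: "qexp ((\<tau> + 1) / 2) = - x" by (simp add: x add_divide_distrib qexp_add qexp_half)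
  have x0: "x \<noteq> 0" by (simp add: x)
  \<comment> \<open>\<open>C\<close> and \<open>D\<close> stand for \<open>euler_phi\<close> at x
    and - x, from the arguments \<tau> / 2 and (\<tau> + 1) / 2; the sign in \<open>- y\<close>
    disappears on squaring.\<close>
  have alg: "X * (2 ^ 24 * ((X\<^sup>2 * A ^ 24) / (X * B ^ 24))\<^sup>2 + ((y * C ^ 24) / (X * B ^ 24))\<^sup>2 +
      ((- y * D ^ 24) / (X * B ^ 24))\<^sup>2) = 2 ^ 24 * X ^ 3 * (A / B) ^ 48 + ((D / B) ^ 48 + (C / B) ^ 48)"
    if "X = y\<^sup>2" "y \<noteq> 0" "B \<noteq> 0" for X y A B C D :: complex
    using that by (simp add: power_divide field_simps power_mult_distrib flip: power_mult power_add)
  have "euler_phi (x\<^sup>2) \<noteq> 0" using euler_phi_nonzero \<tau> by (simp flip: q)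
  from alg[OF refl x0 this] show ?thesis
    unfolding trace_quotient_def Delta_def q q2 q3 x [symmetric] odd_phi_def by simp
qed

text \<open>\<open>has_sum\<close> is unordered and so requires absolute convergence, which follows
  from convergence at a point of larger norm.\<close>

lemma power_series_has_sum:
  fixes e :: "nat \<Rightarrow> complex"
  assumes sums: "\<And>x. norm x < 1 \<Longrightarrow> (\<lambda>n. e n * x ^ n) sums f x" and x: "norm x < 1"
  shows "((\<lambda>n. e n * x ^ n) has_sum f x) UNIV"
proof (rule norm_summable_imp_has_sum[OF _ sums[OF x]])
  obtain r where r: "norm x < r" "r < 1" using dense[OF x] by blast
  have "norm (of_real r :: complex) < 1" using r by (smt (verit) norm_ge_zero norm_of_real real_norm_def)
  then have "summable (\<lambda>n. e n * of_real r ^ n)" using sums sums_summable by blast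
  then show "summable (\<lambda>n. norm (e n * x ^ n))"
    by (rule powser_insidea) (use r in auto)
qed

text \<open>The coefficient with index k sits in degree k - 1, which enumerates
  \<open>degrees 1\<close>. This shift is the factor \<open>qexp \<tau>\<close> in the hypothesis on
  \<open>F\<close>.\<close>

lemma mckay_thompson_sum:
  assumes tr: "\<And>k. virtual_trace g (V (int k - 1)) = C * e k"
    and sums: "\<And>x. norm x < 1 \<Longrightarrow> (\<lambda>k. e k * x ^ k) sums f x"
    and F: "\<And>\<tau>. Im \<tau> > 0 \<Longrightarrow> qexp \<tau> * F \<tau> = f (qexp \<tau>)"
  shows "mckay_thompson_converges 1 V g"
    and "\<tau> \<in> upper_half_plane \<Longrightarrow> mckay_thompson 1 V g \<tau> = C * F \<tau>"
proof -
  have hs: "(mckay_thompson_term V g \<tau> has_sum C * F \<tau>) (degrees 1)" if "\<tau> \<in> upper_half_plane" for \<tau>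
  proof -
    have \<tau>: "Im \<tau> > 0" using that by (simp add: upper_half_plane_def)
    have bij: "bij_betw (\<lambda>k. int k - 1) UNIV (degrees 1)"
    proof (rule bij_betwI[where g = "\<lambda>n. nat (n + 1)"])
      show "(\<lambda>k. int k - 1) \<in> UNIV \<rightarrow> degrees 1"
      proof
        fix k :: nat
        show "int k - 1 \<in> degrees 1"
          by (cases k) (auto simp: degrees_def)
      qed
    qed (auto simp: degrees_def)
    have trm: "mckay_thompson_term V g \<tau> (int k - 1) = C / qexp \<tau> * (e k * qexp \<tau> ^ k)" for k
      by (simp add: mckay_thompson_term_def tr power_int_diff flip: qexp_def)
    have "((\<lambda>k. C / qexp \<tau> * (e k * qexp \<tau> ^ k)) has_sum C / qexp \<tau> * f (qexp \<tau>)) UNIV"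
      by (intro has_sum_cmult_right power_series_has_sum sums) (use \<tau> in auto)
    also have "C / qexp \<tau> * f (qexp \<tau>) = C * F \<tau>" using F[OF \<tau>] by (simp flip: F[OF \<tau>])
    finally show ?thesis
      using has_sum_reindex_bij_betw[OF bij, of "mckay_thompson_term V g \<tau>" "C * F \<tau>"] by (simp add: trm)
  qed
  then show "mckay_thompson_converges 1 V g"
    by (auto simp: mckay_thompson_converges_def intro: has_sum_imp_summable)
  show "\<tau> \<in> upper_half_plane \<Longrightarrow> mckay_thompson 1 V g \<tau> = C * F \<tau>"
    using infsumI[OF hs] by (simp add: mckay_thompson_def)
qed

theorem theorem4p1:
  fixes G :: "('a, 'b) monoid_scheme"
  assumes "group G" and "finite (carrier G)"
  shows "\<exists>d>0. \<exists>V. graded_virtual_module G d V \<and> infinite_dimensional V \<and>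
           (\<forall>g\<in>carrier G. mckay_thompson_converges d V g \<and>
              strictly_of_level (group.ord G g) (mckay_thompson d V g)) \<and>
           finite {n. \<not> genuine (V n)}"
proof -
  have one: "\<one>\<^bsub>G\<^esub> \<in> carrier G" using assms(1) by (simp add: group.is_monoid monoid.one_closed)
  define N where "N = card (carrier G)"
  have N: "N > 0" using one assms(2) by (auto simp: N_def card_gt_0_iff)
  obtain c :: nat and W1 :: "'a virtual_module" and W :: "nat \<Rightarrow> 'a virtual_module" where c: "c > 0" and W1: "W1 \<in> virtual_modules G"
    and W: "\<And>m. W m \<in> virtual_modules G"
    and trW1: "\<And>g. g \<in> carrier G \<Longrightarrow> virtual_trace g W1 = (if g = \<one>\<^bsub>G\<^esub> then of_nat c else 0)"
    and trW: "\<And>g m. g \<in> carrier G \<Longrightarrow>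
       virtual_trace g (W m) = (if group.ord G g = m then of_nat N else 0)"
    and dom: "\<And>C. (\<Sum>m\<in>{2..N}. \<bar>Poly_Mapping.lookup (W m) C\<bar>) \<le> Poly_Mapping.lookup W1 C"
    unfolding N_def
  proof (rule group.dominating_virtual_modules[OF assms], goal_cases)
    case (1 c W1 W)
    show ?case by (rule 1(1)[OF 1(2-)])
  qed
  obtain a :: "nat \<Rightarrow> nat" and b :: "nat \<Rightarrow> nat \<Rightarrow> nat" where
    a: "\<And>x. norm x < 1 \<Longrightarrow> (\<lambda>n. of_nat (a n) * (x\<^sup>2) ^ n) sums
       (2 ^ 24 * (x\<^sup>2) ^ 3 * (euler_phi ((x\<^sup>2)\<^sup>2) / euler_phi (x\<^sup>2)) ^ 48 + (odd_phi x ^ 48 + odd_phi (- x) ^ 48))"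
    and b: "\<And>m x. m \<ge> 1 \<Longrightarrow> norm x < 1 \<Longrightarrow>
       (\<lambda>n. of_nat (b m n) * x ^ n) sums (x ^ m * (euler_phi (x ^ m) / euler_phi x) ^ 24)"
    and ba: "\<And>m n. m \<ge> 1 \<Longrightarrow> b m n \<le> a n" and apos: "\<And>n. a n > 0"
  proof (rule coefficient_domination, goal_cases)
    case (1 a b)
    show ?case by (rule 1(1)[OF 1(2-)])
  qed
  define S where "S q = suminf (\<lambda>n. of_nat (a n) * q ^ n)" for q :: complex
  have S: "(\<lambda>n. of_nat (a n) * q ^ n) sums S q" if "norm q < 1" for q :: complex
  proof -
    \<comment> \<open>The sum of the series was stated in terms of a square root x of q.\<close>
    have "norm (csqrt q) < 1" using that by (simp add: norm_csqrt real_sqrt_lt_1_iff)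
    then have "summable (\<lambda>n. of_nat (a n) * q ^ n :: complex)" using a[of "csqrt q"] by (simp add: sums_iff)
    then show ?thesis by (simp add: S_def summable_sums)
  qed
  have S_hol: "S holomorphic_on ball 0 1"
    by (rule power_series_holomorphic[where a = "\<lambda>n. of_nat (a n)"]) (use S in simp)
  have S_eq: "qexp \<tau> * trace_quotient \<tau> = S (qexp \<tau>)" if \<tau>: "Im \<tau> > 0" for \<tau>
  proof -
    have "norm (qexp (\<tau> / 2)) < 1" using \<tau> by simp
    from a[OF this] have "(\<lambda>n. of_nat (a n) * qexp \<tau> ^ n) sums (qexp \<tau> * trace_quotient \<tau>)"
      unfolding trace_quotient_qexp[OF \<tau> refl] by (simp add: power2_eq_square flip: qexp_add)
    then show ?thesis by (simp add: S_def sums_iff)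
  qed
  \<comment> \<open>The lowest degree - 1 carries the coefficients with index 0.\<close>
  define V :: "int \<Rightarrow> 'a virtual_module" where
    "V n = (if n < - 1 then 0 else frag_cmul (int (a (nat (n + 1)))) W1 +
        (\<Sum>m\<in>{2..N}. frag_cmul (int (b m (nat (n + 1)))) (W m)))" for n
  have trV: "virtual_trace g (V (int k - 1)) =
      (if g = \<one>\<^bsub>G\<^esub> then of_nat c * of_nat (a k) else of_nat N * of_nat (b (group.ord G g) k))"
    if g: "g \<in> carrier G" for g k
  proof -
    interpret group G by (rule assms(1))
    have "virtual_trace g (V (int k - 1)) =
        of_nat (a k) * virtual_trace g W1 + (\<Sum>m\<in>{2..N}. of_nat (b m k) * virtual_trace g (W m))"
      by (simp add: V_def virtual_trace_add virtual_trace_sum virtual_trace_cmul)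
    also have "(\<Sum>m\<in>{2..N}. of_nat (b m k) * virtual_trace g (W m)) =
        (\<Sum>m\<in>{2..N}. if ord g = m then of_nat (b m k) * of_nat N else 0)"
      by (intro sum.cong) (simp_all add: trW[OF g])
    also have "\<dots> = (if ord g \<in> {2..N} then of_nat (b (ord g) k) * of_nat N else 0)"
      by simp
    \<comment> \<open>Orders lie between 1 and N, so each g other than the identity meets exactly
      one \<open>W m\<close>, and the identity meets none.\<close>
    also have "ord g \<in> {2..N} \<longleftrightarrow> g \<noteq> \<one>\<^bsub>G\<^esub>"
    proof -
      have "ord g \<ge> 1" "ord g \<le> N" "ord g = 1 \<longleftrightarrow> g = \<one>\<^bsub>G\<^esub>"
        using ord_ge_1[OF assms(2) g] ord_le_group_order[OF assms(2) g] ord_eq_1[OF g]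
        by (simp_all add: N_def order_def)
      then show ?thesis by auto
    qed
    finally show ?thesis by (simp add: trW1[OF g])
  qed
  have gen: "genuine (V n)" for n
  proof (cases "n < - 1")
    case False
    define k where "k = nat (n + 1)"
    have "0 \<le> Poly_Mapping.lookup (V n) C" for C
    proof -
      \<comment> \<open>The negative part of the sum over m is at most \<open>a k\<close> times the
        total absolute multiplicity, by \<open>ba\<close>; by \<open>dom\<close> the summand with
        \<open>W1\<close> makes up for it.\<close>
      have "- (int (a k) * (\<Sum>m\<in>{2..N}. \<bar>Poly_Mapping.lookup (W m) C\<bar>)) \<le>
          (\<Sum>m\<in>{2..N}. int (b m k) * Poly_Mapping.lookup (W m) C)"
        unfolding sum_distrib_left sum_negf [symmetric]
      proof (rule sum_mono)
        fix m assume "m \<in> {2..N}"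
        then have "int (b m k) * \<bar>Poly_Mapping.lookup (W m) C\<bar> \<le> int (a k) * \<bar>Poly_Mapping.lookup (W m) C\<bar>"
          using ba[of m k] by (intro mult_right_mono) auto
        moreover have "- (int (b m k) * \<bar>Poly_Mapping.lookup (W m) C\<bar>) \<le> int (b m k) * Poly_Mapping.lookup (W m) C"
          unfolding mult_minus_right [symmetric] by (intro mult_left_mono) auto
        ultimately show "- (int (a k) * \<bar>Poly_Mapping.lookup (W m) C\<bar>) \<le> int (b m k) * Poly_Mapping.lookup (W m) C"
          by linarith
      qed
      moreover have "int (a k) * (\<Sum>m\<in>{2..N}. \<bar>Poly_Mapping.lookup (W m) C\<bar>) \<le> int (a k) * Poly_Mapping.lookup W1 C"
        by (intro mult_left_mono dom) simp
      ultimately show ?thesis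
        using False by (simp add: V_def lookup_add lookup_sum k_def)
    qed
    then show ?thesis by (simp add: genuine_def)
  qed (simp add: V_def genuine_closed)
  have "graded_virtual_module G 1 V"
    unfolding graded_virtual_module_def
  proof (intro conjI allI impI)
    show "V n \<in> virtual_modules G" for n
      unfolding V_def using W W1 by (auto intro!: virtual_modules_closed)
    show "V n = 0" if "n \<notin> degrees 1" for n
    proof -
      have "n \<noteq> - 1" "n \<notin> range int" using that by (auto simp: degrees_def)
      then have "n < - 1" by (metis nonneg_int_cases rangeI not_less int_one_le_iff_zero_less le_less linorder_neqE_linordered_idom zle_add1_eq_le add.left_inverse)
      then show ?thesis by (simp add: V_def)
    qed
  qed
  moreover have "infinite_dimensional V"
    unfolding infinite_dimensional_def
  proof (rule infinite_super)
    show "(\<lambda>k. int k - 1) ` UNIV \<subseteq> {n. V n \<noteq> 0}"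
    proof clarsimp
      fix k assume "V (int k - 1) = 0"
      \<comment> \<open>The trace of the identity in degree k - 1 is the product of the positive
        numbers \<open>c\<close> and \<open>a k\<close>.\<close>
      then have "of_nat c * of_nat (a k) = (0 :: complex)" using trV[OF one, of k] by simp
      then show False using c apos[of k] by simp
    qed
    show "infinite ((\<lambda>k. int k - 1) ` (UNIV :: nat set))"
      by (rule range_inj_infinite) (auto simp: inj_on_def)
  qed
  moreover have "mckay_thompson_converges 1 V g \<and> strictly_of_level (group.ord G g) (mckay_thompson 1 V g)"
    if g: "g \<in> carrier G" for g
  proof (cases "g = \<one>\<^bsub>G\<^esub>")
    case True
    have tr: "virtual_trace g (V (int k - 1)) = of_nat c * of_nat (a k)" for k
      using trV[OF g] True by simp
    note sum = mckay_thompson_sum[where V = V and C = "of_nat c" and F = trace_quotient, OF tr S S_eq]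
    have "group.ord G g = 1" using True group.ord_eq_1[OF assms(1) g] by simp
    moreover have "strictly_of_level 1 (mckay_thompson 1 V g)"
      by (rule strictly_of_level_cong[OF trace_quotient_strictly_of_level[OF S_hol S_eq, of "of_nat c"]])
         (assumption, rule sum(2) [symmetric])
    ultimately show ?thesis using sum(1) by simp
  next
    case False
    define m where "m = group.ord G g"
    have m: "m \<ge> 1" unfolding m_def by (rule group.ord_ge_1[OF assms g])
    have tr: "virtual_trace g (V (int k - 1)) = of_nat N * of_nat (b m k)" for k
      using trV[OF g] False by (simp add: m_def)
    note sum = mckay_thompson_sum[where V = V and C = "of_nat N" and F = "delta_quotient m",
      OF tr b[OF m] delta_quotient_qexp]
    have "strictly_of_level m (mckay_thompson 1 V g)"
      by (rule strictly_of_level_cong[OF delta_quotient_strictly_of_level[OF m, of "of_nat N"]])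
         (use N in simp, rule sum(2) [symmetric])
    then show ?thesis using sum(1) by (simp add: m_def)
  qed
  moreover have "finite {n. \<not> genuine (V n)}" by (simp add: gen)
  ultimately show ?thesis by (intro exI[of _ "1 :: nat"] conjI exI[of _ V] ballI) auto
qed

end
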